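(* Let $N$, $\mathfrak n=\bigoplus_{j=1}^{m+1}V_j$ ($m\ge1$), $\mathcal B=\{X_1,\dots,X_p\}$, $L=\sum_{i=1}^pX_i^2$, $\ell_2$ and $\mathcal S$ be as in the context, and assume that $X_p$ belongs to the center of $\mathfrak n$, that $\#\mathcal S=2$, and that the two elements of $\mathcal S$ commute. Then there is a smooth solution $u$ of $Lu=0$ in a neighborhood of the identity of $N$ which is Gevrey of order exactly $m+1$ at the identity, in the sense that $g(a)=u(\exp(aX_{m+1,\beta}))$ satisfies $c^{\sigma+1}(\sigma!)^{m+1}\le|g^{(\sigma)}(0)|\le C^{\sigma+1}(\sigma!)^{m+1}$ for all $\sigma\ge0$, for some constants $c,C>0$.
   Context: Let $N$ be a connected, simply connected nilpotent Lie group whose Lie algebra $\mathfrak n$ (identified with the left-invariant vector fields on $N$) is stratified: $\mathfrak n=\bigoplus_{j=1}^{m+1}V_j$ with finite-dimensional subspaces $V_j$, $m\ge1$, $[V_i,V_j]\subseteq V_{i+j}$ if $i+j\le m+1$, $[V_i,V_j]=0$ if $i+j>m+1$, and $V_1$ generating $\mathfrak n$ as a Lie algebra. Let $\mathcal B=\{X_1,\dots,X_p\}$ be a basis of $V_1$ and $L=\sum_{i=1}^pX_i^2$. Fix a basis $\{X_{m+1,j}\}$ of $V_{m+1}$ and an index $\beta$, and let $\ell_2\in\mathfrak n^*$ be defined by $\ell_2|_{V_i}=0$ for $i\le m$ and $\ell_2(X_{m+1,j})=\delta_{j\beta}$; assume $\ell_2([V_k,V_j])=0$ for all $k,j\ge2$.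 The set $\mathcal S\subseteq\mathcal B$ is defined as follows. If $m\ge2$: $\mathcal S=\{X\in\mathcal B:\exists Y\in\mathfrak n,\ \ell_2([X,Y])\ne0\}$. If $m=1$: $\mathcal S$ is the output of the following greedy procedure: let $P$ initially be the set of unordered pairs $\{X_k,X_j\}\subseteq\mathcal B$ with $\ell_2([X_k,X_j])\ne0$, and the output be empty; while some element of $\mathcal B$ lies in at least two pairs of $P$, choose an element lying in the maximal number of pairs of $P$, add it to the output and delete from $P$ all pairs containing it; when every element lies in at most one pair of $P$, add to the output one arbitrarily chosen element of each remaining pair (any admissible choices may be made). *)

theory Defs
  imports "HOL-Analysis.Analysis"
begin

coinductive smooth_on :: "'a::euclidean_space set \<Rightarrow> ('a \<Rightarrow> real) \<Rightarrow> bool" where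
  "f differentiable_on U \<Longrightarrow> (\<forall>b\<in>Basis. smooth_on U (\<lambda>x. frechet_derivative f (at x) b))
    \<Longrightarrow> smooth_on U f"

text \<open>The group N is modelled in exponential coordinates: the underlying set is the Lie
  algebra 'v itself, mul is the group law, exp(v) = v.  Left-invariant vector field
  determined by v, applied to u at x.\<close>
definition lvf :: "('v::euclidean_space \<Rightarrow> 'v \<Rightarrow> 'v) \<Rightarrow> 'v \<Rightarrow> ('v \<Rightarrow> real) \<Rightarrow> 'v \<Rightarrow> real" where
  "lvf mul v u x = deriv (\<lambda>t. u (mul x (t *\<^sub>R v))) 0"

definition exp_coord_group :: "('v::euclidean_space \<Rightarrow> 'v \<Rightarrow> 'v) \<Rightarrow> ('v \<Rightarrow> 'v \<Rightarrow> 'v) \<Rightarrow> bool" where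
  "exp_coord_group mul br \<longleftrightarrow>
     (\<forall>x y z. mul (mul x y) z = mul x (mul y z)) \<and>
     (\<forall>x. mul 0 x = x \<and> mul x 0 = x \<and> mul x (- x) = 0 \<and> mul (- x) x = 0) \<and>
     (\<forall>v s t. mul (s *\<^sub>R v) (t *\<^sub>R v) = (s + t) *\<^sub>R v) \<and>
     (\<forall>b\<in>Basis. smooth_on (UNIV :: ('v \<times> 'v) set) (\<lambda>z. mul (fst z) (snd z) \<bullet> b)) \<and>
     (\<forall>u v w x. smooth_on UNIV u \<longrightarrow>
        lvf mul v (lvf mul w u) x - lvf mul w (lvf mul v u) x = lvf mul (br v w) u x)"

definition lie_generated :: "('v::real_vector \<Rightarrow> 'v \<Rightarrow> 'v) \<Rightarrow> 'v set \<Rightarrow> 'v set" where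
  "lie_generated br A = \<Inter>{W. subspace W \<and> A \<subseteq> W \<and> (\<forall>x\<in>W. \<forall>y\<in>W. br x y \<in> W)}"

definition stratified :: "('v::euclidean_space \<Rightarrow> 'v \<Rightarrow> 'v) \<Rightarrow> nat \<Rightarrow> (nat \<Rightarrow> 'v set) \<Rightarrow> bool" where
  "stratified br m V \<longleftrightarrow>
     (\<forall>j\<in>{1..m+1}. subspace (V j)) \<and>
     (\<forall>x. \<exists>!vs. (\<forall>j\<in>{1..m+1}. vs j \<in> V j) \<and> (\<forall>j. j \<notin> {1..m+1} \<longrightarrow> vs j = 0) \<and>
            x = (\<Sum>j=1..m+1. vs j)) \<and>
     (\<forall>i\<in>{1..m+1}. \<forall>j\<in>{1..m+1}. i + j \<le> m + 1 \<longrightarrow> (\<forall>x\<in>V i. \<forall>y\<in>V j. br x y \<in> V (i + j))) \<and>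
     (\<forall>i\<in>{1..m+1}. \<forall>j\<in>{1..m+1}. i + j > m + 1 \<longrightarrow> (\<forall>x\<in>V i. \<forall>y\<in>V j. br x y = 0)) \<and>
     lie_generated br (V 1) = UNIV"

definition pdeg :: "nat set set \<Rightarrow> nat \<Rightarrow> nat" where
  "pdeg P i = card {e\<in>P. i \<in> e}"

text \<open>greedy B P S: S is a possible output of the greedy procedure started with the set of
  pairs P over the index set B.\<close>
inductive greedy :: "nat set \<Rightarrow> nat set set \<Rightarrow> nat set \<Rightarrow> bool" where
  step: "\<lbrakk>i \<in> B; 2 \<le> pdeg P i; \<forall>j\<in>B. pdeg P j \<le> pdeg P i;
          greedy B {e\<in>P. i \<notin> e} S\<rbrakk> \<Longrightarrow> greedy B P (insert i S)"
| final: "\<lbrakk>\<forall>j\<in>B. pdeg P j \<le> 1; \<forall>e\<in>P. f e \<in> e\<rbrakk> \<Longrightarrow> greedy B P (f ` P)"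

definition S_set :: "('v \<Rightarrow> 'v \<Rightarrow> 'v) \<Rightarrow> ('v \<Rightarrow> real) \<Rightarrow> nat \<Rightarrow> (nat \<Rightarrow> 'v) \<Rightarrow> nat \<Rightarrow> nat set \<Rightarrow> bool" where
  "S_set br l2 m X p S \<longleftrightarrow>
     (if m \<ge> 2 then S = {i\<in>{1..p}. \<exists>Y. l2 (br (X i) Y) \<noteq> 0}
      else greedy {1..p} {{k, j} | k j. k \<in> {1..p} \<and> j \<in> {1..p} \<and> l2 (br (X k) (X j)) \<noteq> 0} S)"

definition subLap :: "('v::euclidean_space \<Rightarrow> 'v \<Rightarrow> 'v) \<Rightarrow> (nat \<Rightarrow> 'v) \<Rightarrow> nat \<Rightarrow> ('v \<Rightarrow> real) \<Rightarrow> 'v \<Rightarrow> real" where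
  "subLap mul X p u x = (\<Sum>i=1..p. lvf mul (X i) (lvf mul (X i) u) x)"

end

theory Submission
  imports Defs
begin

text \<open>
  Write H for the exponential of the span of the basis elements outside S and of the strata of
  degree at least 2. The form l2 is a character of H, and the two commuting elements of S give
  coordinates (s, t) on the quotient by H. Together with the phase theta (the value of l2 on the
  H-part) and the coordinate y dual to the central element X p, they turn the sublaplacian into the
  Grushin type operator W_ss + W_tt + W_yy + V(s, t) W_theta,theta, where V is a sum of squares of
  homogeneous polynomials of degree m.

  This equation is solved by a sum over k of a_k (cos + sin)(k^(m+1) theta) g_k(s, t, y) with
  Lap g_k = k^(2m+2) V g_k near the origin. Because V is homogeneous, g_k can be chosen with values
  in [0, 1] and g_k(0) at least exp(-Dk), so that a_k can be normalised to make the k-th term at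
  the origin exp(-Kk). The derivatives along Z beta are then, up to sign, the moments
  sum over k of exp(-Kk) k^((m+1) sigma), which are comparable to (sigma!)^(m+1).

  The functions g_k are limits of solutions of the difference equation on finer and finer lattices:
  existence is a monotone iteration, the lower bound at 0 a comparison with an explicit subsolution,
  and all derivatives are controlled by iterating Brandt's discrete gradient estimate.
\<close>

subsection \<open>Smooth functions and composition\<close>

text \<open>The order m + 1 comes from pairing the frequency k^(m+1) in theta with a weight that is
  only exponentially small in k. The obstacle is a lower bound exp(-Dk) at the origin for a solution
  bounded by 1 on a fixed cube. In the variables (s, t) alone, a potential k^(2m+2) V with V
  positive away from 0 would push the value at the origin down to the size of exp(-c k^(m+1)). The
  central direction avoids this: the solution is fed along the y-axis, through the tube where s and
  t are of size 1/k and homogeneity leaves a potential of size k^2. V may vanish along whole lines,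
  so the g_k are not separated into exp(ky) times an eigenfunction in (s, t). They solve a boundary
  value problem, whose construction rests on V \<ge> 0 and whose value at the origin rests on an
  upper bound for V. Bounds on derivatives may grow like powers of k^(2m+2), since the weights
  exp(-k) absorb every power. On a lattice, existence and comparison are elementary, and constants
  independent of the mesh and of k survive the limit.\<close>

fun Ck_on :: "nat \<Rightarrow> 'a::euclidean_space set \<Rightarrow> ('a \<Rightarrow> real) \<Rightarrow> bool" where
  "Ck_on 0 U f \<longleftrightarrow> True"
| "Ck_on (Suc n) U f \<longleftrightarrow> f differentiable_on U \<and>
     (\<forall>b\<in>Basis. Ck_on n U (\<lambda>x. frechet_derivative f (at x) b))"

lemma smooth_on_imp_Ck_on: "smooth_on U f \<Longrightarrow> Ck_on n U f"
proof (induction n arbitrary: f)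
  case (Suc n)
  from Suc.prems show ?case
    by (cases rule: smooth_on.cases) (auto intro: Suc.IH)
qed simp

text \<open>Coinduction is awkward for closure properties, because the derivative of a product is a
  sum of products and not again a product. Through this equivalence they become inductions on the
  order of differentiability.\<close>

lemma smooth_on_iff_Ck_on: "smooth_on U f \<longleftrightarrow> (\<forall>n. Ck_on n U f)"
proof
  assume "\<forall>n. Ck_on n U f"
  then show "smooth_on U f"
  proof (coinduction arbitrary: f)
    case smooth_on
    have 1: "f differentiable_on U" using smooth_on[rule_format, of "Suc 0"] by simp
    have 2: "Ck_on n U (\<lambda>x. frechet_derivative f (at x) b)" if "b \<in> Basis" for b n
      using smooth_on[rule_format, of "Suc n"] that by simp
    show ?case using 1 2 by blast
  qed
qed (simp add: smooth_on_imp_Ck_on)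

lemma Ck_on_Suc_D:
  assumes "open U" "Ck_on (Suc n) U f" "x \<in> U"
  shows "(f has_derivative frechet_derivative f (at x)) (at x)"
  using assms differentiable_on_eq_differentiable_at[of U f] frechet_derivative_works
  by auto

lemma Ck_on_cong:
  assumes "open U" "\<And>x. x \<in> U \<Longrightarrow> f x = g x" "Ck_on n U f"
  shows "Ck_on n U g"
  using assms(2,3)
proof (induction n arbitrary: f g)
  case (Suc n)
  have der: "(g has_derivative frechet_derivative f (at x)) (at x)" if "x \<in> U" for x
    using Ck_on_Suc_D[OF assms(1) Suc.prems(2) that] Suc.prems(1) that assms(1)
    by (metis has_derivative_transform_within_open)
  then have eq: "frechet_derivative f (at x) = frechet_derivative g (at x)" if "x \<in> U" for x
    using frechet_derivative_at that by blast
  have "g differentiable_on U"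
    using der assms(1) differentiable_on_eq_differentiable_at differentiableI by blast
  moreover have "Ck_on n U (\<lambda>x. frechet_derivative g (at x) b)" if "b \<in> Basis" for b
    using Suc.IH[of "\<lambda>x. frechet_derivative f (at x) b" "\<lambda>x. frechet_derivative g (at x) b"]
      eq Suc.prems(2) that by simp
  ultimately show ?case by simp
qed simp

text \<open>Derivatives at a point are unique, so an explicit \<open>D\<close> may stand in for
  \<open>frechet_derivative\<close> in the remaining orders.\<close>

lemma Ck_on_SucI:
  assumes "open U" and der: "\<And>x. x \<in> U \<Longrightarrow> (f has_derivative D x) (at x)"
    and "\<And>b. b \<in> Basis \<Longrightarrow> Ck_on n U (\<lambda>x. D x b)"
  shows "Ck_on (Suc n) U f"
proof -
  have eq: "D x = frechet_derivative f (at x)" if "x \<in> U" for x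
    using frechet_derivative_at der that by blast
  have "f differentiable_on U"
    using der assms(1) differentiable_on_eq_differentiable_at differentiableI by blast
  moreover have "Ck_on n U (\<lambda>x. frechet_derivative f (at x) b)" if "b \<in> Basis" for b
    by (rule Ck_on_cong[OF assms(1) _ assms(3)[OF that]]) (simp add: eq)
  ultimately show ?thesis by simp
qed

lemma Ck_on_mono: "Ck_on (Suc n) U f \<Longrightarrow> Ck_on n U f"
  by (induction n arbitrary: f) auto

lemma Ck_on_const: "open U \<Longrightarrow> Ck_on n U (\<lambda>x. c)"
proof (induction n arbitrary: c)
  case (Suc n)
  show ?case by (rule Ck_on_SucI[where D = "\<lambda>x v. 0"]) (use Suc in auto)
qed simp

lemma Ck_on_linear:
  assumes "open U" "linear f"
  shows "Ck_on n U f"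
proof (cases n)
  case (Suc k)
  show ?thesis unfolding Suc
    by (rule Ck_on_SucI[where D = "\<lambda>x. f"])
       (use assms in \<open>auto intro: Ck_on_const linear_imp_has_derivative\<close>)
qed simp

lemma Ck_on_add:
  assumes "open U" shows "Ck_on n U f \<Longrightarrow> Ck_on n U g \<Longrightarrow> Ck_on n U (\<lambda>x. f x + g x)"
proof (induction n arbitrary: f g)
  case (Suc n)
  show ?case
    by (rule Ck_on_SucI[OF assms has_derivative_add[OF Ck_on_Suc_D[OF assms Suc.prems(1)]
          Ck_on_Suc_D[OF assms Suc.prems(2)]]]) (use Suc in auto)
qed simp

lemma Ck_on_sum:
  assumes "open U" "finite A" "\<And>i. i \<in> A \<Longrightarrow> Ck_on n U (f i)"
  shows "Ck_on n U (\<lambda>x. \<Sum>i\<in>A. f i x)"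
  using assms(2,3)
  by (induction A rule: finite_induct) (simp_all add: Ck_on_const Ck_on_add assms(1))

lemma Ck_on_mult:
  assumes "open U" shows "Ck_on n U f \<Longrightarrow> Ck_on n U g \<Longrightarrow> Ck_on n U (\<lambda>x. f x * g x)"
proof (induction n arbitrary: f g)
  case (Suc n)
  show ?case
  proof (rule Ck_on_SucI[OF assms has_derivative_mult[OF Ck_on_Suc_D[OF assms Suc.prems(1)]
          Ck_on_Suc_D[OF assms Suc.prems(2)]]])
    fix b :: 'a assume b: "b \<in> Basis"
    have "Ck_on n U f" "Ck_on n U g" using Suc.prems Ck_on_mono by blast+
    moreover have "Ck_on n U (\<lambda>x. frechet_derivative f (at x) b)"
      "Ck_on n U (\<lambda>x. frechet_derivative g (at x) b)" using Suc.prems b by simp_all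
    ultimately show "Ck_on n U (\<lambda>x. f x * frechet_derivative g (at x) b + frechet_derivative f (at x) b * g x)"
      by (intro Ck_on_add[OF assms] Suc.IH)
  qed
qed simp

lemma has_derivative_componentwise_Ck_on:
  fixes \<Phi> :: "'a::euclidean_space \<Rightarrow> 'b::euclidean_space"
  assumes "open U" "x \<in> U" "\<And>c. c \<in> Basis \<Longrightarrow> Ck_on (Suc n) U (\<lambda>x. \<Phi> x \<bullet> c)"
  shows "(\<Phi> has_derivative (\<lambda>v. \<Sum>c\<in>Basis. frechet_derivative (\<lambda>x. \<Phi> x \<bullet> c) (at x) v *\<^sub>R c)) (at x)"
proof -
  have "((\<lambda>x. \<Sum>c\<in>Basis. (\<Phi> x \<bullet> c) *\<^sub>R c) has_derivative
      (\<lambda>v. \<Sum>c\<in>Basis. frechet_derivative (\<lambda>x. \<Phi> x \<bullet> c) (at x) v *\<^sub>R c)) (at x)"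
    by (intro has_derivative_sum has_derivative_scaleR_left Ck_on_Suc_D[OF assms(1) assms(3) assms(2)])
  then show ?thesis by (simp add: euclidean_representation)
qed

text \<open>Only \<open>W\<close> varies in the induction: the chain rule produces partial
  derivatives of \<open>W\<close> composed with the same \<open>\<Phi>\<close>, times partial
  derivatives of the components of \<open>\<Phi>\<close>.\<close>

lemma Ck_on_compose:
  fixes \<Phi> :: "'a::euclidean_space \<Rightarrow> 'b::euclidean_space"
  assumes "open U" "open V" "\<Phi> ` U \<subseteq> V"
  shows "Ck_on n V W \<Longrightarrow> (\<And>c. c \<in> Basis \<Longrightarrow> Ck_on n U (\<lambda>x. \<Phi> x \<bullet> c)) \<Longrightarrow> Ck_on n U (\<lambda>x. W (\<Phi> x))"
proof (induction n arbitrary: W)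
  case (Suc n)
  let ?D = "\<lambda>x v. \<Sum>c\<in>Basis. frechet_derivative (\<lambda>x. \<Phi> x \<bullet> c) (at x) v *\<^sub>R c"
  show ?case
  proof (rule Ck_on_SucI[OF assms(1)])
    fix x assume x: "x \<in> U"
    then have Vx: "\<Phi> x \<in> V" using assms(3) by blast
    show "((\<lambda>x. W (\<Phi> x)) has_derivative
        (\<lambda>v. \<Sum>c\<in>Basis. frechet_derivative (\<lambda>x. \<Phi> x \<bullet> c) (at x) v * frechet_derivative W (at (\<Phi> x)) c)) (at x)"
    proof -
      have W': "(W has_derivative frechet_derivative W (at (\<Phi> x))) (at (\<Phi> x))"
        by (rule Ck_on_Suc_D[OF assms(2) Suc.prems(1) Vx])
      have lin: "linear (frechet_derivative W (at (\<Phi> x)))"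
        using W' has_derivative_linear by blast
      have "((\<lambda>x. W (\<Phi> x)) has_derivative (\<lambda>v. frechet_derivative W (at (\<Phi> x)) (?D x v))) (at x)"
        using diff_chain_at[OF has_derivative_componentwise_Ck_on[OF assms(1) x Suc.prems(2)] W']
        by (simp add: o_def)
      then show ?thesis
        by (simp add: linear_sum[OF lin] linear_cmul[OF lin])
    qed
  next
    fix b :: 'a assume b: "b \<in> Basis"
    have "Ck_on n U (\<lambda>x. \<Phi> x \<bullet> c)" if "c \<in> Basis" for c
      using Suc.prems(2)[OF that] Ck_on_mono by blast
    then have "Ck_on n U (\<lambda>x. frechet_derivative W (at (\<Phi> x)) c)" if "c \<in> Basis" for c
      using Suc.IH[of "\<lambda>z. frechet_derivative W (at z) c"] Suc.prems(1) that by simp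
    moreover have "Ck_on n U (\<lambda>x. frechet_derivative (\<lambda>x. \<Phi> x \<bullet> c) (at x) b)" if "c \<in> Basis" for c
      using Suc.prems(2)[OF that] b by simp
    ultimately show "Ck_on n U (\<lambda>x. \<Sum>c\<in>Basis. frechet_derivative (\<lambda>x. \<Phi> x \<bullet> c) (at x) b *
        frechet_derivative W (at (\<Phi> x)) c)"
      by (intro Ck_on_sum Ck_on_mult) (auto simp: assms(1))
  qed
qed simp

definition smooth_map_on :: "'a::euclidean_space set \<Rightarrow> ('a \<Rightarrow> 'b::euclidean_space) \<Rightarrow> bool" where
  "smooth_map_on U \<Phi> \<longleftrightarrow> (\<forall>c\<in>Basis. smooth_on U (\<lambda>x. \<Phi> x \<bullet> c))"

lemma smooth_on_compose:
  assumes "open U" "open V" "\<Phi> ` U \<subseteq> V" "smooth_on V W" "smooth_map_on U \<Phi>"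
  shows "smooth_on U (\<lambda>x. W (\<Phi> x))"
  using assms unfolding smooth_map_on_def smooth_on_iff_Ck_on
  by (blast intro: Ck_on_compose)

lemma smooth_on_linear: "linear f \<Longrightarrow> smooth_on UNIV f"
  by (simp add: smooth_on_iff_Ck_on Ck_on_linear)

lemma smooth_on_sum:
  "open U \<Longrightarrow> finite A \<Longrightarrow> (\<And>i. i \<in> A \<Longrightarrow> smooth_on U (f i)) \<Longrightarrow> smooth_on U (\<lambda>x. \<Sum>i\<in>A. f i x)"
  by (simp add: smooth_on_iff_Ck_on Ck_on_sum)

lemma smooth_on_mult:
  "open U \<Longrightarrow> smooth_on U f \<Longrightarrow> smooth_on U g \<Longrightarrow> smooth_on U (\<lambda>x. f x * g x)"
  by (simp add: smooth_on_iff_Ck_on Ck_on_mult)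

lemma smooth_map_on_compose:
  assumes "smooth_map_on UNIV W" "smooth_map_on UNIV \<Phi>"
  shows "smooth_map_on UNIV (\<lambda>x. W (\<Phi> x))"
  using assms smooth_on_compose[OF open_UNIV open_UNIV _ _ assms(2)]
  by (auto simp: smooth_map_on_def)

lemma smooth_map_on_linear: "linear f \<Longrightarrow> smooth_map_on UNIV f"
  unfolding smooth_map_on_def
  by (auto intro!: smooth_on_linear linear_compose[unfolded o_def, of f]
      bounded_linear.linear[OF bounded_linear_inner_left])

lemma smooth_map_on_Pair:
  assumes "smooth_map_on UNIV f" "smooth_map_on UNIV g"
  shows "smooth_map_on UNIV (\<lambda>x. (f x, g x))"
  using assms by (auto simp: smooth_map_on_def Basis_prod_def)

lemma smooth_map_on_has_derivative:
  assumes "smooth_map_on UNIV f"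
  shows "(f has_derivative frechet_derivative f (at x)) (at x)"
proof -
  have "f differentiable (at x)"
    by (rule differentiableI, rule has_derivative_componentwise_Ck_on[OF open_UNIV UNIV_I, where n = 0])
       (use assms in \<open>simp only: smooth_map_on_def smooth_on_iff_Ck_on\<close>)
  then show ?thesis by (simp add: frechet_derivative_works)
qed

lemma smooth_map_on_frechet_Basis:
  assumes "smooth_map_on UNIV f" "b \<in> Basis"
  shows "smooth_map_on UNIV (\<lambda>x. frechet_derivative f (at x) b)"
  unfolding smooth_map_on_def
proof
  fix c :: 'b assume c: "c \<in> Basis"
  have eq: "frechet_derivative (\<lambda>x. f x \<bullet> c) (at x) = (\<lambda>v. frechet_derivative f (at x) v \<bullet> c)" for x
    using has_derivative_inner_left[OF smooth_map_on_has_derivative[OF assms(1), of x], of c]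
    by (rule frechet_derivative_at[symmetric])
  have "Ck_on (Suc n) UNIV (\<lambda>x. f x \<bullet> c)" for n
    using assms(1) c smooth_on_imp_Ck_on unfolding smooth_map_on_def by blast
  then have "Ck_on n UNIV (\<lambda>x. frechet_derivative (\<lambda>x. f x \<bullet> c) (at x) b)" for n
    using assms(2) unfolding Ck_on.simps by blast
  then show "smooth_on UNIV (\<lambda>x. frechet_derivative f (at x) b \<bullet> c)"
    by (simp add: eq smooth_on_iff_Ck_on)
qed

lemma smooth_map_on_frechet:
  assumes "smooth_map_on UNIV f"
  shows "smooth_map_on UNIV (\<lambda>x. frechet_derivative f (at x) v)"
proof -
  have eq: "frechet_derivative f (at x) v \<bullet> c = (\<Sum>b\<in>Basis. (v \<bullet> b) * (frechet_derivative f (at x) b \<bullet> c))" for x c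
  proof -
    have l: "linear (frechet_derivative f (at x))"
      using smooth_map_on_has_derivative[OF assms] has_derivative_linear by blast
    have "frechet_derivative f (at x) v = frechet_derivative f (at x) (\<Sum>b\<in>Basis. (v \<bullet> b) *\<^sub>R b)"
      by (simp add: euclidean_representation)
    also have "\<dots> = (\<Sum>b\<in>Basis. (v \<bullet> b) *\<^sub>R frechet_derivative f (at x) b)"
      by (simp add: linear_sum[OF l] linear_cmul[OF l])
    finally show ?thesis by (simp add: inner_sum_left)
  qed
  have "smooth_on UNIV (\<lambda>x. \<Sum>b\<in>Basis. (v \<bullet> b) * (frechet_derivative f (at x) b \<bullet> c))"
    if "c \<in> Basis" for c
  proof (intro smooth_on_sum smooth_on_mult open_UNIV finite_Basis)
    fix b :: 'a assume "b \<in> Basis"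
    then show "smooth_on UNIV (\<lambda>x. frechet_derivative f (at x) b \<bullet> c)"
      using smooth_map_on_frechet_Basis[OF assms] that by (simp add: smooth_map_on_def)
    show "smooth_on UNIV (\<lambda>x::'a. v \<bullet> b)"
      by (simp add: smooth_on_iff_Ck_on Ck_on_const)
  qed
  then show ?thesis unfolding smooth_map_on_def eq by blast
qed

lemma smooth_map_on_continuous: "smooth_map_on UNIV f \<Longrightarrow> continuous_on UNIV f"
  by (rule continuous_at_imp_continuous_on)
     (use smooth_map_on_has_derivative has_derivative_continuous in blast)

subsection \<open>Lattice solutions and their interior estimates\<close>

definition lattice_laplacian :: "(('n::finite \<Rightarrow> int) \<Rightarrow> real) \<Rightarrow> ('n \<Rightarrow> int) \<Rightarrow> real" where
  "lattice_laplacian f \<kappa> = (\<Sum>i\<in>UNIV. f (\<kappa>(i := \<kappa> i + 1)) + f (\<kappa>(i := \<kappa> i - 1)) - 2 * f \<kappa>)"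

lemma lattice_laplacian_linear:
  "lattice_laplacian (\<lambda>\<kappa>. a * f \<kappa> + b * g \<kappa>) \<kappa> = a * lattice_laplacian f \<kappa> + b * lattice_laplacian g \<kappa>"
  unfolding lattice_laplacian_def sum_distrib_left sum.distrib[symmetric]
  by (rule sum.cong) (auto simp: algebra_simps)

text \<open>For \<open>a = 1\<close> this is the reflection about the midpoint of the bond from 0 to
  1 in direction \<open>i\<close>.\<close>

lemma lattice_laplacian_reflect:
  fixes f :: "('n::finite \<Rightarrow> int) \<Rightarrow> real"
  shows "lattice_laplacian (\<lambda>\<kappa>. f (\<kappa>(i := a - \<kappa> i))) \<kappa> = lattice_laplacian f (\<kappa>(i := a - \<kappa> i))"
  unfolding lattice_laplacian_def
proof (rule sum.cong[OF refl])
  fix k :: 'n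
  show "f ((\<kappa>(k := \<kappa> k + 1))(i := a - (\<kappa>(k := \<kappa> k + 1)) i)) +
        f ((\<kappa>(k := \<kappa> k - 1))(i := a - (\<kappa>(k := \<kappa> k - 1)) i)) - 2 * f (\<kappa>(i := a - \<kappa> i)) =
        f ((\<kappa>(i := a - \<kappa> i))(k := (\<kappa>(i := a - \<kappa> i)) k + 1)) +
        f ((\<kappa>(i := a - \<kappa> i))(k := (\<kappa>(i := a - \<kappa> i)) k - 1)) - 2 * f (\<kappa>(i := a - \<kappa> i))"
  proof (cases "k = i")
    case True
    have "a - (\<kappa> i + 1) = a - \<kappa> i - 1" "a - (\<kappa> i - 1) = a - \<kappa> i + 1" by simp_all
    then show ?thesis unfolding True by (simp only: fun_upd_same fun_upd_upd)
  next
    case False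
    then have "\<kappa>(k := u, i := v) = \<kappa>(i := v, k := u)" for u v by (rule fun_upd_twist)
    with False show ?thesis by simp
  qed
qed

text \<open>The first summand is lattice harmonic: the squares transverse to \<open>i\<close> have
  second difference 2 each, and the coefficient \<open>CARD('n) - 1\<close> of the negative square
  in direction \<open>i\<close> cancels their sum. The linear term, harmonic by itself, lifts the
  face \<open>\<kappa> i = N\<close>. The last summand vanishes at both ends and carries the whole
  Laplacian \<open>- F\<close>.\<close>

definition barrier :: "'n::finite \<Rightarrow> int \<Rightarrow> real \<Rightarrow> real \<Rightarrow> ('n \<Rightarrow> int) \<Rightarrow> real" where
  "barrier i N M F \<kappa> =
     M / (of_int N)\<^sup>2 * ((\<Sum>j\<in>UNIV - {i}. (of_int (\<kappa> j))\<^sup>2)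
       + of_int (\<kappa> i) * (of_nat CARD('n) * of_int N - (of_nat CARD('n) - 1) * of_int (\<kappa> i)))
     + F / 2 * (of_int (\<kappa> i) * (of_int N - of_int (\<kappa> i)))"

lemma barrier_laplacian:
  fixes i :: "'n::finite"
  shows "lattice_laplacian (barrier i N M F) \<kappa> = - F"
proof -
  let ?n = "real CARD('n)"
  let ?b = "barrier i N M F"
  define q where "q = M / (of_int N)\<^sup>2"
  have i: "?b (\<kappa>(i := \<kappa> i + 1)) + ?b (\<kappa>(i := \<kappa> i - 1)) - 2 * ?b \<kappa> = - q * 2 * (?n - 1) - F"
  proof -
    have s: "(\<Sum>j\<in>UNIV - {i}. (real_of_int ((\<kappa>(i := v)) j))\<^sup>2) = (\<Sum>j\<in>UNIV - {i}. (real_of_int (\<kappa> j))\<^sup>2)" for v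
      by (rule sum.cong) auto
    show ?thesis unfolding barrier_def s q_def[symmetric] by (simp add: algebra_simps power2_eq_square)
  qed
  have j: "?b (\<kappa>(k := \<kappa> k + 1)) + ?b (\<kappa>(k := \<kappa> k - 1)) - 2 * ?b \<kappa> = 2 * q" if "k \<in> UNIV - {i}" for k
  proof -
    define R where "R = (\<Sum>j\<in>UNIV - {i} - {k}. (real_of_int (\<kappa> j))\<^sup>2)"
    have s: "(\<Sum>j\<in>UNIV - {i}. (real_of_int ((\<kappa>(k := v)) j))\<^sup>2) = (real_of_int v)\<^sup>2 + R" for v
    proof -
      have "(\<Sum>j\<in>UNIV - {i} - {k}. (real_of_int ((\<kappa>(k := v)) j))\<^sup>2) = R"
        unfolding R_def by (rule sum.cong) auto
      then show ?thesis by (subst sum.remove[OF _ that]) auto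
    qed
    have s': "(\<Sum>j\<in>UNIV - {i}. (real_of_int (\<kappa> j))\<^sup>2) = (real_of_int (\<kappa> k))\<^sup>2 + R"
      using s[of "\<kappa> k"] by simp
    have ki: "(\<kappa>(k := v)) i = \<kappa> i" for v using that by auto
    show ?thesis unfolding barrier_def s q_def[symmetric] s' ki by (simp add: algebra_simps power2_eq_square)
  qed
  have "lattice_laplacian ?b \<kappa> = (- q * 2 * (?n - 1) - F) + (\<Sum>k\<in>UNIV - {i}. 2 * q)"
    unfolding lattice_laplacian_def by (subst sum.remove[of _ i]) (simp_all only: i j finite UNIV_I sum.cong[OF refl j])
  also have "\<dots> = - F"
    by (simp add: card_Diff_singleton of_nat_diff Suc_leI algebra_simps)
  finally show ?thesis .
qed

lemma barrier_nonneg: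
  fixes i :: "'n::finite" and N :: int
  assumes "N \<ge> 1" "M \<ge> 0" "F \<ge> 0" "0 \<le> \<kappa> i" "\<kappa> i \<le> N"
  shows "barrier i N M F \<kappa> \<ge> 0"
proof -
  have "(real CARD('n) - 1) * real_of_int (\<kappa> i) \<le> (real CARD('n) - 1) * real_of_int N"
    using assms by (intro mult_left_mono) (auto simp: Suc_leI)
  also have "\<dots> \<le> real CARD('n) * real_of_int N" using assms by (simp add: algebra_simps)
  finally have "0 \<le> real CARD('n) * real_of_int N - (real CARD('n) - 1) * real_of_int (\<kappa> i)" by simp
  then show ?thesis unfolding barrier_def using assms
    by (intro add_nonneg_nonneg mult_nonneg_nonneg sum_nonneg divide_nonneg_nonneg) auto
qed

text \<open>The bracket multiplied by M / N^2 reaches N^2: on the face \<open>\<kappa> i = N\<close>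
  through its second part, on a transverse face through a single square. The interior of the face
  \<open>\<kappa> i = 0\<close> is left to the antisymmetry of the function being compared.\<close>

lemma barrier_boundary:
  fixes i :: "'n::finite" and N :: int
  assumes "N \<ge> 1" "M \<ge> 0" "F \<ge> 0" "0 \<le> \<kappa> i" "\<kappa> i \<le> N"
    and bd: "\<kappa> i = N \<or> (\<exists>j. j \<noteq> i \<and> \<bar>\<kappa> j\<bar> = N)"
  shows "barrier i N M F \<kappa> \<ge> M"
proof -
  let ?n = "real CARD('n)" let ?S = "\<Sum>j\<in>UNIV - {i}. (real_of_int (\<kappa> j))\<^sup>2"
  have S0: "?S \<ge> 0" by (intro sum_nonneg) auto
  have "(?n - 1) * \<kappa> i \<le> (?n - 1) * N"
    using assms by (intro mult_left_mono) (auto simp: Suc_leI)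
  then have t0: "real_of_int (\<kappa> i) * (?n * N - (?n - 1) * \<kappa> i) \<ge> real_of_int (\<kappa> i) * N"
    using assms by (intro mult_left_mono) (auto simp: algebra_simps)
  have N2: "?S + real_of_int (\<kappa> i) * (?n * N - (?n - 1) * \<kappa> i) \<ge> (real_of_int N)\<^sup>2"
    using bd
  proof
    assume "\<kappa> i = N"
    then show ?thesis using S0 t0 by (simp add: power2_eq_square)
  next
    assume "\<exists>j. j \<noteq> i \<and> \<bar>\<kappa> j\<bar> = N"
    then obtain j where j: "j \<noteq> i" "\<bar>\<kappa> j\<bar> = N" by blast
    have "(real_of_int (\<kappa> j))\<^sup>2 \<le> ?S" using j(1) by (intro member_le_sum) auto
    moreover have "(real_of_int (\<kappa> j))\<^sup>2 = (real_of_int N)\<^sup>2"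
      using j(2) by (metis of_int_abs power2_abs)
    moreover have "real_of_int (\<kappa> i) * N \<ge> 0" using assms by simp
    ultimately show ?thesis using t0 by linarith
  qed
  have "M = M / (real_of_int N)\<^sup>2 * (real_of_int N)\<^sup>2" using assms by simp
  also have "\<dots> \<le> M / (real_of_int N)\<^sup>2 * (?S + real_of_int (\<kappa> i) * (?n * N - (?n - 1) * \<kappa> i))"
    using N2 assms by (intro mult_left_mono) auto
  also have "\<dots> \<le> barrier i N M F \<kappa>" unfolding barrier_def using assms by simp
  finally show ?thesis .
qed

text \<open>Brandt's comparison argument: antisymmetrise in direction i about the midpoint of the bond and
  dominate the odd part by the barrier, whose lattice Laplacian is exactly constant.\<close>
lemma lattice_gradient_estimate_strict:
  fixes f :: "('n::finite \<Rightarrow> int) \<Rightarrow> real" and N :: int and M F :: real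
  assumes N: "N \<ge> 1" and M: "\<And>\<kappa>. (\<And>j. \<bar>\<kappa> j\<bar> \<le> N) \<Longrightarrow> \<bar>f \<kappa>\<bar> \<le> M"
    and L: "\<And>\<kappa>. (\<And>j. \<bar>\<kappa> j\<bar> < N) \<Longrightarrow> \<bar>lattice_laplacian f \<kappa>\<bar> \<le> F0" and F: "F0 < F" "0 \<le> F"
  shows "\<bar>f ((\<lambda>_. 0)(i := 1)) - f (\<lambda>_. 0)\<bar> \<le> 2 * CARD('n) * M / N + N * F"
proof -
  let ?n = "real CARD('n)"
  define \<psi> where "\<psi> = barrier i N M F"
  \<comment> \<open>Odd under the reflection that sends \<open>\<kappa> i\<close> to
    \<open>1 - \<kappa> i\<close>; its value next to the bond is half the difference to be
    estimated.\<close>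
  define \<phi> where "\<phi> \<kappa> = (1/2) * f \<kappa> + (-1/2) * f (\<kappa>(i := 1 - \<kappa> i))" for \<kappa>
  \<comment> \<open>The half of the box beyond the midpoint of the bond. Its reflection has
    \<open>i\<close>-th coordinate between 1 - N and 0 and stays where \<open>M\<close> bounds
    \<open>f\<close>.\<close>
  define K where "K = {\<kappa> :: 'n \<Rightarrow> int. 1 \<le> \<kappa> i \<and> \<kappa> i \<le> N \<and> (\<forall>j. j \<noteq> i \<longrightarrow> \<bar>\<kappa> j\<bar> \<le> N)}"
  have "M \<ge> 0" using M[of "\<lambda>_. 0"] N by fastforce
  have KD: "\<bar>\<kappa> j\<bar> \<le> N" if "\<kappa> \<in> K" for \<kappa> j
    using that by (cases "j = i") (auto simp: K_def)
  have finK: "finite K"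
  proof (rule finite_subset)
    show "K \<subseteq> (\<Pi>\<^sub>E j\<in>UNIV. {-N..N})"
    proof
      fix \<kappa> assume \<kappa>: "\<kappa> \<in> K"
      have "-N \<le> \<kappa> j \<and> \<kappa> j \<le> N" for j
        using KD[OF \<kappa>, of j] by (simp add: abs_le_iff minus_le_iff)
      then show "\<kappa> \<in> (\<Pi>\<^sub>E j\<in>UNIV. {-N..N})" by auto
    qed
    show "finite (\<Pi>\<^sub>E j\<in>(UNIV::'n set). {-N..N})" by (intro finite_PiE) auto
  qed
  have e: "(\<lambda>_. 0)(i := 1) \<in> K" using N by (auto simp: K_def)
  have \<phi>M: "\<bar>\<phi> \<kappa>\<bar> \<le> M" if "\<kappa> \<in> K" for \<kappa>
  proof -
    have "\<bar>f \<kappa>\<bar> \<le> M" using KD[OF that] by (rule M)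
    moreover have "\<bar>f (\<kappa>(i := 1 - \<kappa> i))\<bar> \<le> M"
      using that N by (intro M) (auto simp: K_def)
    ultimately show ?thesis unfolding \<phi>_def by linarith
  qed
  have main: "\<bar>\<phi> \<kappa>\<bar> \<le> \<psi> \<kappa>" if "\<kappa> \<in> K" for \<kappa>
  proof (rule ccontr)
    assume neg: "\<not> \<bar>\<phi> \<kappa>\<bar> \<le> \<psi> \<kappa>"
    obtain x where x: "x \<in> K" "\<And>y. y \<in> K \<Longrightarrow> \<bar>\<phi> y\<bar> - \<psi> y \<le> \<bar>\<phi> x\<bar> - \<psi> x"
    proof -
      let ?g = "\<lambda>y. \<bar>\<phi> y\<bar> - \<psi> y"
      have "Max (?g ` K) \<in> ?g ` K" using finK e by (intro Max_in) auto
      then obtain x where x: "x \<in> K" "Max (?g ` K) = ?g x" by (rule imageE) simp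
      show ?thesis
      proof (rule that[OF x(1)])
        fix y assume "y \<in> K"
        then show "?g y \<le> ?g x" using finK unfolding x(2)[symmetric] by (intro Max_ge) auto
      qed
    qed
    have pos: "\<bar>\<phi> x\<bar> - \<psi> x > 0" using x(2)[OF that] neg by simp
    have notbd: "x i < N" "\<And>j. j \<noteq> i \<Longrightarrow> \<bar>x j\<bar> < N"
    proof -
      have "\<not> (x i = N \<or> (\<exists>j. j \<noteq> i \<and> \<bar>x j\<bar> = N))"
        using barrier_boundary[OF N \<open>M \<ge> 0\<close> \<open>0 \<le> F\<close>, of x i] x(1) \<phi>M[OF x(1)] pos
        unfolding K_def \<psi>_def by force
      then show "x i < N" "\<And>j. j \<noteq> i \<Longrightarrow> \<bar>x j\<bar> < N"
        using x(1) unfolding K_def by (auto simp: less_le)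
    qed
    define s where "s = sgn (\<phi> x)"
    have "\<psi> x \<ge> 0" unfolding \<psi>_def
      using x(1) by (intro barrier_nonneg N \<open>M \<ge> 0\<close> \<open>0 \<le> F\<close>) (auto simp: K_def)
    then have sx: "s * \<phi> x = \<bar>\<phi> x\<bar>" "\<bar>s\<bar> = 1" "\<phi> x \<noteq> 0" using pos by (auto simp: s_def sgn_if)
    define e where "e \<kappa> = s * \<phi> \<kappa> + (-1) * \<psi> \<kappa>" for \<kappa>
    have ex: "e x = \<bar>\<phi> x\<bar> - \<psi> x" by (simp add: e_def sx)
    have le_abs: "e y \<le> \<bar>\<phi> y\<bar> - \<psi> y" for y
      using sx(2) by (auto simp: e_def abs_if split: if_splits)
    have nb: "e (x(k := x k + d)) \<le> e x" if d: "d = 1 \<or> d = -1" for k d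
    proof (cases "x(k := x k + d) \<in> K")
      case True
      then show ?thesis using le_abs x(2) ex by (metis order_trans)
    next
      case False
      \<comment> \<open>The maximiser is not on the outer faces, so the only neighbour outside
        \<open>K\<close> lies across the bond. There \<open>\<phi>\<close> takes the value opposite
        to \<open>\<phi> x\<close>, and \<open>e\<close> is negative.\<close>
      have "k = i \<and> d = -1 \<and> x i = 1"
      proof (rule ccontr)
        assume a: "\<not> (k = i \<and> d = -1 \<and> x i = 1)"
        have "x(k := x k + d) \<in> K"
          unfolding K_def using x(1) notbd(1) notbd(2)[of k] a d
          by (cases "k = i") (auto simp: K_def)
        with False show False by simp
      qed
      then have kd: "x(k := x k + d) = x(i := 0)" and xi: "x i = 1" by auto
      have x1: "x(i := 1) = x" using xi by auto
      have "\<phi> (x(i := 0)) = - \<phi> x" unfolding \<phi>_def by (simp add: xi x1)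
      moreover have "\<psi> (x(i := 0)) \<ge> 0" unfolding \<psi>_def
        using N by (intro barrier_nonneg N \<open>M \<ge> 0\<close> \<open>0 \<le> F\<close>) auto
      ultimately have "e (x(i := 0)) \<le> - \<bar>\<phi> x\<bar>" using sx(1) by (simp add: e_def)
      then show ?thesis unfolding kd ex using pos \<open>\<psi> x \<ge> 0\<close> by linarith
    qed
    \<comment> \<open>At a maximum of \<open>e\<close> the Laplacian is nonpositive, but subtracting
      the barrier contributes \<open>F\<close>, which strictly exceeds the bound \<open>F0\<close>
      for the other part.\<close>
    have "lattice_laplacian e x \<le> 0"
      unfolding lattice_laplacian_def
    proof (rule sum_nonpos)
      fix k show "e (x(k := x k + 1)) + e (x(k := x k - 1)) - 2 * e x \<le> 0"
        using nb[of 1 k] nb[of "-1" k] by simp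
    qed
    moreover have "lattice_laplacian e x = s * lattice_laplacian \<phi> x + F"
      unfolding e_def lattice_laplacian_linear by (simp add: \<psi>_def barrier_laplacian)
    moreover have "\<bar>lattice_laplacian \<phi> x\<bar> \<le> F0"
    proof -
      have "\<bar>lattice_laplacian f x\<bar> \<le> F0"
      proof (rule L)
        fix j show "\<bar>x j\<bar> < N" using notbd x(1) by (cases "j = i") (auto simp: K_def)
      qed
      moreover have "\<bar>lattice_laplacian f (x(i := 1 - x i))\<bar> \<le> F0"
        using notbd x(1) by (intro L) (auto simp: K_def)
      ultimately show ?thesis
        unfolding \<phi>_def lattice_laplacian_linear lattice_laplacian_reflect by linarith
    qed
    then have "\<bar>s * lattice_laplacian \<phi> x\<bar> \<le> F0" using sx(2) by (simp add: abs_mult)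
    ultimately show False using F by linarith
  qed
  have A: "\<phi> ((\<lambda>_. 0)(i := 1)) = (1/2) * (f ((\<lambda>_. 0)(i := 1)) - f (\<lambda>_. 0))"
    by (simp add: \<phi>_def fun_upd_idem algebra_simps)
  have B: "\<psi> ((\<lambda>_. 0)(i := 1)) \<le> ?n * M / N + F / 2 * N"
  proof -
    have "(\<Sum>j\<in>UNIV - {i}. (real_of_int (((\<lambda>_. 0)(i := 1)) j))\<^sup>2) = 0" by (intro sum.neutral) auto
    then have "\<psi> ((\<lambda>_. 0)(i := 1)) = M / (real_of_int N)\<^sup>2 * (?n * N - (?n - 1)) + F / 2 * (N - 1)"
      by (simp add: \<psi>_def barrier_def)
    moreover have "M / (real_of_int N)\<^sup>2 * (?n * N - (?n - 1)) \<le> M / (real_of_int N)\<^sup>2 * (?n * N)"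
      using \<open>M \<ge> 0\<close> by (intro mult_left_mono) (auto simp: Suc_leI)
    moreover have "M / (real_of_int N)\<^sup>2 * (?n * N) = ?n * M / N"
      using N by (simp add: power2_eq_square)
    moreover have "F / 2 * (N - 1) \<le> F / 2 * N" using F by (intro mult_left_mono) auto
    ultimately show ?thesis by linarith
  qed
  have "\<bar>f ((\<lambda>_. 0)(i := 1)) - f (\<lambda>_. 0)\<bar> = 2 * \<bar>\<phi> ((\<lambda>_. 0)(i := 1))\<bar>"
    unfolding A by (simp add: abs_mult)
  also have "\<dots> \<le> 2 * (?n * M / N + F / 2 * N)" by (rule mult_left_mono[OF order_trans[OF main[OF e] B]]) simp
  also have "\<dots> = 2 * CARD('n) * M / N + N * F" by (simp add: algebra_simps)
  finally show ?thesis .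
qed

lemma lattice_laplacian_translate:
  fixes f :: "('n::finite \<Rightarrow> int) \<Rightarrow> real"
  shows "lattice_laplacian (\<lambda>\<kappa>. f (\<lambda>j. c j + \<kappa> j)) \<kappa> = lattice_laplacian f (\<lambda>j. c j + \<kappa> j)"
proof -
  have "(\<lambda>j. c j + (\<kappa>(i := \<kappa> i + d)) j) = (\<lambda>j. c j + \<kappa> j)(i := c i + \<kappa> i + d)" for i d
    by auto
  from this[of _ 1] this[of _ "-1"] show ?thesis
    unfolding lattice_laplacian_def by (simp add: add.assoc)
qed

text \<open>Strictness is removed by running the previous estimate with \<open>F + e / N\<close> and
  letting e tend to 0; translation moves the centre from 0 to \<open>c\<close>.\<close>

lemma lattice_gradient_estimate:
  fixes f :: "('n::finite \<Rightarrow> int) \<Rightarrow> real" and N :: int and M F :: real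
  assumes N: "N \<ge> 1" and M: "\<And>\<kappa>. (\<And>j. \<bar>\<kappa> j - c j\<bar> \<le> N) \<Longrightarrow> \<bar>f \<kappa>\<bar> \<le> M"
    and L: "\<And>\<kappa>. (\<And>j. \<bar>\<kappa> j - c j\<bar> < N) \<Longrightarrow> \<bar>lattice_laplacian f \<kappa>\<bar> \<le> F"
  shows "\<bar>f (c(i := c i + 1)) - f c\<bar> \<le> 2 * CARD('n) * M / N + N * F"
proof (rule field_le_epsilon)
  fix e :: real assume e: "e > 0"
  have F0: "F \<ge> 0" using L[of c] N by fastforce
  let ?g = "\<lambda>\<kappa>. f (\<lambda>j. c j + \<kappa> j)"
  have "\<bar>?g ((\<lambda>_. 0)(i := 1)) - ?g (\<lambda>_. 0)\<bar> \<le> 2 * CARD('n) * M / N + N * (F + e / N)"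
    by (rule lattice_gradient_estimate_strict[OF N, of ?g M F])
       (use M L e N F0 in \<open>auto simp: lattice_laplacian_translate\<close>)
  moreover have "(\<lambda>j. c j + ((\<lambda>_. 0)(i := 1)) j) = c(i := c i + 1)" by auto
  ultimately show "\<bar>f (c(i := c i + 1)) - f c\<bar> \<le> 2 * CARD('n) * M / N + N * F + e"
    using N by (simp add: algebra_simps)
qed

section \<open>Iterated difference quotients and their interior bounds\<close>

definition lattice_diff :: "nat \<Rightarrow> 'n \<Rightarrow> (('n \<Rightarrow> int) \<Rightarrow> real) \<Rightarrow> ('n \<Rightarrow> int) \<Rightarrow> real" where
  "lattice_diff n i f \<kappa> = real n * (f (\<kappa>(i := \<kappa> i + 1)) - f \<kappa>)"

fun lattice_diffs :: "nat \<Rightarrow> 'n list \<Rightarrow> (('n \<Rightarrow> int) \<Rightarrow> real) \<Rightarrow> ('n \<Rightarrow> int) \<Rightarrow> real" where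
  "lattice_diffs n [] f = f"
| "lattice_diffs n (i # is) f = lattice_diffs n is (lattice_diff n i f)"

lemma lattice_diff_commute:
  "lattice_diff n i (lattice_diff n j f) = lattice_diff n j (lattice_diff n i f)"
proof
  fix \<kappa>
  show "lattice_diff n i (lattice_diff n j f) \<kappa> = lattice_diff n j (lattice_diff n i f) \<kappa>"
  proof (cases "i = j")
    case False
    then have "\<kappa>(i := u, j := v) = \<kappa>(j := v, i := u)" for u v by (rule fun_upd_twist)
    with False show ?thesis by (simp add: lattice_diff_def algebra_simps)
  qed simp
qed

text \<open>The recursion differences in the head direction first. Since differences commute, it may
  also be done last, so that one more order is a single difference of a function already
  estimated.\<close>

lemma lattice_diffs_Cons: "lattice_diffs n (i # is) f = lattice_diff n i (lattice_diffs n is f)"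
proof (induction "is" arbitrary: f)
  case (Cons j js)
  have "lattice_diffs n (i # j # js) f = lattice_diffs n (i # js) (lattice_diff n j f)"
    by (simp add: lattice_diff_commute)
  also have "\<dots> = lattice_diff n i (lattice_diffs n js (lattice_diff n j f))" by (rule Cons.IH)
  finally show ?case by simp
qed simp

lemma lattice_diff_laplacian:
  "lattice_diff n i (lattice_laplacian f) = lattice_laplacian (lattice_diff n i f)"
proof
  fix \<kappa> :: "'a \<Rightarrow> int"
  have "f (\<kappa>(i := \<kappa> i + 1, k := (\<kappa>(i := \<kappa> i + 1)) k + d)) =
      f ((\<kappa>(k := \<kappa> k + d))(i := (\<kappa>(k := \<kappa> k + d)) i + 1))" for k d
  proof (cases "k = i")
    case False
    then have "\<kappa>(i := u, k := v) = \<kappa>(k := v, i := u)" for u v by (metis fun_upd_twist)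
    with False show ?thesis by simp
  qed (simp add: algebra_simps)
  from this[of _ 1] this[of _ "-1"]
  show "lattice_diff n i (lattice_laplacian f) \<kappa> = lattice_laplacian (lattice_diff n i f) \<kappa>"
    unfolding lattice_diff_def lattice_laplacian_def sum_subtractf[symmetric] sum_distrib_left
    by (intro sum.cong) (auto simp: algebra_simps)
qed

lemma lattice_diffs_laplacian:
  "lattice_diffs n is (lattice_laplacian f) = lattice_laplacian (lattice_diffs n is f)"
  by (induction "is" arbitrary: f) (simp_all add: lattice_diff_laplacian)

lemma lattice_diffs_cmult:
  "lattice_diffs n is (\<lambda>\<kappa>. c * f \<kappa>) = (\<lambda>\<kappa>. c * lattice_diffs n is f \<kappa>)"
proof (induction "is" arbitrary: f)
  case (Cons i js)
  have "lattice_diff n i (\<lambda>\<kappa>. c * f \<kappa>) = (\<lambda>\<kappa>. c * lattice_diff n i f \<kappa>)"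
    by (auto simp: lattice_diff_def algebra_simps)
  then show ?case by (simp add: Cons)
qed simp

lemma lattice_diffs_add:
  "lattice_diffs n is (\<lambda>\<kappa>. f \<kappa> + g \<kappa>) = (\<lambda>\<kappa>. lattice_diffs n is f \<kappa> + lattice_diffs n is g \<kappa>)"
proof (induction "is" arbitrary: f g)
  case (Cons i js)
  have "lattice_diff n i (\<lambda>\<kappa>. f \<kappa> + g \<kappa>) = (\<lambda>\<kappa>. lattice_diff n i f \<kappa> + lattice_diff n i g \<kappa>)"
    by (auto simp: lattice_diff_def algebra_simps)
  then show ?case by (simp add: Cons)
qed simp

text \<open>Forward differences read only values ahead of \<open>\<kappa>\<close>, at most one step
  per difference. This allows an equation that holds on a box only to be differenced slightly inside
  it.\<close>

lemma lattice_diffs_cong: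
  assumes "\<And>\<kappa>'. (\<And>j. \<kappa> j \<le> \<kappa>' j \<and> \<kappa>' j \<le> \<kappa> j + int (length is)) \<Longrightarrow> f \<kappa>' = g \<kappa>'"
  shows "lattice_diffs n is f \<kappa> = lattice_diffs n is g \<kappa>"
  using assms
proof (induction "is" arbitrary: f g)
  case (Cons i js)
  have "lattice_diff n i f \<kappa>' = lattice_diff n i g \<kappa>'"
    if "\<And>j. \<kappa> j \<le> \<kappa>' j \<and> \<kappa>' j \<le> \<kappa> j + int (length js)" for \<kappa>'
  proof -
    have "f \<kappa>' = g \<kappa>'"
    proof (rule Cons.prems)
      fix j show "\<kappa> j \<le> \<kappa>' j \<and> \<kappa>' j \<le> \<kappa> j + int (length (i # js))"
        using that[of j] by auto
    qed
    moreover have "f (\<kappa>'(i := \<kappa>' i + 1)) = g (\<kappa>'(i := \<kappa>' i + 1))"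
    proof (rule Cons.prems)
      fix j show "\<kappa> j \<le> (\<kappa>'(i := \<kappa>' i + 1)) j \<and> (\<kappa>'(i := \<kappa>' i + 1)) j \<le> \<kappa> j + int (length (i # js))"
        using that[of j] by (cases "j = i") auto
    qed
    ultimately show ?thesis by (simp add: lattice_diff_def)
  qed
  then show ?case unfolding lattice_diffs.simps by (rule Cons.IH)
qed simp

lemma lattice_diffs_shift:
  "lattice_diffs n is (\<lambda>\<kappa>. f (\<kappa>(i := \<kappa> i + 1))) \<kappa> = lattice_diffs n is f (\<kappa>(i := \<kappa> i + 1))"
proof (induction "is" arbitrary: f \<kappa>)
  case (Cons j js)
  have "lattice_diff n j (\<lambda>\<kappa>. f (\<kappa>(i := \<kappa> i + 1))) = (\<lambda>\<kappa>. lattice_diff n j f (\<kappa>(i := \<kappa> i + 1)))"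
  proof
    fix \<kappa> :: "'a \<Rightarrow> int"
    show "lattice_diff n j (\<lambda>\<kappa>. f (\<kappa>(i := \<kappa> i + 1))) \<kappa> = lattice_diff n j f (\<kappa>(i := \<kappa> i + 1))"
    proof (cases "j = i")
      case False
      then have "\<kappa>(i := u, j := v) = \<kappa>(j := v, i := u)" for u v by (metis fun_upd_twist)
      with False show ?thesis by (simp add: lattice_diff_def)
    qed (simp add: lattice_diff_def)
  qed
  then show ?case unfolding lattice_diffs.simps by (simp only: Cons.IH)
qed simp

text \<open>The discrete product rule evaluates one factor at a shifted point. It is always
  \<open>f\<close> here, so the bound for \<open>f\<close> is needed on a box ahead of
  \<open>\<kappa>\<close> and the one for \<open>g\<close> only at \<open>\<kappa>\<close>. The two
  summands per difference give the power of 2.\<close>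

lemma lattice_diffs_mult_bound:
  fixes "is" :: "'a list"
  assumes "\<And>js \<kappa>'. length js \<le> length is \<Longrightarrow> (\<And>j. \<kappa> j \<le> \<kappa>' j \<and> \<kappa>' j \<le> \<kappa> j + int (length is))
      \<Longrightarrow> \<bar>lattice_diffs n js f \<kappa>'\<bar> \<le> a"
    and "\<And>js. length js \<le> length is \<Longrightarrow> \<bar>lattice_diffs n js g \<kappa>\<bar> \<le> b"
    and "0 \<le> a" "0 \<le> b"
  shows "\<bar>lattice_diffs n is (\<lambda>\<kappa>. f \<kappa> * g \<kappa>) \<kappa>\<bar> \<le> 2 ^ length is * a * b"
  using assms
proof (induction "is" arbitrary: f g)
  case Nil
  have "\<bar>f \<kappa>\<bar> \<le> a" "\<bar>g \<kappa>\<bar> \<le> b" using Nil(1)[of "[]" \<kappa>] Nil(2)[of "[]"] by auto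
  then show ?case using mult_mono[of "\<bar>f \<kappa>\<bar>" a "\<bar>g \<kappa>\<bar>" b] Nil(3) by (simp add: abs_mult)
next
  case (Cons i "is")
  let ?f = "\<lambda>\<kappa>. f (\<kappa>(i := \<kappa> i + 1))"
  have eq: "lattice_diff n i (\<lambda>\<kappa>. f \<kappa> * g \<kappa>) =
      (\<lambda>\<kappa>. lattice_diff n i f \<kappa> * g \<kappa> + ?f \<kappa> * lattice_diff n i g \<kappa>)"
    by (auto simp: lattice_diff_def algebra_simps)
  have 1: "\<bar>lattice_diffs n is (\<lambda>\<kappa>. lattice_diff n i f \<kappa> * g \<kappa>) \<kappa>\<bar> \<le> 2 ^ length is * a * b"
  proof (rule Cons.IH)
    fix js :: "'a list" and \<kappa>' assume js: "length js \<le> length is"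
      and k: "\<And>j. \<kappa> j \<le> \<kappa>' j \<and> \<kappa>' j \<le> \<kappa> j + int (length is)"
    have "\<bar>lattice_diffs n (i # js) f \<kappa>'\<bar> \<le> a"
    proof (rule Cons.prems(1))
      show "length (i # js) \<le> length (i # is)" using js by simp
      fix j show "\<kappa> j \<le> \<kappa>' j \<and> \<kappa>' j \<le> \<kappa> j + int (length (i # is))" using k[of j] by auto
    qed
    then show "\<bar>lattice_diffs n js (lattice_diff n i f) \<kappa>'\<bar> \<le> a" by simp
  qed (use Cons.prems in auto)
  have 2: "\<bar>lattice_diffs n is (\<lambda>\<kappa>. ?f \<kappa> * lattice_diff n i g \<kappa>) \<kappa>\<bar> \<le> 2 ^ length is * a * b"
  proof (rule Cons.IH)
    fix js :: "'a list" and \<kappa>' assume js: "length js \<le> length is"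
      and k: "\<And>j. \<kappa> j \<le> \<kappa>' j \<and> \<kappa>' j \<le> \<kappa> j + int (length is)"
    show "\<bar>lattice_diffs n js ?f \<kappa>'\<bar> \<le> a" unfolding lattice_diffs_shift
    proof (rule Cons.prems(1))
      show "length js \<le> length (i # is)" using js by simp
      fix j show "\<kappa> j \<le> (\<kappa>'(i := \<kappa>' i + 1)) j \<and> (\<kappa>'(i := \<kappa>' i + 1)) j \<le> \<kappa> j + int (length (i # is))"
        using k[of j] by (cases "j = i") auto
    qed
  next
    fix js :: "'a list" assume "length js \<le> length is"
    then show "\<bar>lattice_diffs n js (lattice_diff n i g) \<kappa>\<bar> \<le> b"
      using Cons.prems(2)[of "i # js"] by simp
  qed (use Cons.prems in auto)
  have "\<bar>lattice_diffs n (i # is) (\<lambda>\<kappa>. f \<kappa> * g \<kappa>) \<kappa>\<bar> \<le> 2 ^ length is * a * b + 2 ^ length is * a * b"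
    unfolding lattice_diffs.simps eq lattice_diffs_add using 1 2 by linarith
  also have "\<dots> = 2 ^ length (i # is) * a * b" by (simp add: algebra_simps)
  finally show ?case .
qed

text \<open>Decreases from 1 at order 0 towards 1/2. Each difference spends a part of the cube, and
  the cube of half side 1/2 is left for all orders at once.\<close>

definition shrink_radius :: "nat \<Rightarrow> real" where
  "shrink_radius l = 1/2 + 1 / (real l + 2)"

definition lattice_bound :: "nat \<Rightarrow> nat \<Rightarrow> real \<Rightarrow> real \<Rightarrow> (('n \<Rightarrow> int) \<Rightarrow> real) \<Rightarrow> bool" where
  "lattice_bound n l R a f \<longleftrightarrow> (\<forall>js \<kappa>. length js \<le> l \<longrightarrow>
     (\<forall>j. \<bar>real_of_int (\<kappa> j)\<bar> \<le> R * real n) \<longrightarrow> \<bar>lattice_diffs n js f \<kappa>\<bar> \<le> a)"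

text \<open>Since \<open>n\<close> is both the inverse mesh and the index range, the equation lives
  on the fixed cube of half side 1. The factor \<open>1 / (real n)\<^sup>2\<close> matches
  \<open>lattice_laplacian\<close>, which is not divided by the squared mesh.\<close>

definition lattice_solution :: "nat \<Rightarrow> (('n::finite \<Rightarrow> int) \<Rightarrow> real) \<Rightarrow> (('n \<Rightarrow> int) \<Rightarrow> real) \<Rightarrow> bool" where
  "lattice_solution n U w \<longleftrightarrow> (\<forall>\<kappa>. \<bar>w \<kappa>\<bar> \<le> 1) \<and>
     (\<forall>\<kappa>. (\<forall>j. \<bar>\<kappa> j\<bar> < int n) \<longrightarrow> lattice_laplacian w \<kappa> = 1 / (real n)\<^sup>2 * (U \<kappa> * w \<kappa>))"

text \<open>Induction on the order. A difference of order l of \<open>w\<close> satisfies a Poisson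
  equation whose right-hand side is a difference of \<open>U * w\<close> of order l, bounded by the
  induction hypothesis. The gradient estimate on a box of fixed physical size then reaches order l +
  1, and \<open>U\<close> contributes one factor \<open>\<Lambda>\<close>. What matters is that
  \<open>C\<close> is independent of the mesh, of \<open>\<Lambda>\<close>, of \<open>U\<close> and
  of \<open>w\<close>.\<close>

lemma interior_derivative_bounds:
  "\<exists>C n0. C \<ge> 1 \<and> (\<forall>n\<ge>n0. \<forall>\<Lambda>\<ge>1. \<forall>U w :: ('n::finite \<Rightarrow> int) \<Rightarrow> real.
     lattice_bound n l 2 (b * \<Lambda>) U \<longrightarrow> lattice_solution n U w \<longrightarrow>
     lattice_bound n l (shrink_radius l) (C * \<Lambda> ^ l) w)"
proof (induction l)
  case 0
  show ?case by (rule exI[of _ 1], rule exI[of _ 0]) (auto simp: lattice_bound_def lattice_solution_def)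
next
  case (Suc l)
  then obtain C n0 where C: "C \<ge> 1" and IH: "\<And>n \<Lambda> U w. n \<ge> n0 \<Longrightarrow> \<Lambda> \<ge> 1 \<Longrightarrow>
     lattice_bound n l 2 (b * \<Lambda>) U \<Longrightarrow> lattice_solution n U w \<Longrightarrow>
     lattice_bound n l (shrink_radius l) (C * \<Lambda> ^ l) (w :: ('n \<Rightarrow> int) \<Rightarrow> real)" by blast
  define d where "d = shrink_radius l - shrink_radius (Suc l)"
  have d_eq: "d = 1 / ((real l + 2) * (real l + 3))" by (simp add: d_def shrink_radius_def divide_simps) (simp add: algebra_simps)
  have "1 * 1 \<le> (real l + 2) * (real l + 3)" by (intro mult_mono) auto
  then have d: "0 < d" "d \<le> 1" by (auto simp: d_eq)
  have r1: "shrink_radius l \<le> 1" "l > 0 \<Longrightarrow> shrink_radius l \<le> 5/6" and mono: "shrink_radius (Suc l) \<le> shrink_radius l"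
    by (auto simp: shrink_radius_def field_simps)
  \<comment> \<open>The bound by 2 / d makes the box of physical half side d at least two lattice
    steps wide. For l > 0 the radius is at most 5/6, and 6 * l + 1 leaves room for l forward steps
    before the equation ceases to hold.\<close>
  define n1 where "n1 = max n0 (max (nat \<lceil>2 / d\<rceil>) (6 * l + 1))"
  \<comment> \<open>The two summands are the two terms of the gradient estimate after multiplication
    by n: N is at least d * n / 2 in the first and at most n in the second.\<close>
  define C' where "C' = max C (4 * real CARD('n) * C / d + 2 ^ l * \<bar>b\<bar> * C)"
  have "lattice_bound n (Suc l) (shrink_radius (Suc l)) (C' * \<Lambda> ^ Suc l) w"
    if n: "n1 \<le> n" and \<Lambda>: "1 \<le> \<Lambda>" and U': "lattice_bound n (Suc l) 2 (b * \<Lambda>) U" and sol: "lattice_solution n U w"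
    for n \<Lambda> and U w :: "('n \<Rightarrow> int) \<Rightarrow> real"
    unfolding lattice_bound_def
  proof (intro allI impI)
    fix "is" :: "'n list" and \<kappa> :: "'n \<Rightarrow> int"
    assume len: "length is \<le> Suc l" and \<kappa>: "\<forall>j. \<bar>real_of_int (\<kappa> j)\<bar> \<le> shrink_radius (Suc l) * n"
    have U: "\<bar>lattice_diffs n js U \<kappa>\<bar> \<le> b * \<Lambda>"
      if "length js \<le> Suc l" "\<And>j. \<bar>real_of_int (\<kappa> j)\<bar> \<le> 2 * real n" for js \<kappa>
      using U' that unfolding lattice_bound_def by blast
    have w: "\<bar>w \<kappa>\<bar> \<le> 1" for \<kappa> using sol unfolding lattice_solution_def by blast
    have eq: "lattice_laplacian w \<kappa> = 1 / (real n)\<^sup>2 * (U \<kappa> * w \<kappa>)" if "\<And>j. \<bar>\<kappa> j\<bar> < int n" for \<kappa>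
      using sol that unfolding lattice_solution_def by blast
    have nn: "n \<ge> n0" "real n \<ge> 2 / d" "n \<ge> 6 * l + 1" using n by (auto simp: n1_def; linarith)+
    have n0': "real n > 0" using nn(3) by simp
    have "lattice_bound n l 2 (b * \<Lambda>) U" using U' unfolding lattice_bound_def by simp
    then have IHn: "\<bar>lattice_diffs n js w \<kappa>'\<bar> \<le> C * \<Lambda> ^ l"
      if "length js \<le> l" "\<And>j. \<bar>real_of_int (\<kappa>' j)\<bar> \<le> shrink_radius l * n" for js \<kappa>'
      using IH[OF nn(1) \<Lambda> _ sol] that unfolding lattice_bound_def by blast
    show "\<bar>lattice_diffs n is w \<kappa>\<bar> \<le> C' * \<Lambda> ^ Suc l"
    proof (cases "length is \<le> l")
      case True
      have "\<bar>lattice_diffs n is w \<kappa>\<bar> \<le> C * \<Lambda> ^ l"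
      proof (rule IHn[OF True])
        fix j show "\<bar>real_of_int (\<kappa> j)\<bar> \<le> shrink_radius l * n"
          using \<kappa> mono mult_right_mono[OF mono, of "real n"] by (meson of_nat_0_le_iff order_trans)
      qed
      also have "\<dots> \<le> C' * \<Lambda> ^ Suc l"
        using C \<Lambda> by (intro mult_mono power_increasing) (auto simp: C'_def)
      finally show ?thesis .
    next
      case False
      then obtain i js where ijs: "is = i # js" "length js = l" using len
        by (metis Suc_length_conv le_SucE length_Suc_conv not_less_eq_eq order_refl)
      define N where "N = \<lfloor>d * n\<rfloor>"
      have dn: "d * n \<ge> 2" using nn(2) d by (simp add: field_simps)
      have N: "N \<ge> 1" "real_of_int N \<le> d * n" "real_of_int N \<ge> d * n / 2"
        unfolding N_def using dn by linarith+
      define M where "M = C * \<Lambda> ^ l"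
      define F where "F = 1 / (real n)\<^sup>2 * (2 ^ l * (\<bar>b\<bar> * \<Lambda>) * M)"
      have M0: "M \<ge> 0" using C \<Lambda> by (simp add: M_def)
      have near: "\<bar>real_of_int (\<kappa>' j)\<bar> \<le> shrink_radius l * n - (real_of_int N - m)"
        if "\<bar>\<kappa>' j - \<kappa> j\<bar> \<le> m" for \<kappa>' j m
      proof -
        have "\<bar>real_of_int (\<kappa>' j)\<bar> \<le> \<bar>real_of_int (\<kappa> j)\<bar> + m" using that by linarith
        also have "\<dots> \<le> shrink_radius (Suc l) * n + m" using \<kappa> by simp
        also have "\<dots> = shrink_radius l * n - d * n + m" by (simp add: d_def algebra_simps)
        finally show ?thesis using N(2) by linarith
      qed
      have "\<bar>lattice_diffs n js w (\<kappa>(i := \<kappa> i + 1)) - lattice_diffs n js w \<kappa>\<bar> \<le> 2 * CARD('n) * M / N + N * F"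
      proof (rule lattice_gradient_estimate[OF N(1)])
        fix \<kappa>' assume "\<And>j. \<bar>\<kappa>' j - \<kappa> j\<bar> \<le> N"
        then show "\<bar>lattice_diffs n js w \<kappa>'\<bar> \<le> M"
          unfolding M_def using near[of \<kappa>' _ N] ijs(2) by (intro IHn) auto
      next
        fix \<kappa>' assume *: "\<And>j. \<bar>\<kappa>' j - \<kappa> j\<bar> < N"
        have nr: "\<bar>real_of_int (\<kappa>' j)\<bar> \<le> shrink_radius l * n - 1" for j
          using near[of \<kappa>' j "N - 1"] *[of j] by simp
        have nl: "\<bar>\<kappa>' j\<bar> + int l < n" for j
        proof (cases "l = 0")
          case True
          then show ?thesis using nr[of j] r1(1) mult_right_mono[OF r1(1), of "real n"] by linarith
        next
          case False
          have "shrink_radius l * n \<le> 5/6 * n" using r1(2) False by (intro mult_right_mono) auto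
          then show ?thesis using nr[of j] nn(3) by linarith
        qed
        have "lattice_laplacian (lattice_diffs n js w) \<kappa>' = lattice_diffs n js (lattice_laplacian w) \<kappa>'"
          by (simp add: lattice_diffs_laplacian)
        also have "\<dots> = lattice_diffs n js (\<lambda>\<kappa>. 1 / (real n)\<^sup>2 * (U \<kappa> * w \<kappa>)) \<kappa>'"
        proof (rule lattice_diffs_cong)
          fix \<kappa>'' assume **: "\<And>j. \<kappa>' j \<le> \<kappa>'' j \<and> \<kappa>'' j \<le> \<kappa>' j + int (length js)"
          have "\<bar>\<kappa>'' j\<bar> < int n" for j using nl[of j] **[of j] ijs(2) by linarith
          then show "lattice_laplacian w \<kappa>'' = 1 / (real n)\<^sup>2 * (U \<kappa>'' * w \<kappa>'')" by (rule eq)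
        qed
        also have "\<dots> = 1 / (real n)\<^sup>2 * lattice_diffs n js (\<lambda>\<kappa>. U \<kappa> * w \<kappa>) \<kappa>'"
          by (simp only: lattice_diffs_cmult)
        also have "\<bar>\<dots>\<bar> \<le> F"
        proof -
          have "\<bar>lattice_diffs n js (\<lambda>\<kappa>. U \<kappa> * w \<kappa>) \<kappa>'\<bar> \<le> 2 ^ length js * (\<bar>b\<bar> * \<Lambda>) * M"
          proof (rule lattice_diffs_mult_bound)
            fix ks :: "'n list" and \<kappa>'' assume ks: "length ks \<le> length js"
              and **: "\<And>j. \<kappa>' j \<le> \<kappa>'' j \<and> \<kappa>'' j \<le> \<kappa>' j + int (length js)"
            have "\<bar>real_of_int (\<kappa>'' j)\<bar> \<le> 2 * real n" for j using nl[of j] **[of j] ijs(2) by linarith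
            then have "\<bar>lattice_diffs n ks U \<kappa>''\<bar> \<le> b * \<Lambda>" using ks ijs(2) by (intro U) auto
            also have "\<dots> \<le> \<bar>b\<bar> * \<Lambda>" using \<Lambda> by (intro mult_right_mono) auto
            finally show "\<bar>lattice_diffs n ks U \<kappa>''\<bar> \<le> \<bar>b\<bar> * \<Lambda>" .
          next
            fix ks :: "'n list" assume "length ks \<le> length js"
            then show "\<bar>lattice_diffs n ks w \<kappa>'\<bar> \<le> M"
              unfolding M_def using nr ijs(2) by (intro IHn) (auto intro: order_trans[OF nr])
          qed (use \<Lambda> M0 in auto)
          then show ?thesis unfolding F_def abs_mult ijs(2) by (intro mult_mono) auto
        qed
        finally show "\<bar>lattice_laplacian (lattice_diffs n js w) \<kappa>'\<bar> \<le> F" .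
      qed
      then have "\<bar>lattice_diffs n is w \<kappa>\<bar> \<le> n * (2 * CARD('n) * M / N + N * F)"
        unfolding ijs(1) lattice_diffs_Cons lattice_diff_def abs_mult using n0' by simp
      also have "\<dots> = n * (2 * CARD('n) * M / N) + n * (N * F)" by (simp add: distrib_left)
      also have "n * (2 * CARD('n) * M / N) \<le> n * (2 * CARD('n) * M / (d * n / 2))"
        using N dn M0 by (intro mult_left_mono divide_left_mono) auto
      also have "n * (2 * CARD('n) * M / (d * n / 2)) = 4 * real CARD('n) * M / d" using n0' by simp
      also have "n * (N * F) \<le> n * (n * F)"
      proof -
        have "F \<ge> 0" using M0 \<Lambda> by (simp add: F_def)
        moreover have "real_of_int N \<le> real n" using N(2) d mult_right_mono[OF d(2), of "real n"] by linarith
        ultimately show ?thesis by (intro mult_left_mono mult_right_mono) auto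
      qed
      also have "real n * (real n * F) = 2 ^ l * (\<bar>b\<bar> * \<Lambda>) * M" using n0' by (simp add: F_def power2_eq_square)
      also have "4 * real CARD('n) * M / d + 2 ^ l * (\<bar>b\<bar> * \<Lambda>) * M \<le> C' * \<Lambda> ^ Suc l"
      proof -
        have "4 * real CARD('n) * M / d \<le> 4 * real CARD('n) * C / d * \<Lambda> ^ Suc l"
        proof -
          have "4 * real CARD('n) * M / d = 4 * real CARD('n) * C / d * \<Lambda> ^ l" by (simp add: M_def)
          also have "\<dots> \<le> 4 * real CARD('n) * C / d * \<Lambda> ^ Suc l"
            using C d \<Lambda> by (intro mult_left_mono power_increasing) auto
          finally show ?thesis .
        qed
        moreover have "2 ^ l * (\<bar>b\<bar> * \<Lambda>) * M = 2 ^ l * \<bar>b\<bar> * C * \<Lambda> ^ Suc l" by (simp add: M_def)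
        ultimately have "4 * real CARD('n) * M / d + 2 ^ l * (\<bar>b\<bar> * \<Lambda>) * M \<le>
            (4 * real CARD('n) * C / d + 2 ^ l * \<bar>b\<bar> * C) * \<Lambda> ^ Suc l" unfolding distrib_right by linarith
        also have "\<dots> \<le> C' * \<Lambda> ^ Suc l" using \<Lambda> by (intro mult_right_mono) (auto simp: C'_def)
        finally show ?thesis .
      qed
      finally show ?thesis by simp
    qed
  qed
  moreover have "C' \<ge> 1" using C by (simp add: C'_def)
  ultimately show ?case by blast
qed

text \<open>Monotone iteration starting from the supersolution 1, with the value 1 kept off
  \<open>Q\<close>. The iterates decrease and stay nonnegative, so they converge. They stay above
  \<open>\<phi>\<close> on \<open>T\<close>: at a step that leaves \<open>T\<close> the subsolution
  is nonpositive, hence below any iterate.\<close>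

lemma lattice_dirichlet_solution:
  fixes V \<phi> :: "('n::finite \<Rightarrow> int) \<Rightarrow> real" and Q T :: "('n \<Rightarrow> int) set"
  assumes V: "\<And>\<kappa>. V \<kappa> \<ge> 0"
    and sub1: "\<And>\<kappa>. \<kappa> \<in> T \<Longrightarrow> \<phi> \<kappa> \<le> 1"
    and subnb: "\<And>\<kappa> i d. \<kappa> \<in> T \<Longrightarrow> \<kappa> \<in> Q \<Longrightarrow> d \<in> {1, -1} \<Longrightarrow> \<kappa>(i := \<kappa> i + d) \<notin> T \<Longrightarrow> \<phi> (\<kappa>(i := \<kappa> i + d)) \<le> 0"
    and sub: "\<And>\<kappa>. \<kappa> \<in> T \<Longrightarrow> \<kappa> \<in> Q \<Longrightarrow> V \<kappa> * \<phi> \<kappa> \<le> lattice_laplacian \<phi> \<kappa>"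
  shows "\<exists>w. (\<forall>\<kappa>. 0 \<le> w \<kappa> \<and> w \<kappa> \<le> 1) \<and> (\<forall>\<kappa>\<in>Q. lattice_laplacian w \<kappa> = V \<kappa> * w \<kappa>) \<and> (\<forall>\<kappa>\<in>T. \<phi> \<kappa> \<le> w \<kappa>)"
proof -
  let ?c = "2 * real CARD('n)"
  define nb where "nb w \<kappa> = (\<Sum>i\<in>UNIV. w (\<kappa>(i := \<kappa> i + 1)) + w (\<kappa>(i := \<kappa> i - 1)))"
    for w :: "('n \<Rightarrow> int) \<Rightarrow> real" and \<kappa>
  have lap: "lattice_laplacian w \<kappa> = nb w \<kappa> - ?c * w \<kappa>" for w \<kappa>
    by (simp add: lattice_laplacian_def nb_def sum_subtractf)
  have nb_mono: "nb w \<kappa> \<le> nb w' \<kappa>"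
    if "\<And>i d. d \<in> {1, -1} \<Longrightarrow> w (\<kappa>(i := \<kappa> i + d)) \<le> w' (\<kappa>(i := \<kappa> i + d))" for w w' \<kappa>
    unfolding nb_def using that[of 1] that[of "-1"] by (intro sum_mono add_mono) auto
  have c: "?c + V \<kappa> > 0" for \<kappa> using V[of \<kappa>] by (intro add_pos_nonneg) auto
  \<comment> \<open>The equation at \<open>\<kappa>\<close> solved for the central value with the
    neighbours frozen. The denominator is positive because V is nonnegative, which makes the map
    monotone.\<close>
  define step where "step w \<kappa> = (if \<kappa> \<in> Q then nb w \<kappa> / (?c + V \<kappa>) else 1)" for w \<kappa>
  define it where "it k = (step ^^ k) (\<lambda>_. 1)" for k
  have it_Suc: "it (Suc k) = step (it k)" and it_0: "it 0 = (\<lambda>_. 1)" for k by (auto simp: it_def)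
  have step_mono: "step w \<kappa> \<le> step w' \<kappa>" if "\<And>\<kappa>. w \<kappa> \<le> w' \<kappa>" for w w' \<kappa>
    unfolding step_def using that c[of \<kappa>] by (auto intro!: divide_right_mono nb_mono)
  have bounds: "0 \<le> it k \<kappa> \<and> it k \<kappa> \<le> 1" for k \<kappa>
  proof (induction k arbitrary: \<kappa>)
    case (Suc k)
    have "nb (it k) \<kappa> \<le> nb (\<lambda>_. 1) \<kappa>" using Suc by (intro nb_mono) auto
    also have "nb (\<lambda>_. 1) \<kappa> = ?c" by (simp add: nb_def)
    finally have "nb (it k) \<kappa> \<le> ?c + V \<kappa>" using V[of \<kappa>] by simp
    moreover have "nb (it k) \<kappa> \<ge> 0" unfolding nb_def using Suc by (intro sum_nonneg add_nonneg_nonneg) auto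
    ultimately show ?case unfolding it_Suc step_def using c[of \<kappa>] by auto
  qed (simp add: it_0)
  have dec: "it (Suc k) \<kappa> \<le> it k \<kappa>" for k \<kappa>
  proof (induction k arbitrary: \<kappa>)
    case 0
    then show ?case using bounds[of "Suc 0" \<kappa>] by (simp add: it_0)
  next
    case (Suc k)
    then show ?case unfolding it_Suc[of "Suc k"] it_Suc[of k] by (intro step_mono) (simp add: it_Suc)
  qed
  have lower: "\<phi> \<kappa> \<le> it k \<kappa>" if "\<kappa> \<in> T" for k \<kappa>
    using that
  proof (induction k arbitrary: \<kappa>)
    case (Suc k)
    show ?case
    proof (cases "\<kappa> \<in> Q")
      case True
      have "\<phi> (\<kappa>(i := \<kappa> i + d)) \<le> it k (\<kappa>(i := \<kappa> i + d))" if "d \<in> {1, -1}" for i d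
        using Suc.IH subnb[OF Suc.prems True that, of i] bounds[of k] order_trans by blast
      then have "nb \<phi> \<kappa> \<le> nb (it k) \<kappa>" by (rule nb_mono)
      moreover have "(?c + V \<kappa>) * \<phi> \<kappa> \<le> nb \<phi> \<kappa>"
        using sub[OF Suc.prems True] unfolding lap by (simp add: algebra_simps)
      ultimately show ?thesis unfolding it_Suc step_def using c[of \<kappa>] True
        by (simp add: pos_le_divide_eq mult.commute)
    qed (use sub1[OF Suc.prems] in \<open>simp add: it_Suc step_def\<close>)
  qed (simp add: it_0 sub1)
  define w where "w \<kappa> = lim (\<lambda>k. it k \<kappa>)" for \<kappa>
  have lim: "(\<lambda>k. it k \<kappa>) \<longlonglongrightarrow> w \<kappa>" for \<kappa>
  proof -
    have "decseq (\<lambda>k. it k \<kappa>)" by (rule decseq_SucI) (rule dec)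
    then have "convergent (\<lambda>k. it k \<kappa>)"
      using bounds by (intro Bseq_monoseq_convergent BseqI'[of _ 1]) (auto simp: monoseq_iff)
    then show ?thesis unfolding w_def by (simp add: convergent_LIMSEQ_iff)
  qed
  show ?thesis
  proof (intro exI[of _ w] conjI allI ballI)
    fix \<kappa>
    show "0 \<le> w \<kappa>" "w \<kappa> \<le> 1" using bounds by (auto intro: LIMSEQ_le_const[OF lim] LIMSEQ_le_const2[OF lim])
  next
    fix \<kappa> assume "\<kappa> \<in> T" then show "\<phi> \<kappa> \<le> w \<kappa>" using lower by (auto intro: LIMSEQ_le_const[OF lim])
  next
    fix \<kappa> assume Q: "\<kappa> \<in> Q"
    have "(\<lambda>k. (?c + V \<kappa>) * it (Suc k) \<kappa>) \<longlonglongrightarrow> (?c + V \<kappa>) * w \<kappa>"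
      by (intro tendsto_mult_left LIMSEQ_Suc lim)
    moreover have "(\<lambda>k. (?c + V \<kappa>) * it (Suc k) \<kappa>) = (\<lambda>k. nb (it k) \<kappa>)"
      using Q c[of \<kappa>] by (simp add: it_Suc step_def)
    moreover have "(\<lambda>k. nb (it k) \<kappa>) \<longlonglongrightarrow> nb w \<kappa>"
      unfolding nb_def by (intro tendsto_sum tendsto_add lim)
    ultimately have "nb w \<kappa> = (?c + V \<kappa>) * w \<kappa>" using LIMSEQ_unique by metis
    then show "lattice_laplacian w \<kappa> = V \<kappa> * w \<kappa>" by (simp add: lap algebra_simps)
  qed
qed

subsection \<open>Passage to the continuum limit\<close>

text \<open>Compactness of a product of intervals replaces a diagonal sequence: the index set in the
  application, all multi-indices and all points, is uncountable. The price is a filter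
  \<open>H\<close> finer than \<open>sequentially\<close> instead of a subsequence.\<close>

lemma bounded_family_cluster:
  fixes G :: "nat \<Rightarrow> 'a \<Rightarrow> real"
  assumes "\<And>n x. \<bar>G n x\<bar> \<le> B x"
  shows "\<exists>g H. H \<noteq> bot \<and> H \<le> sequentially \<and> (\<forall>x. ((\<lambda>n. G n x) \<longlongrightarrow> g x) H)"
proof -
  let ?K = "PiE UNIV (\<lambda>x. {- B x..B x})"
  have "compactin (product_topology (\<lambda>_. euclidean) UNIV) ?K"
    by (simp add: compactin_PiE)
  then have "compact ?K"
    using compactin_euclidean_iff euclidean_product_topology by metis
  moreover have "filtermap G sequentially \<noteq> bot" by (simp add: filtermap_bot_iff)
  moreover have "eventually (\<lambda>f. f \<in> ?K) (filtermap G sequentially)"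
  proof -
    have "G n \<in> ?K" for n
      using abs_le_D1[OF assms] abs_le_D2[OF assms] by (auto simp: minus_le_iff)
    then show ?thesis by (simp add: eventually_filtermap)
  qed
  ultimately obtain g where g: "inf (nhds g) (filtermap G sequentially) \<noteq> bot"
    unfolding compact_filter by blast
  define H where "H = inf (filtercomap G (nhds g)) sequentially"
  have "H \<noteq> bot"
  proof
    assume "H = bot"
    then have "eventually (\<lambda>_. False) H" by simp
    then obtain P Q where P: "eventually P (filtercomap G (nhds g))" and Q: "eventually Q sequentially"
      and PQ: "\<And>n. P n \<Longrightarrow> Q n \<Longrightarrow> False" unfolding H_def eventually_inf by blast
    obtain P' where P': "eventually P' (nhds g)" "\<And>n. P' (G n) \<Longrightarrow> P n"
      using P unfolding eventually_filtercomap by blast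
    have "eventually (\<lambda>f. \<not> P' f) (filtermap G sequentially)"
      unfolding eventually_filtermap using Q by (rule eventually_mono) (use PQ P' in blast)
    then have "eventually (\<lambda>_. False) (inf (nhds g) (filtermap G sequentially))"
      unfolding eventually_inf using P'(1) by blast
    with g show False by (simp add: eventually_False)
  qed
  moreover have "H \<le> sequentially" by (simp add: H_def)
  moreover have "((\<lambda>n. G n x) \<longlongrightarrow> g x) H" for x
  proof -
    have "filterlim G (nhds g) H"
      unfolding filterlim_iff_le_filtercomap H_def by simp
    moreover have "((\<lambda>f. f x) \<longlongrightarrow> g x) (nhds g)"
    proof (rule iffD1[OF tendsto_at_iff_tendsto_nhds[of "\<lambda>f. f x" g]])
      show "((\<lambda>f. f x) \<longlongrightarrow> g x) (at g)"
      proof -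
        have "continuous_on UNIV (\<lambda>f::'a \<Rightarrow> real. f x)" by (rule continuous_on_product_coordinates)
        then show ?thesis unfolding continuous_on_def by simp
      qed
    qed
    ultimately show ?thesis using filterlim_compose by blast
  qed
  ultimately show ?thesis by blast
qed

text \<open>Values and slopes go through one induction, because the value at the next integer
  inherits the error of the current slope.\<close>

lemma int_taylor2_nonneg:
  fixes p :: "int \<Rightarrow> real"
  assumes "\<And>m. 0 \<le> m \<Longrightarrow> m < int a \<Longrightarrow> \<bar>p (m + 2) - 2 * p (m + 1) + p m\<bar> \<le> c"
  shows "\<bar>p (int a) - p 0 - real a * (p 1 - p 0)\<bar> \<le> c * (real a)\<^sup>2 \<and>
    \<bar>(p (int a + 1) - p (int a)) - (p 1 - p 0)\<bar> \<le> c * real a"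
  using assms
proof (induction a)
  case (Suc a)
  then have IH1: "\<bar>p (int a) - p 0 - real a * (p 1 - p 0)\<bar> \<le> c * (real a)\<^sup>2"
    and IH2: "\<bar>(p (int a + 1) - p (int a)) - (p 1 - p 0)\<bar> \<le> c * real a" by auto
  have s: "\<bar>p (int a + 2) - 2 * p (int a + 1) + p (int a)\<bar> \<le> c" using Suc.prems[of "int a"] by simp
  then have c: "c \<ge> 0" by linarith
  have "\<bar>p (int a + 1) - p 0 - (real a + 1) * (p 1 - p 0)\<bar> \<le> c * (real a)\<^sup>2 + c * real a"
    using IH1 IH2 by (simp add: algebra_simps abs_le_iff)
  also have "\<dots> \<le> c * (real a + 1)\<^sup>2" using c by (simp add: power2_eq_square algebra_simps)
  finally have 1: "\<bar>p (int a + 1) - p 0 - (real a + 1) * (p 1 - p 0)\<bar> \<le> c * (real a + 1)\<^sup>2" .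
  have 2: "\<bar>(p (int a + 2) - p (int a + 1)) - (p 1 - p 0)\<bar> \<le> c * (real a + 1)"
    using IH2 s by (simp add: algebra_simps abs_le_iff)
  show ?case using 1 2 by (simp add: add.commute)
qed simp

text \<open>For negative \<open>j\<close> the sequence is reflected. The backward slope at 0 differs
  from the forward one by a second difference, which costs the factor 2.\<close>

lemma int_taylor2:
  fixes p :: "int \<Rightarrow> real"
  assumes "\<And>m. min 0 j - 1 \<le> m \<Longrightarrow> m \<le> max 0 j \<Longrightarrow> \<bar>p (m + 2) - 2 * p (m + 1) + p m\<bar> \<le> c"
  shows "\<bar>p j - p 0 - real_of_int j * (p 1 - p 0)\<bar> \<le> 2 * c * (real_of_int j)\<^sup>2"
proof (cases "j \<ge> 0")
  case True
  have "\<bar>p (int (nat j)) - p 0 - real (nat j) * (p 1 - p 0)\<bar> \<le> c * (real (nat j))\<^sup>2"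
    by (rule conjunct1[OF int_taylor2_nonneg]) (use True in \<open>auto intro!: assms\<close>)
  moreover have "c \<ge> 0" using assms[of 0] by fastforce
  ultimately show ?thesis using True by (simp add: algebra_simps)
next
  case False
  define a where "a = nat (- j)"
  have a: "j = - int a" "a \<ge> 1" using False by (auto simp: a_def)
  have c: "c \<ge> 0" using assms[of 0] by fastforce
  have "\<bar>p (- int a) - p (-0) - real a * (p (-1) - p (-0))\<bar> \<le> c * (real a)\<^sup>2"
  proof (rule conjunct1[OF int_taylor2_nonneg, of a "\<lambda>m. p (- m)"])
    fix m :: int assume m: "0 \<le> m" "m < int a"
    have "\<bar>p (- m - 2 + 2) - 2 * p (- m - 2 + 1) + p (- m - 2)\<bar> \<le> c" using m a by (intro assms) auto
    then show "\<bar>p (- (m + 2)) - 2 * p (- (m + 1)) + p (- m)\<bar> \<le> c" by (simp add: algebra_simps)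
  qed
  moreover have "\<bar>p 1 - 2 * p 0 + p (-1)\<bar> \<le> c" using assms[of "-1"] a by simp
  then have "\<bar>real a * (p 1 - 2 * p 0 + p (-1))\<bar> \<le> real a * c"
    by (simp add: abs_mult mult_left_mono)
  moreover have "real a * c \<le> c * (real a)\<^sup>2" using a c
    by (simp add: power2_eq_square mult.commute mult_left_mono mult_le_cancel_left1)
  ultimately show ?thesis unfolding a(1) by (simp add: algebra_simps abs_le_iff)
qed

definition open_cube :: "(real^'n) set" where
  "open_cube = {z. \<forall>j. \<bar>z $ j\<bar> < 1/2}"

definition sample :: "nat \<Rightarrow> (real^'n::finite \<Rightarrow> real) \<Rightarrow> ('n \<Rightarrow> int) \<Rightarrow> real" where
  "sample n U \<kappa> = U (\<chi> j. \<kappa> j / real n)"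

text \<open>A jet lists all iterated partial derivatives; the remainder estimate is what makes the
  entry \<open>g (i # is)\<close> the derivative of \<open>g is\<close> in direction \<open>i\<close>.\<close>
definition jet_solution :: "(nat \<Rightarrow> real) \<Rightarrow> real \<Rightarrow> (real^'n::finite \<Rightarrow> real) \<Rightarrow> ('n list \<Rightarrow> real^'n \<Rightarrow> real) \<Rightarrow> bool" where
  "jet_solution C \<Lambda> U g \<longleftrightarrow>
     (\<forall>is. \<forall>z\<in>open_cube. \<bar>g is z\<bar> \<le> C (length is) * \<Lambda> ^ length is) \<and>
     (\<forall>is i t. \<forall>z\<in>open_cube. z + t *\<^sub>R axis i 1 \<in> open_cube \<longrightarrow>
        \<bar>g is (z + t *\<^sub>R axis i 1) - g is z - t * g (i # is) z\<bar> \<le> 2 * (C (length is + 2) * \<Lambda> ^ (length is + 2)) * t\<^sup>2) \<and>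
     (\<forall>z\<in>open_cube. (\<Sum>i\<in>UNIV. g [i, i] z) = U z * g [] z)"

text \<open>Points are rounded down to the lattice, and each jet entry is the limit of the
  corresponding difference quotient along one common filter. The bounds are uniform in the mesh, so
  they and the discrete Taylor remainders pass to the limit. The choice of \<open>C\<close> precedes
  that of \<open>\<Lambda>\<close>, \<open>U\<close> and \<open>w\<close>, so one choice serves all
  frequencies.\<close>

lemma interior_solution_limit:
  "\<exists>C. (\<forall>l. C l \<ge> 1) \<and> (\<forall>\<Lambda>\<ge>1. \<forall>n0. \<forall>U :: real^'n::finite \<Rightarrow> real. \<forall>w.
    continuous_on UNIV U \<longrightarrow> (\<forall>l. \<forall>n\<ge>1. lattice_bound n l 2 (b l * \<Lambda>) (sample n U)) \<longrightarrow>
    (\<forall>n\<ge>n0. lattice_solution n (sample n U) (w n)) \<longrightarrow>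
    (\<exists>g. jet_solution C \<Lambda> U g \<and> (\<forall>\<delta>. (\<forall>n\<ge>n0. \<delta> \<le> w n (\<lambda>_. 0)) \<longrightarrow> \<delta> \<le> g [] 0)))"
proof -
  define P where "P l C m0 \<longleftrightarrow> C \<ge> 1 \<and> (\<forall>n\<ge>m0. \<forall>\<Lambda>\<ge>1. \<forall>U w :: ('n \<Rightarrow> int) \<Rightarrow> real.
     lattice_bound n l 2 (b l * \<Lambda>) U \<longrightarrow> lattice_solution n U w \<longrightarrow>
     lattice_bound n l (shrink_radius l) (C * \<Lambda> ^ l) w)" for l C m0
  have "\<forall>l. \<exists>C m0. P l C m0" unfolding P_def by (intro allI interior_derivative_bounds)
  then obtain C m0 where P: "\<And>l. P l (C l) (m0 l)" by metis
  show ?thesis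
  proof (rule exI[of _ C], intro conjI allI impI)
    show "1 \<le> C l" for l using P unfolding P_def by blast
    then have C: "C l \<ge> 1" for l .
    fix \<Lambda> :: real and n0 and U :: "real^'n \<Rightarrow> real" and w
    assume \<Lambda>: "1 \<le> \<Lambda>" and cont: "continuous_on UNIV U"
      and U: "\<forall>l. \<forall>n\<ge>1. lattice_bound n l 2 (b l * \<Lambda>) (sample n U)"
      and sol: "\<forall>n\<ge>n0. lattice_solution n (sample n U) (w n)"
    define fl where "fl n z j = \<lfloor>real n * (z $ j)\<rfloor>" for n :: nat and z :: "real^'n" and j
    \<comment> \<open>For n at least 3 * (l + 2), the surplus n / (l + 2) of the radius over n / 2
      is at least 3 lattice steps, enough for rounding and the shifts below.\<close>
    define N where "N l = max (max n0 (m0 l)) (3 * l + 6)" for l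
    have bdw: "\<bar>lattice_diffs n is (w n) \<kappa>\<bar> \<le> C (length is) * \<Lambda> ^ length is"
      if n: "n \<ge> N (length is)" and \<kappa>: "\<And>j. \<bar>real_of_int (\<kappa> j)\<bar> \<le> n / 2 + 3" for n "is" \<kappa>
    proof -
      have n': "n \<ge> 1" "n \<ge> n0" "n \<ge> m0 (length is)" "real n \<ge> 3 * length is + 6" using n by (auto simp: N_def)
      have bound: "lattice_bound n (length is) (shrink_radius (length is)) (C (length is) * \<Lambda> ^ length is) (w n)"
        using P[of "length is"] U sol n' \<Lambda> unfolding P_def by blast
      have "\<bar>real_of_int (\<kappa> j)\<bar> \<le> shrink_radius (length is) * real n" for j
      proof -
        have "3 \<le> real n / (real (length is) + 2)" using n'(4) by (simp add: field_simps)
        then show ?thesis using \<kappa>[of j] by (simp add: shrink_radius_def algebra_simps)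
      qed
      then show ?thesis using bound unfolding lattice_bound_def by blast
    qed
    have flb: "\<bar>real_of_int (fl n z j)\<bar> \<le> n / 2 + 1" if "z \<in> open_cube" for n z j
    proof -
      have "\<bar>real n * (z $ j)\<bar> \<le> n * (1/2)" unfolding abs_mult
        using that by (intro mult_mono) (auto simp: open_cube_def less_imp_le)
      then show ?thesis unfolding fl_def by linarith
    qed
    \<comment> \<open>The default 0 makes the family bounded for every n and every point, as the
      cluster lemma requires; for fixed multi-index and a point of the cube it does not affect the
      limit.\<close>
    define G where "G n x = (case x of (is, z) \<Rightarrow>
        if z \<in> open_cube \<and> n \<ge> N (length is) then lattice_diffs n is (w n) (fl n z) else 0)" for n x
    have Gb: "\<bar>G n (is, z)\<bar> \<le> C (length is) * \<Lambda> ^ length is" for n "is" z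
    proof (cases "z \<in> open_cube \<and> n \<ge> N (length is)")
      case True
      then show ?thesis using flb[of z n] by (auto simp: G_def intro!: bdw order_trans[OF flb])
    next
      case False
      then show ?thesis using C[of "length is"] \<Lambda> by (auto simp: G_def)
    qed
    have Gev: "eventually (\<lambda>n. G n (is, z) = lattice_diffs n is (w n) (fl n z)) sequentially"
      if "z \<in> open_cube" for "is" z
      using eventually_ge_at_top[of "N (length is)"] by eventually_elim (simp add: G_def that)
    have "\<bar>G n x\<bar> \<le> C (length (fst x)) * \<Lambda> ^ length (fst x)" for n x
      using Gb[of n "fst x" "snd x"] by simp
    from bounded_family_cluster[of G, OF this] obtain g H where H: "H \<noteq> bot" "H \<le> sequentially"
      and lim: "\<And>x. ((\<lambda>n. G n x) \<longlongrightarrow> g x) H" by blast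
    have evH: "eventually P sequentially \<Longrightarrow> eventually P H" for P
      using H(2) by (rule filter_leD)
    have limH: "(f \<longlongrightarrow> l) sequentially \<Longrightarrow> (f \<longlongrightarrow> l) H" for f and l :: real
      using H(2) by (rule tendsto_mono)
    show "\<exists>g. jet_solution C \<Lambda> U g \<and> (\<forall>\<delta>. (\<forall>n\<ge>n0. \<delta> \<le> w n (\<lambda>_. 0)) \<longrightarrow> \<delta> \<le> g [] 0)"
      unfolding jet_solution_def
    proof (rule exI[of _ "\<lambda>is z. g (is, z)"], intro conjI allI ballI impI)
      fix "is" z
      show "\<bar>g (is, z)\<bar> \<le> C (length is) * \<Lambda> ^ length is"
        by (rule tendsto_upperbound[OF tendsto_rabs[OF lim]]) (auto simp: Gb H(1))
    next
      fix \<delta> assume d: "\<forall>n\<ge>n0. \<delta> \<le> w n (\<lambda>_. 0)"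
      have z: "(0::real^'n) \<in> open_cube" by (simp add: open_cube_def)
      have "eventually (\<lambda>n. \<delta> \<le> G n ([], 0)) sequentially"
        using Gev[OF z, of "[]"] eventually_ge_at_top[of n0]
      proof eventually_elim
        case (elim n)
        have "fl n 0 = (\<lambda>_. 0)" by (auto simp: fl_def)
        then show ?case using elim d by simp
      qed
      then show "\<delta> \<le> g ([], 0)" by (intro tendsto_lowerbound[OF lim evH H(1)])
    next
      fix "is" :: "'n list" and i t and z :: "real^'n"
      assume z: "z \<in> open_cube" and z': "z + t *\<^sub>R axis i 1 \<in> open_cube"
      let ?z' = "z + t *\<^sub>R axis i 1" let ?B = "C (length is + 2) * \<Lambda> ^ (length is + 2)"
      \<comment> \<open>The number of lattice steps between the two rounded points, which differ in
        coordinate \<open>i\<close> only; \<open>j n / n\<close> tends to \<open>t\<close>.\<close>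
      define j where "j n = fl n ?z' i - fl n z i" for n
      have flz': "fl n ?z' = (fl n z)(i := fl n z i + j n)" for n
        by (auto simp: j_def fl_def axis_def)
      have jt: "(\<lambda>n. real_of_int (j n) / real n) \<longlonglongrightarrow> t"
      proof -
        have "(\<lambda>n. real_of_int (j n) / real n - t) \<longlonglongrightarrow> 0"
        proof (rule Lim_null_comparison)
          show "eventually (\<lambda>n. norm (real_of_int (j n) / real n - t) \<le> 1 / real n) sequentially"
            using eventually_gt_at_top[of 0]
          proof eventually_elim
            case (elim n)
            have "\<bar>real_of_int (j n) - n * t\<bar> \<le> 1" unfolding j_def fl_def
              by (simp add: axis_def algebra_simps) linarith
            then have "\<bar>real_of_int (j n) - n * t\<bar> / n \<le> 1 / n" using elim by (simp add: divide_right_mono)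
            moreover have "real_of_int (j n) / n - t = (real_of_int (j n) - n * t) / n"
              using elim by (simp add: field_simps)
            ultimately show ?case using elim by simp
          qed
          show "(\<lambda>n. 1 / real n) \<longlonglongrightarrow> 0" by (rule lim_1_over_n)
        qed
        then show ?thesis by (simp add: LIM_zero_iff)
      qed
      have "eventually (\<lambda>n. \<bar>G n (is, ?z') - G n (is, z) - real_of_int (j n) / real n * G n (i # is, z)\<bar>
          \<le> 2 * ?B * (real_of_int (j n) / real n)\<^sup>2) sequentially"
        using Gev[OF z, of "is"] Gev[OF z', of "is"] Gev[OF z, of "i # is"]
          eventually_ge_at_top[of "max 1 (N (length is + 2))"]
      proof eventually_elim
        case (elim n)
        then have n: "n \<ge> 1" "n \<ge> N (length (i # i # is))" by auto
        \<comment> \<open>The difference quotient restricted to the lattice line in direction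
          \<open>i\<close>. Its second differences are quotients of order two higher divided by n^2,
          so the one-dimensional Taylor estimate applies.\<close>
        define p where "p m = lattice_diffs n is (w n) ((fl n z)(i := fl n z i + m))" for m
        have p2: "p (m + 2) - 2 * p (m + 1) + p m =
            1 / (real n)\<^sup>2 * lattice_diffs n (i # i # is) (w n) ((fl n z)(i := fl n z i + m))" for m
          unfolding lattice_diffs_Cons p_def lattice_diff_def using n(1)
          by (simp add: field_simps power2_eq_square)
        have "\<bar>p (j n) - p 0 - real_of_int (j n) * (p 1 - p 0)\<bar> \<le> 2 * (1 / (real n)\<^sup>2 * ?B) * (real_of_int (j n))\<^sup>2"
        proof (rule int_taylor2)
          fix m assume m: "min 0 (j n) - 1 \<le> m" "m \<le> max 0 (j n)"
          have "\<bar>lattice_diffs n (i # i # is) (w n) ((fl n z)(i := fl n z i + m))\<bar> \<le>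
              C (length (i # i # is)) * \<Lambda> ^ length (i # i # is)"
          proof (rule bdw[OF n(2)])
            fix k
            show "\<bar>real_of_int (((fl n z)(i := fl n z i + m)) k)\<bar> \<le> real n / 2 + 3"
            proof (cases "k = i")
              case True
              have "\<bar>real_of_int (fl n z i)\<bar> \<le> n / 2 + 1" "\<bar>real_of_int (fl n z i + j n)\<bar> \<le> n / 2 + 1"
                using flb[OF z, of n i] flb[OF z', of n i] by (auto simp: j_def)
              then show ?thesis using m True by (auto simp: min_def max_def abs_le_iff split: if_splits)
            next
              case False
              then show ?thesis using flb[OF z, of n k] by simp
            qed
          qed
          then show "\<bar>p (m + 2) - 2 * p (m + 1) + p m\<bar> \<le> 1 / (real n)\<^sup>2 * ?B"
            unfolding p2 abs_mult by (intro mult_mono) auto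
        qed
        moreover have "p (j n) = G n (is, ?z')" "p 0 = G n (is, z)"
          using elim by (auto simp: p_def flz')
        moreover have "real_of_int (j n) * (p 1 - p 0) = real_of_int (j n) / real n * G n (i # is, z)"
          using elim n(1) by (simp add: p_def lattice_diffs_Cons lattice_diff_def del: lattice_diffs.simps)
        ultimately show ?case by (simp add: power_divide)
      qed
      then have ev: "eventually (\<lambda>n. \<bar>G n (is, ?z') - G n (is, z) - real_of_int (j n) / real n * G n (i # is, z)\<bar>
          \<le> 2 * ?B * (real_of_int (j n) / real n)\<^sup>2) H" by (rule evH)
      show "\<bar>g (is, ?z') - g (is, z) - t * g (i # is, z)\<bar> \<le> 2 * ?B * t\<^sup>2"
        by (rule tendsto_le[OF H(1) _ _ ev]) (intro tendsto_intros lim limH[OF jt])+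
    next
      fix z :: "real^'n" assume z: "z \<in> open_cube"
      let ?U = "\<lambda>n. U (\<chi> j. fl n z j / real n)"
      have "(\<lambda>n. real_of_int (fl n z j) / real n) \<longlonglongrightarrow> z $ j" for j
      proof -
        have "(\<lambda>n. real_of_int (fl n z j) / real n - z $ j) \<longlonglongrightarrow> 0"
        proof (rule Lim_null_comparison)
          show "eventually (\<lambda>n. norm (real_of_int (fl n z j) / real n - z $ j) \<le> 1 / real n) sequentially"
            using eventually_gt_at_top[of 0]
          proof eventually_elim
            case (elim n)
            have "\<bar>real_of_int (fl n z j) - n * z $ j\<bar> \<le> 1" unfolding fl_def by linarith
            then have "\<bar>real_of_int (fl n z j) - n * z $ j\<bar> / n \<le> 1 / n" using elim by (simp add: divide_right_mono)
            moreover have "real_of_int (fl n z j) / n - z $ j = (real_of_int (fl n z j) - n * z $ j) / n"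
              using elim by (simp add: field_simps)
            ultimately show ?case using elim by simp
          qed
          show "(\<lambda>n. 1 / real n) \<longlonglongrightarrow> 0" by (rule lim_1_over_n)
        qed
        then show ?thesis by (simp add: LIM_zero_iff)
      qed
      then have "(\<lambda>n. \<chi> j. real_of_int (fl n z j) / real n) \<longlonglongrightarrow> (\<chi> j. z $ j)"
        by (rule tendsto_vec_lambda)
      moreover have "isCont U z" using cont by (simp add: continuous_on_eq_continuous_at)
      ultimately have Ulim: "?U \<longlonglongrightarrow> U z" using isCont_tendsto_compose by fastforce
      let ?E = "\<lambda>n. (\<Sum>i\<in>UNIV. G n ([i, i], z)) - ?U n * G n ([], z)"
      have "eventually (\<lambda>n. \<bar>?E n\<bar> \<le> CARD('n) * (C 3 * \<Lambda> ^ 3) * (1 / real n)) sequentially"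
      proof -
        have "eventually (\<lambda>n. \<forall>i\<in>UNIV. G n ([i, i], z) = lattice_diffs n [i, i] (w n) (fl n z)) sequentially"
          by (intro eventually_ball_finite ballI Gev[OF z]) auto
        then show ?thesis using Gev[OF z, of "[]"] eventually_ge_at_top[of "max 7 (N 3)"]
        proof eventually_elim
          case (elim n)
          then have n: "n \<ge> 7" "n \<ge> N 3" "n \<ge> n0" by (auto simp: N_def)
          \<comment> \<open>The equation contains the symmetric second difference, which is the
            forward one based one step back. Moving the base point costs a third difference quotient
            divided by n.\<close>
          let ?dn = "\<lambda>i. (fl n z)(i := fl n z i - 1)"
          have up: "(?dn i)(i := ?dn i i + 1) = fl n z" for i by auto
          have second: "lattice_diffs n [i, i] (w n) (?dn i) = (real n)\<^sup>2 *
              (w n ((fl n z)(i := fl n z i + 1)) + w n (?dn i) - 2 * w n (fl n z))" for i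
            by (simp add: lattice_diff_def power2_eq_square algebra_simps)
          have "(\<Sum>i\<in>UNIV. lattice_diffs n [i, i] (w n) (?dn i)) = (real n)\<^sup>2 * lattice_laplacian (w n) (fl n z)"
            unfolding second lattice_laplacian_def sum_distrib_left ..
          also have "\<dots> = ?U n * w n (fl n z)"
          proof -
            have "\<bar>fl n z j\<bar> < int n" for j using flb[OF z, of n j] n(1) by linarith
            then show ?thesis using sol n by (simp add: lattice_solution_def sample_def)
          qed
          finally have sm: "?U n * G n ([], z) = (\<Sum>i\<in>UNIV. lattice_diffs n [i, i] (w n) (?dn i))"
            using elim by simp
          have "\<bar>?E n\<bar> = \<bar>\<Sum>i\<in>UNIV. lattice_diffs n [i, i] (w n) (fl n z) - lattice_diffs n [i, i] (w n) (?dn i)\<bar>"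
            unfolding sm sum_subtractf using elim by simp
          also have "\<dots> \<le> (\<Sum>i\<in>(UNIV::'n set). C 3 * \<Lambda> ^ 3 * (1 / n))"
          proof (rule order_trans[OF sum_abs], rule sum_mono)
            fix i
            have "\<bar>lattice_diffs n [i, i, i] (w n) (?dn i)\<bar> \<le> C (length [i, i, i]) * \<Lambda> ^ length [i, i, i]"
            proof (rule bdw)
              show "\<bar>real_of_int (?dn i k)\<bar> \<le> real n / 2 + 3" for k
                using flb[OF z, of n k] by (cases "k = i") auto
            qed (use n in \<open>simp add: numeral_3_eq_3\<close>)
            also have "\<dots> = C 3 * \<Lambda> ^ 3" by (simp add: numeral_3_eq_3)
            finally have "\<bar>real n * (lattice_diffs n [i, i] (w n) (fl n z) - lattice_diffs n [i, i] (w n) (?dn i))\<bar> \<le> C 3 * \<Lambda> ^ 3"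
              unfolding lattice_diffs_Cons[of n i "[i, i]"] lattice_diff_def[of n i "lattice_diffs n [i, i] (w n)"] up .
            then show "\<bar>lattice_diffs n [i, i] (w n) (fl n z) - lattice_diffs n [i, i] (w n) (?dn i)\<bar> \<le> C 3 * \<Lambda> ^ 3 * (1 / n)"
              using n(1) unfolding abs_mult abs_of_nat by (simp add: pos_le_divide_eq mult.commute)
          qed
          finally show ?case by simp
        qed
      qed
      then have "eventually (\<lambda>n. norm (?E n) \<le> CARD('n) * (C 3 * \<Lambda> ^ 3) * (1 / real n)) sequentially" by simp
      then have "?E \<longlonglongrightarrow> 0"
        by (rule Lim_null_comparison) (intro tendsto_mult_right_zero lim_1_over_n)
      then have "(?E \<longlongrightarrow> 0) H" by (rule limH)
      moreover have "(?E \<longlongrightarrow> (\<Sum>i\<in>UNIV. g ([i, i], z)) - U z * g ([], z)) H"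
        by (intro tendsto_intros lim limH[OF Ulim])
      ultimately show "(\<Sum>i\<in>UNIV. g ([i, i], z)) = U z * g ([], z)"
        using tendsto_unique[OF H(1)] by fastforce
    qed
  qed
qed

subsection \<open>Polynomial potentials and a lower bound at the origin\<close>

text \<open>Bounds for all orders on all cubes, uniform in the mesh. The class contains constants
  and coordinates and is closed under sums and products, hence contains the potential.\<close>

definition lattice_bounded :: "(real^'n::finite \<Rightarrow> real) \<Rightarrow> bool" where
  "lattice_bounded f \<longleftrightarrow> (\<forall>l R. \<exists>a. \<forall>n\<ge>1. lattice_bound n l R a (sample n f))"

lemma lattice_diffs_const: "lattice_diffs n js (\<lambda>\<kappa>. c) \<kappa> = (if js = [] then c else 0)"
proof (cases js)
  case (Cons i "is")
  have "lattice_diff n i (\<lambda>\<kappa>. c) = (\<lambda>\<kappa>. 0 * 0)" by (auto simp: lattice_diff_def)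
  then show ?thesis unfolding Cons lattice_diffs.simps by (simp only: lattice_diffs_cmult) simp
qed simp

lemma lattice_bounded_const: "lattice_bounded (\<lambda>z. c)"
  unfolding lattice_bounded_def lattice_bound_def sample_def lattice_diffs_const
  by (intro allI exI[of _ "\<bar>c\<bar>"]) auto

lemma lattice_bounded_coord: "lattice_bounded (\<lambda>z. z $ k)"
  unfolding lattice_bounded_def lattice_bound_def
proof (intro allI)
  fix l :: nat and R :: real
  have "\<bar>lattice_diffs n js (sample n (\<lambda>z. z $ k)) \<kappa>\<bar> \<le> max R 1"
    if n: "n \<ge> 1" and \<kappa>: "\<forall>j. \<bar>real_of_int (\<kappa> j)\<bar> \<le> R * real n" for n js \<kappa>
  proof (cases js)
    case Nil
    then show ?thesis using n \<kappa>[rule_format, of k] by (simp add: sample_def field_simps abs_mult le_max_iff_disj)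
  next
    case (Cons i "is")
    have "lattice_diff n i (sample n (\<lambda>z. z $ k)) = (\<lambda>\<kappa>. if i = k then 1 else 0)"
      using n by (auto simp: sample_def lattice_diff_def field_simps)
    then show ?thesis by (auto simp: Cons lattice_diffs_const)
  qed
  then show "\<exists>a. \<forall>n\<ge>1. \<forall>js \<kappa>. length js \<le> l \<longrightarrow> (\<forall>j. \<bar>real_of_int (\<kappa> j)\<bar> \<le> R * real n) \<longrightarrow>
     \<bar>lattice_diffs n js (sample n (\<lambda>z. z $ k)) \<kappa>\<bar> \<le> a" by blast
qed

lemma lattice_bounded_add:
  assumes "lattice_bounded f" "lattice_bounded g"
  shows "lattice_bounded (\<lambda>z. f z + g z)"
  unfolding lattice_bounded_def
proof (intro allI)
  fix l :: nat and R :: real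
  obtain a b where ab: "\<forall>n\<ge>1. lattice_bound n l R a (sample n f)" "\<forall>n\<ge>1. lattice_bound n l R b (sample n g)"
    using assms unfolding lattice_bounded_def by metis
  have "lattice_bound n l R (a + b) (sample n (\<lambda>z. f z + g z))" if n: "n \<ge> 1" for n
    unfolding lattice_bound_def sample_def lattice_diffs_add
    using ab n unfolding lattice_bound_def sample_def
    by (intro allI impI order_trans[OF abs_triangle_ineq] add_mono) blast+
  then show "\<exists>a. \<forall>n\<ge>1. lattice_bound n l R a (sample n (\<lambda>z. f z + g z))" by blast
qed

lemma lattice_bounded_mult:
  fixes f g :: "real^'n::finite \<Rightarrow> real"
  assumes "lattice_bounded f" "lattice_bounded g"
  shows "lattice_bounded (\<lambda>z. f z * g z)"
  unfolding lattice_bounded_def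
proof (intro allI)
  fix l :: nat and R :: real
  \<comment> \<open>The product rule evaluates \<open>f\<close> up to l steps ahead, a physical
    distance of at most l / n \<le> l.\<close>
  obtain a b where ab: "\<forall>n\<ge>1. lattice_bound n l (R + l) a (sample n f)" "\<forall>n\<ge>1. lattice_bound n l R b (sample n g)"
    using assms unfolding lattice_bounded_def by metis
  have "lattice_bound n l R (2 ^ l * \<bar>a\<bar> * \<bar>b\<bar>) (sample n (\<lambda>z. f z * g z))" if n: "n \<ge> 1" for n
    unfolding lattice_bound_def
  proof (intro allI impI)
    fix js :: "'n list" and \<kappa> :: "'n \<Rightarrow> int"
    assume js: "length js \<le> l" and \<kappa>: "\<forall>j. \<bar>real_of_int (\<kappa> j)\<bar> \<le> R * real n"
    have "\<bar>lattice_diffs n js (\<lambda>\<kappa>. sample n f \<kappa> * sample n g \<kappa>) \<kappa>\<bar> \<le> 2 ^ length js * \<bar>a\<bar> * \<bar>b\<bar>"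
    proof (rule lattice_diffs_mult_bound)
      fix ks :: "'n list" and \<kappa>' assume ks: "length ks \<le> length js" and k: "\<And>j. \<kappa> j \<le> \<kappa>' j \<and> \<kappa>' j \<le> \<kappa> j + int (length js)"
      have "\<bar>real_of_int (\<kappa>' j)\<bar> \<le> (R + l) * real n" for j
      proof -
        have "\<bar>real_of_int (\<kappa>' j)\<bar> \<le> \<bar>real_of_int (\<kappa> j)\<bar> + real l" using k[of j] js by linarith
        also have "\<dots> \<le> R * n + l * n" using \<kappa> n by (intro add_mono) (auto simp: mult_le_cancel_left1)
        finally show ?thesis by (simp add: distrib_right)
      qed
      then have "\<bar>lattice_diffs n ks (sample n f) \<kappa>'\<bar> \<le> a" using ab(1) ks js n unfolding lattice_bound_def by simp
      then show "\<bar>lattice_diffs n ks (sample n f) \<kappa>'\<bar> \<le> \<bar>a\<bar>" by simp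
    next
      fix ks :: "'n list" assume ks: "length ks \<le> length js"
      then have "\<bar>lattice_diffs n ks (sample n g) \<kappa>\<bar> \<le> b" using ab(2) js n \<kappa> unfolding lattice_bound_def by simp
      then show "\<bar>lattice_diffs n ks (sample n g) \<kappa>\<bar> \<le> \<bar>b\<bar>" by simp
    qed auto
    also have "\<dots> \<le> 2 ^ l * \<bar>a\<bar> * \<bar>b\<bar>" using js by (intro mult_right_mono power_increasing) auto
    finally show "\<bar>lattice_diffs n js (sample n (\<lambda>z. f z * g z)) \<kappa>\<bar> \<le> 2 ^ l * \<bar>a\<bar> * \<bar>b\<bar>"
      by (simp add: sample_def[abs_def])
  qed
  then show "\<exists>a. \<forall>n\<ge>1. lattice_bound n l R a (sample n (\<lambda>z. f z * g z))" by blast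
qed

lemma lattice_bounded_sum:
  "finite A \<Longrightarrow> (\<And>i. i \<in> A \<Longrightarrow> lattice_bounded (f i)) \<Longrightarrow> lattice_bounded (\<lambda>z. \<Sum>i\<in>A. f i z)"
  by (induction A rule: finite_induct) (auto simp: lattice_bounded_const lattice_bounded_add)

lemma lattice_bounded_power: "lattice_bounded f \<Longrightarrow> lattice_bounded (\<lambda>z. f z ^ k)"
  by (induction k) (auto simp: lattice_bounded_const lattice_bounded_mult)

definition hom_poly :: "(nat \<Rightarrow> real) \<Rightarrow> nat \<Rightarrow> real \<Rightarrow> real \<Rightarrow> real" where
  "hom_poly c m s t = (\<Sum>a\<le>m. c a * (s ^ a * t ^ (m - a)))"

definition potential :: "nat set \<Rightarrow> (nat \<Rightarrow> nat \<Rightarrow> real) \<Rightarrow> nat \<Rightarrow> real^3 \<Rightarrow> real" where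
  "potential I c m z = (\<Sum>i\<in>I. (hom_poly (c i) m (z $ 1) (z $ 2))\<^sup>2)"

lemma potential_nonneg: "potential I c m z \<ge> 0"
  unfolding potential_def by (intro sum_nonneg) auto

lemma potential_continuous: "continuous_on UNIV (potential I c m)"
  unfolding potential_def hom_poly_def by (intro continuous_intros)

lemma potential_lattice_bounded: "finite I \<Longrightarrow> lattice_bounded (potential I c m)"
  unfolding potential_def hom_poly_def
  by (intro lattice_bounded_sum lattice_bounded_power lattice_bounded_mult lattice_bounded_const lattice_bounded_coord) auto

lemma potential_bound:
  "\<exists>B\<ge>0. \<forall>r z. \<bar>z $ 1\<bar> \<le> r \<longrightarrow> \<bar>z $ 2\<bar> \<le> r \<longrightarrow> potential I c m z \<le> B * r ^ (2 * m)"
proof (rule exI[of _ "\<Sum>i\<in>I. (\<Sum>a\<le>m. \<bar>c i a\<bar>)\<^sup>2"], intro conjI allI impI)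
  show "0 \<le> (\<Sum>i\<in>I. (\<Sum>a\<le>m. \<bar>c i a\<bar>)\<^sup>2)" by (intro sum_nonneg) auto
  fix r and z :: "real^3" assume r: "\<bar>z $ 1\<bar> \<le> r" "\<bar>z $ 2\<bar> \<le> r"
  then have r0: "r \<ge> 0" by linarith
  have P: "\<bar>hom_poly (c i) m (z $ 1) (z $ 2)\<bar> \<le> (\<Sum>a\<le>m. \<bar>c i a\<bar>) * r ^ m" for i
    unfolding hom_poly_def sum_distrib_right
  proof (rule order_trans[OF sum_abs], rule sum_mono)
    fix a assume a: "a \<in> {..m}"
    have "\<bar>z $ 1\<bar> ^ a * \<bar>z $ 2\<bar> ^ (m - a) \<le> r ^ a * r ^ (m - a)"
      using r r0 by (intro mult_mono power_mono) auto
    also have "\<dots> = r ^ m" using a by (simp add: power_add[symmetric])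
    finally show "\<bar>c i a * (z $ 1 ^ a * z $ 2 ^ (m - a))\<bar> \<le> \<bar>c i a\<bar> * r ^ m"
      by (simp add: abs_mult power_abs mult_left_mono)
  qed
  have "(hom_poly (c i) m (z $ 1) (z $ 2))\<^sup>2 \<le> (\<Sum>a\<le>m. \<bar>c i a\<bar>)\<^sup>2 * r ^ (2 * m)" for i
  proof -
    have "(hom_poly (c i) m (z $ 1) (z $ 2))\<^sup>2 \<le> ((\<Sum>a\<le>m. \<bar>c i a\<bar>) * r ^ m)\<^sup>2"
      using power_mono[OF P[of i], of 2] by simp
    then show ?thesis by (simp add: power_mult_distrib power_mult[symmetric] mult.commute)
  qed
  then show "potential I c m z \<le> (\<Sum>i\<in>I. (\<Sum>a\<le>m. \<bar>c i a\<bar>)\<^sup>2) * r ^ (2 * m)"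
    unfolding potential_def sum_distrib_right by (intro sum_mono)
qed

text \<open>The second-difference multiplier of cosh is 2 cosh - 2 and that of cos is 2 cos - 2.
  This bound and its companion for cos estimate both from below, as a subsolution requires.\<close>

lemma cosh_ge_quadratic: "cosh x \<ge> 1 + x\<^sup>2 / 2" for x :: real
proof -
  have "cosh (2 * (x / 2)) = 1 + 2 * (sinh (x / 2))\<^sup>2"
    unfolding cosh_double cosh_square_eq by simp
  moreover have "(x / 2)\<^sup>2 \<le> (sinh (x / 2))\<^sup>2"
    using real_le_abs_sinh[of "x / 2"] unfolding abs_le_square_iff[symmetric]
    by (simp add: sinh_field_def exp_minus)
  ultimately show ?thesis by (simp add: power_divide)
qed

lemma cos_ge_quadratic: "cos x \<ge> 1 - x\<^sup>2 / 2" for x :: real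
proof -
  have "cos (2 * (x / 2)) = 1 - 2 * (sin (x / 2))\<^sup>2"
    unfolding cos_double cos_squared_eq by simp
  moreover have "(sin (x / 2))\<^sup>2 \<le> (x / 2)\<^sup>2"
    using abs_sin_x_le_abs_x[of "x / 2"] unfolding abs_le_square_iff[symmetric] .
  ultimately show ?thesis by (simp add: power_divide)
qed

lemma cosh_le_exp: "x \<ge> 0 \<Longrightarrow> cosh x \<le> exp x" for x :: real
  using cosh_plus_sinh[of x] sinh_real_nonneg_iff[of x] by linarith

text \<open>The lattice solution with boundary value 1 stays above the subsolution
  \<open>cosh (\<mu>y) cos (ks\<^sub>1) cos (ks\<^sub>2)\<close>, which only lives where \<open>\<bar>s\<^sub>i\<bar> < \<pi>/(2k)\<close>; there the scaled potential
  \<open>k\<^bsup>2m+2\<^esup> V\<close> is of size \<open>k\<^sup>2\<close> by homogeneity, so that \<open>\<mu>\<close> proportional to \<open>k\<close> suffices.\<close>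
lemma lattice_solution_lower_bound:
  assumes fin: "finite I"
  shows "\<exists>D\<ge>0. \<forall>k\<ge>1. \<forall>n\<ge>k. \<exists>w.
    lattice_solution n (sample n (\<lambda>z. real k ^ (2 * m + 2) * potential I c m z)) w \<and>
    exp (- (D * real k)) \<le> w (\<lambda>_. 0)"
proof -
  obtain B where B: "B \<ge> 0" "\<And>r z. \<bar>z $ 1\<bar> \<le> r \<Longrightarrow> \<bar>z $ 2\<bar> \<le> r \<Longrightarrow> potential I c m z \<le> B * r ^ (2 * m)"
    using potential_bound[of I c m] by blast
  \<comment> \<open>With \<open>\<mu> = E * k\<close>, the gain E^2 k^2 in the third direction pays
    2 k^2 for the two cosines and B (pi/2)^(2m) k^2 for the potential where both cosines are
    positive.\<close>
  define E where "E = sqrt (2 + B * (pi / 2) ^ (2 * m))"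
  have E: "E \<ge> 0" "E\<^sup>2 = 2 + B * (pi / 2) ^ (2 * m)" using B(1) by (auto simp: E_def)
  show ?thesis
  proof (rule exI[of _ "2 * E"], intro conjI allI impI)
    show "0 \<le> 2 * E" using E by simp
    fix k n :: nat assume k: "1 \<le> k" and kn: "k \<le> n"
    have n: "real n > 0" "real k > 0" "real k / real n \<le> 1" using k kn by auto
    define \<mu> where "\<mu> = E * k"
    define Q :: "(3 \<Rightarrow> int) set" where "Q = {\<kappa>. \<forall>j. \<bar>\<kappa> j\<bar> < int n}"
    define h where "h = 1 / real n"
    define a where "a = real k * h"
    have h: "h > 0" and a: "a > 0" "a \<le> 1" using n by (auto simp: h_def a_def)
    \<comment> \<open>In the third direction \<open>T\<close> reaches twice as far as
      \<open>Q\<close>, so a step from \<open>Q\<close> leaves \<open>T\<close> only through a zero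
      of a cosine. The divisor cosh (2 * \<mu>) below normalises the subsolution on this longer
      range.\<close>
    define T :: "(3 \<Rightarrow> int) set" where "T = {\<kappa>. \<bar>a * \<kappa> 1\<bar> < pi / 2 \<and> \<bar>a * \<kappa> 2\<bar> < pi / 2 \<and> \<bar>\<kappa> 3\<bar> \<le> 2 * int n}"
    define \<phi> where "\<phi> \<kappa> = cosh (\<mu> * h * of_int (\<kappa> 3)) / cosh (2 * \<mu>) * cos (a * of_int (\<kappa> 1)) * cos (a * of_int (\<kappa> 2))"
      for \<kappa> :: "3 \<Rightarrow> int"
    define V where "V \<kappa> = h\<^sup>2 * (real k ^ (2 * m + 2) * potential I c m (\<chi> j. \<kappa> j / real n))" for \<kappa> :: "3 \<Rightarrow> int"
    have cosT: "cos (a * of_int (\<kappa> 1)) \<ge> 0" "cos (a * of_int (\<kappa> 2)) \<ge> 0" if "\<kappa> \<in> T" for \<kappa>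
      using that by (auto simp: T_def abs_less_iff intro!: cos_ge_zero)
    have "\<exists>w. (\<forall>\<kappa>. 0 \<le> w \<kappa> \<and> w \<kappa> \<le> 1) \<and> (\<forall>\<kappa>\<in>Q. lattice_laplacian w \<kappa> = V \<kappa> * w \<kappa>) \<and> (\<forall>\<kappa>\<in>T. \<phi> \<kappa> \<le> w \<kappa>)"
    proof (rule lattice_dirichlet_solution)
      show "0 \<le> V \<kappa>" for \<kappa> unfolding V_def by (intro mult_nonneg_nonneg potential_nonneg) auto
    next
      fix \<kappa> assume \<kappa>: "\<kappa> \<in> T"
      have "cosh (\<mu> * h * of_int (\<kappa> 3)) \<le> cosh (2 * \<mu>)"
      proof -
        have "\<bar>h * of_int (\<kappa> 3)\<bar> \<le> 2" using \<kappa> n unfolding T_def h_def by (simp add: abs_mult field_simps) linarith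
        then have "\<mu> * \<bar>h * of_int (\<kappa> 3)\<bar> \<le> \<mu> * 2" using E by (intro mult_left_mono) (auto simp: \<mu>_def)
        moreover have "\<bar>\<mu> * h * of_int (\<kappa> 3)\<bar> = \<mu> * \<bar>h * of_int (\<kappa> 3)\<bar>" using E by (simp add: abs_mult \<mu>_def)
        ultimately have "\<bar>\<mu> * h * of_int (\<kappa> 3)\<bar> \<le> 2 * \<mu>" by simp
        then have "cosh \<bar>\<mu> * h * of_int (\<kappa> 3)\<bar> \<le> cosh (2 * \<mu>)"
          by (subst cosh_real_nonneg_le_iff) auto
        then show ?thesis by simp
      qed
      then have "cosh (\<mu> * h * of_int (\<kappa> 3)) / cosh (2 * \<mu>) \<le> 1" by simp
      then have "cosh (\<mu> * h * of_int (\<kappa> 3)) / cosh (2 * \<mu>) * cos (a * of_int (\<kappa> 1)) \<le> 1 * 1"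
        using cosT[OF \<kappa>] by (intro mult_mono) auto
      then have "\<phi> \<kappa> \<le> 1 * 1" unfolding \<phi>_def
        using cosT[OF \<kappa>] by (intro mult_mono) auto
      then show "\<phi> \<kappa> \<le> 1" by simp
    next
      fix \<kappa> i d assume \<kappa>: "\<kappa> \<in> T" "\<kappa> \<in> Q" and d: "d \<in> {1, -1::int}" and nT: "\<kappa>(i := \<kappa> i + d) \<notin> T"
      \<comment> \<open>Since k \<le> n, one step changes the argument by at most 1, so a step out
        of (-pi/2, pi/2) lands before pi, where the cosine is nonpositive.\<close>
      have neg: "cos (a * of_int (\<kappa> j + d)) \<le> 0"
        if "\<bar>a * of_int (\<kappa> j)\<bar> < pi / 2" "\<not> \<bar>a * of_int (\<kappa> j + d)\<bar> < pi / 2" for j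
      proof -
        let ?x = "a * of_int (\<kappa> j + d)"
        have "\<bar>?x\<bar> < pi / 2 + pi / 2"
        proof -
          have "\<bar>?x\<bar> \<le> \<bar>a * of_int (\<kappa> j)\<bar> + a" using d a by (auto simp: algebra_simps)
          then show ?thesis using that(1) a(2) pi_gt3 by linarith
        qed
        then have "pi / 2 \<le> \<bar>?x\<bar>" "\<bar>?x\<bar> \<le> pi" using that(2) by auto
        then have "cos \<bar>?x\<bar> \<le> cos (pi / 2)" by (intro cos_monotone_0_pi_le) auto
        then show ?thesis by simp
      qed
      consider "i = 1" | "i = 2" | "i = 3" using exhaust_3 by blast
      then show "\<phi> (\<kappa>(i := \<kappa> i + d)) \<le> 0"
      proof cases
        case 1
        then have "\<not> \<bar>a * of_int (\<kappa> 1 + d)\<bar> < pi / 2" using nT \<kappa>(1) by (auto simp: T_def)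
        with neg[of 1] \<kappa>(1) have "cos (a * of_int (\<kappa> 1 + d)) \<le> 0" by (simp add: T_def)
        then have "cosh (\<mu> * h * of_int (\<kappa> 3)) / cosh (2 * \<mu>) * cos (a * of_int (\<kappa> 1 + d)) \<le> 0"
          by (intro mult_nonneg_nonpos) auto
        then have "cosh (\<mu> * h * of_int (\<kappa> 3)) / cosh (2 * \<mu>) * cos (a * of_int (\<kappa> 1 + d)) * cos (a * of_int (\<kappa> 2)) \<le> 0"
          using cosT(2)[OF \<kappa>(1)] by (rule mult_nonpos_nonneg)
        then show ?thesis unfolding \<phi>_def 1 by simp
      next
        case 2
        then have "\<not> \<bar>a * of_int (\<kappa> 2 + d)\<bar> < pi / 2" using nT \<kappa>(1) by (auto simp: T_def)
        with neg[of 2] \<kappa>(1) have "cos (a * of_int (\<kappa> 2 + d)) \<le> 0" by (simp add: T_def)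
        moreover have "0 \<le> cosh (\<mu> * h * of_int (\<kappa> 3)) / cosh (2 * \<mu>) * cos (a * of_int (\<kappa> 1))"
          using cosT(1)[OF \<kappa>(1)] by (intro mult_nonneg_nonneg) auto
        ultimately have "cosh (\<mu> * h * of_int (\<kappa> 3)) / cosh (2 * \<mu>) * cos (a * of_int (\<kappa> 1)) * cos (a * of_int (\<kappa> 2 + d)) \<le> 0"
          by (intro mult_nonneg_nonpos)
        then show ?thesis unfolding \<phi>_def 2 by simp
      next
        case 3
        have "\<bar>\<kappa> 3\<bar> < int n" using \<kappa>(2) by (simp add: Q_def)
        then have "\<bar>\<kappa> 3 + d\<bar> \<le> 2 * int n" using d by auto
        then have "\<kappa>(i := \<kappa> i + d) \<in> T" using \<kappa>(1) 3 by (auto simp: T_def)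
        then show ?thesis using nT by simp
      qed
    next
      fix \<kappa> assume \<kappa>: "\<kappa> \<in> T" "\<kappa> \<in> Q"
      have p0: "\<phi> \<kappa> \<ge> 0" unfolding \<phi>_def using cosT[OF \<kappa>(1)] by (intro mult_nonneg_nonneg) auto
      \<comment> \<open>By the addition formulas \<open>\<phi>\<close> is an exact eigenfunction of
        each second difference, so no discretisation error appears.\<close>
      have cs: "cos (a * (x + 1)) + cos (a * (x - 1)) = 2 * cos a * cos (a * x)" for x :: real
        by (simp add: cos_add cos_diff algebra_simps)
      have ch: "cosh (b * (x + 1)) + cosh (b * (x - 1)) = 2 * cosh b * cosh (b * x)" for b x :: real
        by (simp add: cosh_add cosh_diff algebra_simps)
      have d1: "\<phi> (\<kappa>(1 := \<kappa> 1 + 1)) + \<phi> (\<kappa>(1 := \<kappa> 1 - 1)) = 2 * cos a * \<phi> \<kappa>"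
      proof -
        have "\<phi> (\<kappa>(1 := \<kappa> 1 + 1)) + \<phi> (\<kappa>(1 := \<kappa> 1 - 1)) = cosh (\<mu> * h * of_int (\<kappa> 3)) / cosh (2 * \<mu>) *
          (cos (a * (of_int (\<kappa> 1) + 1)) + cos (a * (of_int (\<kappa> 1) - 1))) * cos (a * of_int (\<kappa> 2))"
          unfolding \<phi>_def by (simp add: distrib_left distrib_right)
        then show ?thesis unfolding cs \<phi>_def by simp
      qed
      have d2: "\<phi> (\<kappa>(2 := \<kappa> 2 + 1)) + \<phi> (\<kappa>(2 := \<kappa> 2 - 1)) = 2 * cos a * \<phi> \<kappa>"
      proof -
        have "\<phi> (\<kappa>(2 := \<kappa> 2 + 1)) + \<phi> (\<kappa>(2 := \<kappa> 2 - 1)) = cosh (\<mu> * h * of_int (\<kappa> 3)) / cosh (2 * \<mu>) *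
          cos (a * of_int (\<kappa> 1)) * (cos (a * (of_int (\<kappa> 2) + 1)) + cos (a * (of_int (\<kappa> 2) - 1)))"
          unfolding \<phi>_def by (simp add: distrib_left distrib_right)
        then show ?thesis unfolding cs \<phi>_def by simp
      qed
      have d3: "\<phi> (\<kappa>(3 := \<kappa> 3 + 1)) + \<phi> (\<kappa>(3 := \<kappa> 3 - 1)) = 2 * cosh (\<mu> * h) * \<phi> \<kappa>"
      proof -
        have "\<phi> (\<kappa>(3 := \<kappa> 3 + 1)) + \<phi> (\<kappa>(3 := \<kappa> 3 - 1)) =
          (cosh ((\<mu> * h) * (of_int (\<kappa> 3) + 1)) + cosh ((\<mu> * h) * (of_int (\<kappa> 3) - 1))) / cosh (2 * \<mu>) *
          cos (a * of_int (\<kappa> 1)) * cos (a * of_int (\<kappa> 2))"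
          unfolding \<phi>_def by (simp add: distrib_left distrib_right add_divide_distrib)
        then show ?thesis unfolding ch \<phi>_def by simp
      qed
      have lap: "lattice_laplacian \<phi> \<kappa> = (2 * cosh (\<mu> * h) - 2 + 2 * (2 * cos a - 2)) * \<phi> \<kappa>"
        unfolding lattice_laplacian_def sum_3 d1 d2 d3 by (simp add: algebra_simps)
      have "V \<kappa> \<le> h\<^sup>2 * ((real k)\<^sup>2 * (B * (pi / 2) ^ (2 * m)))"
      proof -
        have "potential I c m (\<chi> j. \<kappa> j / real n) \<le> B * (pi / 2 / k) ^ (2 * m)"
        proof (rule B(2))
          have ineq: "\<bar>real_of_int x / real n\<bar> \<le> pi / 2 / k" if "\<bar>a * of_int x\<bar> < pi / 2" for x
            using that n by (simp add: a_def h_def abs_mult field_simps)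
          show "\<bar>(\<chi> j. real_of_int (\<kappa> j) / real n) $ 1\<bar> \<le> pi / 2 / k"
            "\<bar>(\<chi> j. real_of_int (\<kappa> j) / real n) $ 2\<bar> \<le> pi / 2 / k"
            using \<kappa>(1) ineq by (auto simp: T_def)
        qed
        then have "real k ^ (2 * m + 2) * potential I c m (\<chi> j. \<kappa> j / real n) \<le> real k ^ (2 * m + 2) * (B * (pi / 2 / k) ^ (2 * m))"
          by (intro mult_left_mono) auto
        also have "\<dots> = (real k)\<^sup>2 * (B * (pi / 2) ^ (2 * m))"
          using n(2) by (simp add: power_add power_divide power2_eq_square)
        finally show ?thesis unfolding V_def by (intro mult_left_mono) auto
      qed
      also have "\<dots> = (\<mu> * h)\<^sup>2 - 2 * a\<^sup>2"
        unfolding \<mu>_def a_def power_mult_distrib E(2) by (simp add: algebra_simps)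
      also have "\<dots> \<le> 2 * cosh (\<mu> * h) - 2 + 2 * (2 * cos a - 2)"
      proof -
        have "x\<^sup>2 - 2 * y\<^sup>2 \<le> 2 * u - 2 + 2 * (2 * v - 2)"
          if "u \<ge> 1 + x\<^sup>2 / 2" "v \<ge> 1 - y\<^sup>2 / 2" for x y u v :: real
        proof -
          have "2 + x\<^sup>2 \<le> 2 * u" "2 - y\<^sup>2 \<le> 2 * v" using that by (simp_all add: field_simps)
          then show ?thesis unfolding right_diff_distrib by linarith
        qed
        then show ?thesis using cosh_ge_quadratic cos_ge_quadratic by blast
      qed
      finally show "V \<kappa> * \<phi> \<kappa> \<le> lattice_laplacian \<phi> \<kappa>" unfolding lap using p0 by (rule mult_right_mono)
    qed
    then obtain w where w: "\<And>\<kappa>. 0 \<le> w \<kappa> \<and> w \<kappa> \<le> 1" "\<And>\<kappa>. \<kappa> \<in> Q \<Longrightarrow> lattice_laplacian w \<kappa> = V \<kappa> * w \<kappa>"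
      "\<And>\<kappa>. \<kappa> \<in> T \<Longrightarrow> \<phi> \<kappa> \<le> w \<kappa>" by blast
    show "\<exists>w. lattice_solution n (sample n (\<lambda>z. real k ^ (2 * m + 2) * potential I c m z)) w \<and>
      exp (- (2 * E * real k)) \<le> w (\<lambda>_. 0)"
      unfolding lattice_solution_def
    proof (intro exI[of _ w] conjI allI impI)
      fix \<kappa> :: "3 \<Rightarrow> int"
      show "\<bar>w \<kappa>\<bar> \<le> 1" using w(1)[of \<kappa>] by simp
      assume "\<forall>j. \<bar>\<kappa> j\<bar> < int n"
      then show "lattice_laplacian w \<kappa> =
         1 / (real n)\<^sup>2 * (sample n (\<lambda>z. real k ^ (2 * m + 2) * potential I c m z) \<kappa> * w \<kappa>)"
        using w(2)[of \<kappa>] by (simp add: Q_def V_def h_def sample_def power_divide)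
    next
      have "(\<lambda>_. 0) \<in> T" by (simp add: T_def)
      then have "\<phi> (\<lambda>_. 0) \<le> w (\<lambda>_. 0)" by (rule w(3))
      \<comment> \<open>At the origin only the normalisation 1 / cosh (2 * \<mu>) is left, and it is
        at least exp (- 2 E k); hence the rate 2 * E.\<close>
      moreover have "exp (- (2 * E * real k)) \<le> \<phi> (\<lambda>_. 0)"
      proof -
        have "cosh (2 * \<mu>) \<le> exp (2 * \<mu>)" using E by (intro cosh_le_exp) (simp add: \<mu>_def)
        then have "1 / exp (2 * \<mu>) \<le> 1 / cosh (2 * \<mu>)" by (intro divide_left_mono) auto
        then show ?thesis by (simp add: \<phi>_def \<mu>_def exp_minus inverse_eq_divide mult.assoc)
      qed
      ultimately show "exp (- (2 * E * real k)) \<le> w (\<lambda>_. 0)" by linarith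
    qed
  qed
qed

subsection \<open>Superposition of the scaled solutions\<close>

text \<open>For each k the limit is taken over meshes n \<ge> k, the range of the lattice lower
  bound. The potential and all its differences scale by the same factor k^(2m+2), which therefore
  serves as \<open>\<Lambda>\<close>.\<close>

lemma scaled_solution_family:
  assumes fin: "finite I"
  shows "\<exists>D C. D \<ge> 0 \<and> (\<forall>l. C l \<ge> (1::real)) \<and> (\<forall>k\<ge>1. \<exists>g :: 3 list \<Rightarrow> real^3 \<Rightarrow> real.
    jet_solution C (real k ^ (2 * m + 2)) (\<lambda>z. real k ^ (2 * m + 2) * potential I c m z) g \<and>
    exp (- (D * real k)) \<le> g [] 0)"
proof -
  define U where "U k z = real k ^ (2 * m + 2) * potential I c m z" for k z
  obtain D where D: "D \<ge> 0" and sol: "\<And>k n. k \<ge> 1 \<Longrightarrow> n \<ge> k \<Longrightarrow> \<exists>w.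
    lattice_solution n (sample n (U k)) w \<and> exp (- (D * real k)) \<le> w (\<lambda>_. 0)"
    using lattice_solution_lower_bound[OF fin, of m c] unfolding U_def by blast
  have "\<forall>l. \<exists>b. \<forall>n\<ge>1. lattice_bound n l 2 b (sample n (potential I c m))"
    using potential_lattice_bounded[OF fin] unfolding lattice_bounded_def by blast
  then obtain b where b: "\<And>l n. n \<ge> 1 \<Longrightarrow> lattice_bound n l 2 (b l) (sample n (potential I c m))" by metis
  have bU: "lattice_bound n l 2 (b l * real k ^ (2 * m + 2)) (sample n (U k))" if n: "n \<ge> 1" for l n k
  proof -
    have eq: "sample n (U k) = (\<lambda>\<kappa>. real k ^ (2 * m + 2) * sample n (potential I c m) \<kappa>)"
      by (auto simp: sample_def U_def)
    show ?thesis
      using b[OF n, of l] unfolding lattice_bound_def eq lattice_diffs_cmult abs_mult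
      by (auto simp: mult.commute[of "b l"] intro!: mult_left_mono)
  qed
  obtain C where C: "\<forall>l. C l \<ge> 1" and lim: "\<forall>\<Lambda>\<ge>1. \<forall>n0. \<forall>U :: real^3 \<Rightarrow> real. \<forall>w.
    continuous_on UNIV U \<longrightarrow> (\<forall>l. \<forall>n\<ge>1. lattice_bound n l 2 (b l * \<Lambda>) (sample n U)) \<longrightarrow>
    (\<forall>n\<ge>n0. lattice_solution n (sample n U) (w n)) \<longrightarrow>
    (\<exists>g. jet_solution C \<Lambda> U g \<and> (\<forall>\<delta>. (\<forall>n\<ge>n0. \<delta> \<le> w n (\<lambda>_. 0)) \<longrightarrow> \<delta> \<le> g [] 0))"
    using interior_solution_limit[where b = b and 'n = 3] by (elim exE conjE)
  have "\<exists>g. jet_solution C (real k ^ (2 * m + 2)) (U k) g \<and> exp (- (D * real k)) \<le> g [] 0" if k: "k \<ge> 1" for k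
  proof -
    have \<Lambda>: "1 \<le> real k ^ (2 * m + 2)" using k by (intro one_le_power) simp
    have cont: "continuous_on UNIV (U k)"
      unfolding U_def by (intro continuous_intros potential_continuous)
    have "\<forall>n. \<exists>w. n \<ge> k \<longrightarrow> lattice_solution n (sample n (U k)) w \<and> exp (- (D * real k)) \<le> w (\<lambda>_. 0)"
      using sol[OF k] by blast
    from choice[OF this] obtain w where w: "\<forall>n. n \<ge> k \<longrightarrow>
      lattice_solution n (sample n (U k)) (w n) \<and> exp (- (D * real k)) \<le> w n (\<lambda>_. 0)" by blast
    then have "\<forall>n\<ge>k. lattice_solution n (sample n (U k)) (w n)" by blast
    with lim[THEN spec, THEN mp, OF \<Lambda>] cont bU
    obtain g where "jet_solution C (real k ^ (2 * m + 2)) (U k) g"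
      and low: "\<forall>\<delta>. (\<forall>n\<ge>k. \<delta> \<le> w n (\<lambda>_. 0)) \<longrightarrow> \<delta> \<le> g [] 0" by blast
    moreover have "exp (- (D * real k)) \<le> g [] 0" using low w by blast
    ultimately show ?thesis by blast
  qed
  with D C show ?thesis unfolding U_def by blast
qed

section \<open>Taylor estimates for jets\<close>

lemma open_cube_restrict:
  assumes "z \<in> open_cube" "z + \<zeta> \<in> open_cube"
  shows "z + (\<Sum>i\<in>A. (\<zeta> $ i) *\<^sub>R axis i 1) \<in> open_cube"
  unfolding open_cube_def
proof (intro CollectI allI)
  fix j
  have "(\<Sum>i\<in>A. (\<zeta> $ i) *\<^sub>R axis i 1) $ j = (if j \<in> A then \<zeta> $ j else 0)"
    by (simp add: axis_def sum.delta if_distrib cong: if_cong)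
  then show "\<bar>(z + (\<Sum>i\<in>A. (\<zeta> $ i) *\<^sub>R axis i 1)) $ j\<bar> < 1/2"
    using assms unfolding open_cube_def by (auto simp: vector_add_component)
qed

text \<open>The increment is made one coordinate at a time, along a path that a cube always
  contains. The Lipschitz bound replaces each partial derivative met on the way by its value at
  \<open>z\<close>.\<close>

lemma taylor_from_coordinates:
  fixes f :: "real^'n::finite \<Rightarrow> real" and f' :: "'n \<Rightarrow> real^'n \<Rightarrow> real"
  assumes z: "z \<in> open_cube" "z + \<zeta> \<in> open_cube" and K: "K \<ge> 0"
    and f: "\<And>i t y. y \<in> open_cube \<Longrightarrow> y + t *\<^sub>R axis i 1 \<in> open_cube \<Longrightarrow> \<bar>f (y + t *\<^sub>R axis i 1) - f y - t * f' i y\<bar> \<le> K * t\<^sup>2"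
    and f': "\<And>i j t y. y \<in> open_cube \<Longrightarrow> y + t *\<^sub>R axis j 1 \<in> open_cube \<Longrightarrow> \<bar>f' i (y + t *\<^sub>R axis j 1) - f' i y\<bar> \<le> 2 * K * \<bar>t\<bar>"
  shows "\<bar>f (z + \<zeta>) - f z - (\<Sum>i\<in>UNIV. \<zeta> $ i * f' i z)\<bar> \<le> 2 * K * (\<Sum>i\<in>UNIV. \<bar>\<zeta> $ i\<bar>)\<^sup>2"
proof -
  define p where "p A = z + (\<Sum>i\<in>A. (\<zeta> $ i) *\<^sub>R axis i 1)" for A :: "'n set"
  have pC: "p A \<in> open_cube" for A unfolding p_def by (rule open_cube_restrict[OF z])
  have main: "(\<forall>j. \<bar>f' j (p A) - f' j z\<bar> \<le> 2 * K * (\<Sum>i\<in>A. \<bar>\<zeta> $ i\<bar>)) \<and>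
    \<bar>f (p A) - f z - (\<Sum>i\<in>A. \<zeta> $ i * f' i z)\<bar> \<le> 2 * K * (\<Sum>i\<in>A. \<bar>\<zeta> $ i\<bar>)\<^sup>2" if "finite A" for A
    using that
  proof (induction A rule: finite_induct)
    case empty
    then show ?case by (simp add: p_def)
  next
    case (insert k A)
    let ?s = "\<Sum>i\<in>A. \<bar>\<zeta> $ i\<bar>" let ?t = "\<zeta> $ k"
    have s0: "?s \<ge> 0" by (intro sum_nonneg) auto
    have pk: "p (insert k A) = p A + ?t *\<^sub>R axis k 1" using insert by (simp add: p_def add_ac)
    have 1: "\<bar>f' j (p (insert k A)) - f' j z\<bar> \<le> 2 * K * (?s + \<bar>?t\<bar>)" for j
    proof -
      have "\<bar>f' j (p (insert k A)) - f' j (p A)\<bar> \<le> 2 * K * \<bar>?t\<bar>"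
        unfolding pk using f'[OF pC[of A], of ?t k] pC[of "insert k A"] pk by simp
      moreover have "\<bar>f' j (p A) - f' j z\<bar> \<le> 2 * K * ?s" using insert.IH by blast
      ultimately show ?thesis unfolding distrib_left by linarith
    qed
    have a: "\<bar>f (p (insert k A)) - f (p A) - ?t * f' k (p A)\<bar> \<le> K * ?t\<^sup>2"
      unfolding pk using f[OF pC[of A], of ?t k] pC[of "insert k A"] pk by simp
    have b: "\<bar>?t * f' k (p A) - ?t * f' k z\<bar> \<le> \<bar>?t\<bar> * (2 * K * ?s)"
      unfolding right_diff_distrib[symmetric] abs_mult using insert.IH by (intro mult_left_mono) auto
    have c: "\<bar>f (p A) - f z - (\<Sum>i\<in>A. \<zeta> $ i * f' i z)\<bar> \<le> 2 * K * ?s\<^sup>2" using insert.IH by blast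
    have "\<bar>f (p (insert k A)) - f z - (?t * f' k z + (\<Sum>i\<in>A. \<zeta> $ i * f' i z))\<bar> \<le> K * ?t\<^sup>2 + \<bar>?t\<bar> * (2 * K * ?s) + 2 * K * ?s\<^sup>2"
      using a b c by linarith
    also have "\<dots> \<le> 2 * K * (\<bar>?t\<bar> + ?s)\<^sup>2"
    proof -
      have "2 * K * (\<bar>?t\<bar> + ?s)\<^sup>2 = K * ?t\<^sup>2 + \<bar>?t\<bar> * (2 * K * ?s) + 2 * K * ?s\<^sup>2 + (K * ?t\<^sup>2 + 2 * K * \<bar>?t\<bar> * ?s)"
        by (simp add: power2_eq_square algebra_simps)
      moreover have "K * ?t\<^sup>2 + 2 * K * \<bar>?t\<bar> * ?s \<ge> 0" using K s0 by (intro add_nonneg_nonneg mult_nonneg_nonneg) auto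
      ultimately show ?thesis by linarith
    qed
    finally show ?case using 1 insert by (simp add: add.commute)
  qed
  have "p UNIV = z + \<zeta>" unfolding p_def
    by (simp add: vec_eq_iff axis_def sum.delta if_distrib cong: if_cong)
  then show ?thesis using main[of UNIV] by simp
qed

text \<open>The Lipschitz bound for a partial derivative comes from its own remainder estimate
  together with the bound on the next jet entry; in a cube of side 1 the quadratic remainder is
  dominated by a linear one.\<close>

lemma jet_taylor:
  assumes C: "\<And>l. C l \<ge> 1" and \<Lambda>: "\<Lambda> \<ge> 1" and g: "jet_solution C \<Lambda> U g"
    and z: "z \<in> open_cube" "z + \<zeta> \<in> (open_cube :: (real^'n::finite) set)"
  shows "\<bar>g is (z + \<zeta>) - g is z - (\<Sum>i\<in>UNIV. \<zeta> $ i * g (i # is) z)\<bar>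
    \<le> 2 * (2 * (C (length is + 2) + C (length is + 3)) * \<Lambda> ^ (length is + 3)) * (\<Sum>i\<in>UNIV. \<bar>\<zeta> $ i\<bar>)\<^sup>2"
proof -
  have b: "\<bar>g is z\<bar> \<le> C (length is) * \<Lambda> ^ length is" if "z \<in> open_cube" for "is" z
    using g that unfolding jet_solution_def by blast
  have t: "\<bar>g is (z + t *\<^sub>R axis i 1) - g is z - t * g (i # is) z\<bar> \<le> 2 * (C (length is + 2) * \<Lambda> ^ (length is + 2)) * t\<^sup>2"
    if "z \<in> open_cube" "z + t *\<^sub>R axis i 1 \<in> open_cube" for "is" i t z
    using g that unfolding jet_solution_def by blast
  define l where "l = length is"
  \<comment> \<open>One constant for the three quantities in play: the remainder at
    \<open>is\<close>, the remainder at \<open>i # is\<close> and the size of the second-order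
    entries.\<close>
  define K where "K = 2 * (C (l + 2) + C (l + 3)) * \<Lambda> ^ (l + 3)"
  have C0: "C j \<ge> 0" for j using C[of j] by linarith
  have K0: "K \<ge> 0" unfolding K_def using C0 \<Lambda> by (intro mult_nonneg_nonneg add_nonneg_nonneg) auto
  have L: "\<Lambda> ^ (l + 2) \<le> \<Lambda> ^ (l + 3)" using \<Lambda> by (intro power_increasing) auto
  have K2: "2 * (C (l + 2) * \<Lambda> ^ (l + 2)) \<le> K"
  proof -
    have "C (l + 2) * \<Lambda> ^ (l + 2) \<le> (C (l + 2) + C (l + 3)) * \<Lambda> ^ (l + 3)"
      using L C0 \<Lambda> by (intro mult_mono) auto
    then show ?thesis unfolding K_def mult.assoc by (rule mult_left_mono) simp
  qed
  have K2': "C (l + 2) * \<Lambda> ^ (l + 2) \<le> K" using K2 mult_nonneg_nonneg[OF C0, of "\<Lambda> ^ (l + 2)" "l + 2"] \<Lambda> by simp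
  have K3: "2 * (C (l + 3) * \<Lambda> ^ (l + 3)) \<le> K"
  proof -
    have "C (l + 3) * \<Lambda> ^ (l + 3) \<le> (C (l + 2) + C (l + 3)) * \<Lambda> ^ (l + 3)"
      using C0 \<Lambda> by (intro mult_right_mono) auto
    then show ?thesis unfolding K_def mult.assoc by (rule mult_left_mono) simp
  qed
  have "\<bar>g is (z + \<zeta>) - g is z - (\<Sum>i\<in>UNIV. \<zeta> $ i * g (i # is) z)\<bar> \<le> 2 * K * (\<Sum>i\<in>UNIV. \<bar>\<zeta> $ i\<bar>)\<^sup>2"
  proof (rule taylor_from_coordinates[OF z K0])
    fix i t y assume y: "y \<in> open_cube" "y + t *\<^sub>R axis i (1::real) \<in> (open_cube :: (real^'n) set)"
    have "2 * (C (l + 2) * \<Lambda> ^ (l + 2)) * t\<^sup>2 \<le> K * t\<^sup>2" using K2 by (rule mult_right_mono) simp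
    then show "\<bar>g is (y + t *\<^sub>R axis i 1) - g is y - t * g (i # is) y\<bar> \<le> K * t\<^sup>2"
      using t[OF y, of "is"] by (simp add: l_def)
  next
    fix i j t y assume y: "y \<in> open_cube" "y + t *\<^sub>R axis j (1::real) \<in> (open_cube :: (real^'n) set)"
    have "\<bar>t\<bar> \<le> 1"
    proof -
      have "\<bar>y $ j\<bar> < 1/2" "\<bar>y $ j + t\<bar> < 1/2"
        using y unfolding open_cube_def by (auto simp: axis_def dest: spec[of _ j])
      then show ?thesis by linarith
    qed
    then have t2: "t\<^sup>2 \<le> \<bar>t\<bar>" by (metis abs_ge_zero abs_mult_self_eq mult_left_le_one_le power2_eq_square)
    have "2 * (C (l + 3) * \<Lambda> ^ (l + 3)) * t\<^sup>2 \<le> K * \<bar>t\<bar>" using K3 t2 K0 by (intro mult_mono) auto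
    then have "\<bar>g (i # is) (y + t *\<^sub>R axis j 1) - g (i # is) y - t * g (j # i # is) y\<bar> \<le> K * \<bar>t\<bar>"
      using t[OF y, of "i # is"] by (simp add: l_def numeral_3_eq_3)
    moreover have "\<bar>t * g (j # i # is) y\<bar> \<le> K * \<bar>t\<bar>"
    proof -
      have "\<bar>g (j # i # is) y\<bar> \<le> K" using b[OF y(1), of "j # i # is"] K2' by (simp add: l_def)
      from mult_left_mono[OF this abs_ge_zero[of t]] show ?thesis by (simp add: abs_mult mult.commute)
    qed
    ultimately show "\<bar>g (i # is) (y + t *\<^sub>R axis j 1) - g (i # is) y\<bar> \<le> 2 * K * \<bar>t\<bar>" by linarith
  qed
  then show ?thesis unfolding K_def l_def .
qed

text \<open>All derivatives of \<open>cos + sin\<close> have modulus 1 at 0, so real-valued superpositions keep every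
  Taylor coefficient.\<close>
definition trig :: "nat \<Rightarrow> real \<Rightarrow> real" where
  "trig j x = cos (x + j * (pi / 2)) + sin (x + j * (pi / 2))"

lemma trig_shift: "cos (x + real (Suc j) * (pi / 2)) = - sin (x + j * (pi / 2))"
  "sin (x + real (Suc j) * (pi / 2)) = cos (x + j * (pi / 2))"
proof -
  have eq: "x + real (Suc j) * (pi / 2) = (x + j * (pi / 2)) + pi / 2" by (simp add: algebra_simps)
  show "cos (x + real (Suc j) * (pi / 2)) = - sin (x + j * (pi / 2))"
    "sin (x + real (Suc j) * (pi / 2)) = cos (x + j * (pi / 2))"
    unfolding eq by (simp_all add: cos_add sin_add)
qed

lemma trig_DERIV: "(trig j has_real_derivative trig (Suc j) x) (at x)"
proof -
  have "((\<lambda>x. cos (x + j * (pi / 2)) + sin (x + j * (pi / 2))) has_real_derivative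
      - sin (x + j * (pi / 2)) + cos (x + j * (pi / 2))) (at x)"
    by (auto intro!: derivative_eq_intros)
  then show ?thesis unfolding trig_shift trig_def[abs_def] by simp
qed

lemma trig_bound: "\<bar>trig j x\<bar> \<le> 2"
  unfolding trig_def using abs_cos_le_one[of "x + j * (pi / 2)"] abs_sin_le_one[of "x + j * (pi / 2)"] by linarith

lemma trig_2: "trig (Suc (Suc 0)) x = - trig 0 x"
  unfolding trig_def trig_shift by simp

lemma trig_at_0: "\<bar>trig j 0\<bar> = 1"
proof -
  let ?a = "0 + real j * (pi / 2)"
  have "(trig j 0)\<^sup>2 = 1 + 2 * sin ?a * cos ?a"
    unfolding trig_def using sin_cos_squared_add[of ?a] by (simp only: power2_sum) (simp add: algebra_simps)
  also have "2 * sin ?a * cos ?a = sin (real j * pi)" by (simp add: sin_double[symmetric])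
  finally have "(trig j 0)\<^sup>2 = 1" by simp
  then show ?thesis by (metis abs_1 abs_eq_iff power2_eq_1_iff)
qed

lemma trig_taylor: "\<bar>trig j (x + y) - trig j x - y * trig (Suc j) x\<bar> \<le> 2 * y\<^sup>2"
proof -
  have lip: "\<bar>trig (Suc j) u - trig (Suc j) v\<bar> \<le> 2 * \<bar>u - v\<bar>" for u v
  proof -
    have "norm (trig (Suc j) u - trig (Suc j) v) \<le> 2 * norm (u - v)"
      by (rule field_differentiable_bound[OF convex_UNIV, of _ "trig (Suc (Suc j))"])
         (auto intro: trig_bound DERIV_subset[OF trig_DERIV])
    then show ?thesis by simp
  qed
  let ?f = "\<lambda>s. trig j (x + s) - s * trig (Suc j) x"
  have "norm (?f y - ?f 0) \<le> (2 * \<bar>y\<bar>) * norm (y - 0)"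
  proof (rule field_differentiable_bound[OF convex_closed_segment[of 0 y], of _ "\<lambda>s. trig (Suc j) (x + s) - trig (Suc j) x"])
    fix s assume s: "s \<in> closed_segment 0 y"
    show "(?f has_field_derivative trig (Suc j) (x + s) - trig (Suc j) x) (at s within closed_segment 0 y)"
      by (rule DERIV_subset[OF _ subset_UNIV])
         (auto intro!: derivative_eq_intros DERIV_chain'[OF _ trig_DERIV, of "\<lambda>s. x + s" 1, simplified])
    have "\<bar>s\<bar> \<le> \<bar>y\<bar>" using s by (auto simp: closed_segment_eq_real_ivl split: if_splits)
    then show "norm (trig (Suc j) (x + s) - trig (Suc j) x) \<le> 2 * \<bar>y\<bar>"
      using lip[of "x + s" x] by simp
  qed auto
  then show ?thesis by (simp add: power2_eq_square algebra_simps abs_mult_self_eq)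
qed

section \<open>Exponentially weighted moments and the Gevrey bounds\<close>

lemma power_le_fact_exp: "x ^ N \<le> fact N * exp x" if "x \<ge> 0" for x :: real
proof -
  have s: "(\<lambda>n. x ^ n /\<^sub>R fact n) sums exp x" by (rule exp_converges)
  have "sum (\<lambda>n. x ^ n /\<^sub>R fact n) {N} \<le> (\<Sum>n. x ^ n /\<^sub>R fact n)"
    by (rule sum_le_suminf) (use s that in \<open>auto simp: sums_iff\<close>)
  then have "x ^ N / fact N \<le> exp x" using s by (simp add: sums_iff divide_inverse mult.commute)
  then show ?thesis by (simp add: pos_divide_le_eq mult.commute)
qed

lemma summable_exp_geometric: "a > 0 \<Longrightarrow> summable (\<lambda>n. exp (- (a * real (Suc n))))"
proof -
  assume a: "a > 0"
  have "summable (\<lambda>n. exp (- a) * exp (- a) ^ n)" using a by (intro summable_mult summable_geometric) simp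
  moreover have "exp (- (a * real (Suc n))) = exp (- a) * exp (- a) ^ n" for n
    by (simp add: exp_of_nat_mult[symmetric] exp_add[symmetric] algebra_simps)
  ultimately show ?thesis by simp
qed

text \<open>Half of the exponential absorbs the power, the other half is summed as a geometric
  series.\<close>

lemma summable_exp_power: "summable (\<lambda>n. exp (- real (Suc n)) * real (Suc n) ^ N)"
proof (rule summable_comparison_test[OF _ summable_mult[OF summable_exp_geometric[of "1/2"], of "fact N * 2 ^ N"]])
  have "norm (exp (- real (Suc n)) * real (Suc n) ^ N) \<le> fact N * 2 ^ N * exp (- (1/2 * real (Suc n)))" for n
  proof -
    let ?x = "real (Suc n)"
    have "?x ^ N = 2 ^ N * (?x / 2) ^ N" by (simp add: power_divide)
    also have "\<dots> \<le> 2 ^ N * (fact N * exp (?x / 2))" by (intro mult_left_mono power_le_fact_exp) auto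
    finally have "exp (- ?x) * ?x ^ N \<le> exp (- ?x) * (2 ^ N * (fact N * exp (?x / 2)))"
      by (intro mult_left_mono) auto
    also have "\<dots> = fact N * 2 ^ N * (exp (- ?x) * exp (?x / 2))" by (simp add: mult_ac)
    also have "exp (- ?x) * exp (?x / 2) = exp (- (1/2 * ?x))" by (simp add: exp_add[symmetric] field_simps)
    finally show ?thesis by simp
  qed
  then show "\<exists>M. \<forall>n\<ge>M. norm (exp (- real (Suc n)) * real (Suc n) ^ N) \<le> fact N * 2 ^ N * exp (- (1/2 * real (Suc n)))"
    by blast
qed auto

text \<open>For the lower bound a single term suffices, the one with base \<sigma>, because
  \<sigma>^\<sigma> dominates the factorial. For the upper bound, x^\<sigma> is at most
  q^(-\<sigma>) \<sigma>! exp(q x), raised to the power m + 1. The choice of \<open>q\<close> makes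
  this use exactly half of the exponential and leaves the other half for convergence.\<close>

lemma gevrey_moment_bounds:
  fixes K :: real
  assumes K: "K > 0"
  shows "\<exists>c C. c > 0 \<and> C > 0 \<and> (\<forall>\<sigma>. summable (\<lambda>n. exp (- (K * real (Suc n))) * (real (Suc n) ^ (m + 1)) ^ \<sigma>) \<and>
    c ^ (\<sigma> + 1) * fact \<sigma> ^ (m + 1) \<le> (\<Sum>n. exp (- (K * real (Suc n))) * (real (Suc n) ^ (m + 1)) ^ \<sigma>) \<and>
    (\<Sum>n. exp (- (K * real (Suc n))) * (real (Suc n) ^ (m + 1)) ^ \<sigma>) \<le> C ^ (\<sigma> + 1) * fact \<sigma> ^ (m + 1))"
proof -
  define q where "q = K / (2 * real (m + 1))"
  have q: "q > 0" using K by (simp add: q_def)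
  define E where "E = (\<Sum>n. exp (- (K / 2 * real (Suc n))))"
  have sE: "summable (\<lambda>n. exp (- (K / 2 * real (Suc n))))" using K by (intro summable_exp_geometric) simp
  have E: "E \<ge> 0" unfolding E_def by (rule suminf_nonneg[OF sE]) simp
  define C where "C = max 1 (max E ((1 / q) ^ (m + 1)))"
  have C: "C \<ge> 1" "E \<le> C" "(1 / q) ^ (m + 1) \<le> C" by (auto simp: C_def)
  define T where "T \<sigma> n = exp (- (K * real (Suc n))) * (real (Suc n) ^ (m + 1)) ^ \<sigma>" for \<sigma> n
  have T0: "T \<sigma> n \<ge> 0" for \<sigma> n by (simp add: T_def)
  have Tup: "T \<sigma> n \<le> fact \<sigma> ^ (m + 1) * ((1 / q) ^ (m + 1)) ^ \<sigma> * exp (- (K / 2 * real (Suc n)))" for \<sigma> n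
  proof -
    let ?x = "real (Suc n)"
    have "?x ^ \<sigma> = (1 / q) ^ \<sigma> * (q * ?x) ^ \<sigma>" using q by (simp add: power_divide power_mult_distrib)
    also have "\<dots> \<le> (1 / q) ^ \<sigma> * (fact \<sigma> * exp (q * ?x))"
      using q by (intro mult_left_mono power_le_fact_exp) auto
    finally have "(?x ^ \<sigma>) ^ (m + 1) \<le> ((1 / q) ^ \<sigma> * (fact \<sigma> * exp (q * ?x))) ^ (m + 1)"
      by (intro power_mono) auto
    also have "\<dots> = fact \<sigma> ^ (m + 1) * ((1 / q) ^ (m + 1)) ^ \<sigma> * exp (q * ?x) ^ (m + 1)"
      unfolding power_mult_distrib by (simp only: power_mult[symmetric] mult_ac)
    also have "exp (q * ?x) ^ (m + 1) = exp (K / 2 * ?x)"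
      unfolding exp_of_nat_mult[symmetric] q_def using K by (simp add: field_simps)
    finally have "(?x ^ (m + 1)) ^ \<sigma> \<le> fact \<sigma> ^ (m + 1) * ((1 / q) ^ (m + 1)) ^ \<sigma> * exp (K / 2 * ?x)"
      by (simp only: power_mult[symmetric] mult.commute)
    then have "T \<sigma> n \<le> exp (- (K * ?x)) * (fact \<sigma> ^ (m + 1) * ((1 / q) ^ (m + 1)) ^ \<sigma> * exp (K / 2 * ?x))"
      unfolding T_def by (intro mult_left_mono) auto
    also have "\<dots> = fact \<sigma> ^ (m + 1) * ((1 / q) ^ (m + 1)) ^ \<sigma> * (exp (- (K * ?x)) * exp (K / 2 * ?x))"
      by (simp only: mult_ac)
    also have "exp (- (K * ?x)) * exp (K / 2 * ?x) = exp (- (K / 2 * ?x))"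
      unfolding exp_add[symmetric] by (simp add: field_simps)
    finally show ?thesis .
  qed
  have sT: "summable (T \<sigma>)" for \<sigma>
    by (rule summable_comparison_test'[OF summable_mult[OF sE], of 0 _ "fact \<sigma> ^ (m + 1) * ((1 / q) ^ (m + 1)) ^ \<sigma>"])
       (use T0 Tup in auto)
  have up: "suminf (T \<sigma>) \<le> C ^ (\<sigma> + 1) * fact \<sigma> ^ (m + 1)" for \<sigma>
  proof -
    have "suminf (T \<sigma>) \<le> (\<Sum>n. fact \<sigma> ^ (m + 1) * ((1 / q) ^ (m + 1)) ^ \<sigma> * exp (- (K / 2 * real (Suc n))))"
      by (intro suminf_le Tup sT summable_mult sE)
    also have "\<dots> = fact \<sigma> ^ (m + 1) * (((1 / q) ^ (m + 1)) ^ \<sigma> * E)"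
      unfolding E_def suminf_mult[OF sE] by (simp only: mult.assoc)
    also have "\<dots> \<le> fact \<sigma> ^ (m + 1) * (C ^ \<sigma> * C)"
      using C E q by (intro mult_left_mono mult_mono power_mono) auto
    finally show ?thesis by (simp add: mult_ac)
  qed
  have low: "exp (- K) ^ (\<sigma> + 1) * fact \<sigma> ^ (m + 1) \<le> suminf (T \<sigma>)" for \<sigma>
  proof -
    \<comment> \<open>The index is shifted by one, so this is the term with base \<sigma>; for
      \<sigma> = 0 truncated subtraction selects the first term instead.\<close>
    have "exp (- K) ^ (\<sigma> + 1) * fact \<sigma> ^ (m + 1) \<le> T \<sigma> (\<sigma> - 1)"
    proof (cases "\<sigma> = 0")
      case True
      then show ?thesis by (simp add: T_def)
    next
      case False
      then have s: "real (Suc (\<sigma> - 1)) = real \<sigma>" by simp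
      have "fact \<sigma> ^ (m + 1) \<le> (real \<sigma> ^ \<sigma>) ^ (m + 1)"
        using fact_le_power[of \<sigma>, where 'a = real] by (intro power_mono) auto
      moreover have "exp (- K) ^ (\<sigma> + 1) \<le> exp (- (K * real \<sigma>))"
        unfolding exp_of_nat_mult[symmetric] using K by (simp add: algebra_simps)
      ultimately have "exp (- K) ^ (\<sigma> + 1) * fact \<sigma> ^ (m + 1) \<le> exp (- (K * real \<sigma>)) * (real \<sigma> ^ \<sigma>) ^ (m + 1)"
        by (intro mult_mono) auto
      then show ?thesis unfolding T_def s by (simp only: power_mult[symmetric] mult.commute)
    qed
    also have "\<dots> = sum (T \<sigma>) {\<sigma> - 1}" by simp
    also have "\<dots> \<le> suminf (T \<sigma>)" by (rule sum_le_suminf[OF sT]) (use T0 in auto)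
    finally show ?thesis .
  qed
  show ?thesis
    by (rule exI[of _ "exp (- K)"], rule exI[of _ C])
       (use C sT up low in \<open>auto simp: T_def[abs_def]\<close>)
qed

text \<open>The product rule with an explicit quadratic remainder: \<open>p\<close> stands for a
  trigonometric factor of frequency \<open>L\<close>, \<open>q\<close> for a jet entry of size
  \<open>K\<close>. The remainder is polynomial in both, so it can be summed over the
  series.\<close>

lemma product_taylor:
  fixes p p0 p1 q q0 qd \<tau> s L K :: real
  assumes "\<bar>p - p0 - \<tau> * p1\<bar> \<le> 2 * L\<^sup>2 * \<tau>\<^sup>2" "\<bar>p0\<bar> \<le> 2" "\<bar>p1\<bar> \<le> 2 * L"
    "\<bar>q\<bar> \<le> K" "\<bar>q - q0 - qd\<bar> \<le> K * s\<^sup>2" "\<bar>qd\<bar> \<le> K * s" "\<bar>\<tau>\<bar> \<le> 1" "L \<ge> 1" "s \<ge> 0"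
  shows "\<bar>p * q - p0 * q0 - (\<tau> * p1 * q0 + p0 * qd)\<bar> \<le> 4 * K * L\<^sup>2 * (\<bar>\<tau>\<bar> + s)\<^sup>2"
proof -
  have K: "K \<ge> 0" using assms(4) by linarith
  have L2: "L \<le> L\<^sup>2" "1 \<le> L\<^sup>2" using assms(8) one_le_power[of L 2] by (auto simp: power2_eq_square)
  have "p * q - p0 * q0 - (\<tau> * p1 * q0 + p0 * qd) =
      (p - p0 - \<tau> * p1) * q + (p0 + \<tau> * p1) * (q - q0 - qd) + \<tau> * p1 * qd"
    by (simp add: algebra_simps)
  also have "\<bar>\<dots>\<bar> \<le> \<bar>(p - p0 - \<tau> * p1) * q\<bar> + \<bar>(p0 + \<tau> * p1) * (q - q0 - qd)\<bar> + \<bar>\<tau> * p1 * qd\<bar>" by linarith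
  also have "\<bar>(p - p0 - \<tau> * p1) * q\<bar> \<le> (2 * L\<^sup>2 * \<tau>\<^sup>2) * K"
    unfolding abs_mult by (intro mult_mono assms(1,4)) auto
  also have "\<bar>(p0 + \<tau> * p1) * (q - q0 - qd)\<bar> \<le> (4 * L\<^sup>2) * (K * s\<^sup>2)"
  proof -
    have "\<bar>\<tau> * p1\<bar> \<le> 1 * (2 * L)" unfolding abs_mult by (intro mult_mono assms(3,7)) auto
    then have "\<bar>p0 + \<tau> * p1\<bar> \<le> 4 * L\<^sup>2" using assms(2) L2 by linarith
    then show ?thesis unfolding abs_mult by (intro mult_mono assms(5)) auto
  qed
  also have "\<bar>\<tau> * p1 * qd\<bar> \<le> \<bar>\<tau>\<bar> * (2 * L\<^sup>2) * (K * s)"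
    unfolding abs_mult by (intro mult_mono order_trans[OF assms(3)] assms(6)) (use L2 K assms(8,9) in auto)
  also have "2 * L\<^sup>2 * \<tau>\<^sup>2 * K + 4 * L\<^sup>2 * (K * s\<^sup>2) + \<bar>\<tau>\<bar> * (2 * L\<^sup>2) * (K * s) =
      K * L\<^sup>2 * (2 * \<bar>\<tau>\<bar>\<^sup>2 + 4 * s\<^sup>2 + 2 * \<bar>\<tau>\<bar> * s)" by (simp add: algebra_simps)
  also have "\<dots> \<le> K * L\<^sup>2 * (4 * (\<bar>\<tau>\<bar> + s)\<^sup>2)"
  proof (rule mult_left_mono)
    have "4 * (x + s)\<^sup>2 - (2 * x\<^sup>2 + 4 * s\<^sup>2 + 2 * x * s) = 2 * x\<^sup>2 + 6 * (x * s)" for x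
      by (simp add: power2_eq_square algebra_simps)
    moreover have "2 * \<bar>\<tau>\<bar>\<^sup>2 + 6 * (\<bar>\<tau>\<bar> * s) \<ge> 0"
      using assms(9) by (intro add_nonneg_nonneg mult_nonneg_nonneg) auto
    ultimately have "4 * (\<bar>\<tau>\<bar> + s)\<^sup>2 - (2 * \<bar>\<tau>\<bar>\<^sup>2 + 4 * s\<^sup>2 + 2 * \<bar>\<tau>\<bar> * s) \<ge> 0" by (simp only:)
    then show "2 * \<bar>\<tau>\<bar>\<^sup>2 + 4 * s\<^sup>2 + 2 * \<bar>\<tau>\<bar> * s \<le> 4 * (\<bar>\<tau>\<bar> + s)\<^sup>2" by linarith
  qed (use K in auto)
  finally show ?thesis by (simp add: mult_ac)
qed

lemma has_derivative_quadratic: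
  fixes f :: "'a::real_normed_vector \<Rightarrow> real"
  assumes lin: "bounded_linear D" and \<delta>: "\<delta> > 0"
    and q: "\<And>v. norm v < \<delta> \<Longrightarrow> \<bar>f (x + v) - f x - D v\<bar> \<le> M * (norm v)\<^sup>2"
  shows "(f has_derivative D) (at x)"
proof (rule has_derivativeI_sandwich[OF \<delta> lin])
  fix y assume y: "y \<noteq> x" "dist y x < \<delta>"
  then have "\<bar>f (x + (y - x)) - f x - D (y - x)\<bar> \<le> M * (norm (y - x))\<^sup>2"
    by (intro q) (simp add: dist_norm)
  then show "norm (f y - f x - D (y - x)) / norm (y - x) \<le> M * norm (y - x)"
    using y by (simp add: divide_le_eq power2_eq_square mult.assoc)
next
  have "((\<lambda>y. M * norm (y - x)) \<longlongrightarrow> M * norm (x - x)) (at x)" by (intro tendsto_intros)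
  then show "((\<lambda>y. M * norm (y - x)) \<longlongrightarrow> 0) (at x)" by simp
qed

lemma open_open_cube: "open (open_cube :: (real^'n::finite) set)"
proof -
  have "open_cube = (\<Inter>j\<in>UNIV. {z :: real^'n. \<bar>z $ j\<bar> < 1/2})" by (auto simp: open_cube_def)
  also have "open \<dots>" by (intro open_INT) (auto intro!: open_Collect_less continuous_intros)
  finally show ?thesis .
qed

text \<open>The series is differentiated by adding up quadratic Taylor remainders: that of the k-th
  term is its weight, at most exp(-k), times a power of k. Since \<open>W\<close> is a jet closed
  under all derivatives, the same argument gives every order.\<close>

theorem grushin_solution:
  assumes fin: "finite I"
  shows "\<exists>W :: nat \<Rightarrow> 3 list \<Rightarrow> real \<times> (real^3) \<Rightarrow> real.
    (\<forall>j is x. snd x \<in> open_cube \<longrightarrow> (W j is has_derivative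
       (\<lambda>v. fst v * W (Suc j) is x + (\<Sum>i\<in>UNIV. snd v $ i * W j (i # is) x))) (at x)) \<and>
    (\<forall>x. snd x \<in> open_cube \<longrightarrow> (\<Sum>i\<in>UNIV. W 0 [i, i] x) + potential I c m (snd x) * W (Suc (Suc 0)) [] x = 0) \<and>
    (\<exists>c C. c > 0 \<and> C > 0 \<and> (\<forall>\<sigma>. c ^ (\<sigma> + 1) * fact \<sigma> ^ (m + 1) \<le> \<bar>W \<sigma> [] 0\<bar> \<and>
       \<bar>W \<sigma> [] 0\<bar> \<le> C ^ (\<sigma> + 1) * fact \<sigma> ^ (m + 1)))"
proof -
  obtain D C where D: "D \<ge> 0" and C: "\<And>l. C l \<ge> (1::real)" and sol: "\<forall>k\<ge>1. \<exists>g :: 3 list \<Rightarrow> real^3 \<Rightarrow> real.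
    jet_solution C (real k ^ (2 * m + 2)) (\<lambda>z. real k ^ (2 * m + 2) * potential I c m z) g \<and>
    exp (- (D * real k)) \<le> g [] 0"
    using scaled_solution_family[OF fin, of m c] by blast
  define \<Lambda> where "\<Lambda> n = real (Suc n) ^ (2 * m + 2)" for n
  define \<rho> where "\<rho> n = real (Suc n) ^ (m + 1)" for n
  have \<Lambda>\<rho>: "\<Lambda> n = (\<rho> n)\<^sup>2" for n unfolding \<Lambda>_def \<rho>_def power_mult[symmetric]
    by (rule arg_cong[where f = "\<lambda>e. real (Suc n) ^ e"]) simp
  have \<rho>1: "\<rho> n \<ge> 1" for n unfolding \<rho>_def by (intro one_le_power) simp
  have \<Lambda>1: "\<Lambda> n \<ge> 1" for n unfolding \<Lambda>_def by (intro one_le_power) simp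
  have "\<forall>n. \<exists>g :: 3 list \<Rightarrow> real^3 \<Rightarrow> real.
    jet_solution C (\<Lambda> n) (\<lambda>z. \<Lambda> n * potential I c m z) g \<and> exp (- (D * real (Suc n))) \<le> g [] 0"
    unfolding \<Lambda>_def by (rule allI, rule sol[THEN spec, THEN mp]) simp
  from choice[OF this] obtain g :: "nat \<Rightarrow> 3 list \<Rightarrow> real^3 \<Rightarrow> real" where
    g: "\<And>n. jet_solution C (\<Lambda> n) (\<lambda>z. \<Lambda> n * potential I c m z) (g n)"
    and g0: "\<And>n. exp (- (D * real (Suc n))) \<le> g n [] 0" by blast
  have gb: "\<bar>g n is z\<bar> \<le> C (length is) * \<Lambda> n ^ length is" if "z \<in> open_cube" for n "is" z
    using g[of n] that unfolding jet_solution_def by blast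
  have geq: "(\<Sum>i\<in>UNIV. g n [i, i] z) = \<Lambda> n * potential I c m z * g n [] z" if "z \<in> open_cube" for n z
    using g[of n] that unfolding jet_solution_def by blast
  have g0': "g n [] 0 > 0" for n using g0[of n] less_le_trans[OF exp_gt_zero] by blast
  have C0: "C l \<ge> 0" for l using C[of l] by linarith
  \<comment> \<open>Division by the value at the origin makes that value of the term exactly exp(-(1
    + D) k) with k = n + 1. The lower bound exp(-Dk) then leaves a weight of at most
    exp(-k).\<close>
  define a where "a n = exp (- ((1 + D) * real (Suc n))) / g n [] 0" for n
  have a0: "a n \<ge> 0" for n using g0'[of n] by (simp add: a_def)
  have a_le: "a n \<le> exp (- real (Suc n))" for n
  proof -
    have "a n \<le> exp (- ((1 + D) * real (Suc n))) / exp (- (D * real (Suc n)))"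
      unfolding a_def using g0[of n] g0'[of n] by (intro divide_left_mono) auto
    also have "\<dots> = exp (- real (Suc n))" unfolding exp_diff[symmetric] by (simp add: algebra_simps)
    finally show ?thesis .
  qed
  have sum_a: "summable (\<lambda>n. a n * \<rho> n ^ j * \<Lambda> n ^ r)" for j r
  proof (rule summable_comparison_test'[OF summable_exp_power[of "(m + 1) * j + (2 * m + 2) * r"], of 0])
    fix n
    have "a n * \<rho> n ^ j * \<Lambda> n ^ r \<le> exp (- real (Suc n)) * (\<rho> n ^ j * \<Lambda> n ^ r)"
      unfolding mult.assoc using a_le[of n] \<rho>1[of n] \<Lambda>1[of n] by (intro mult_right_mono) auto
    also have "\<rho> n ^ j * \<Lambda> n ^ r = real (Suc n) ^ ((m + 1) * j + (2 * m + 2) * r)"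
      unfolding \<rho>_def \<Lambda>_def power_mult[symmetric] power_add[symmetric] ..
    finally show "norm (a n * \<rho> n ^ j * \<Lambda> n ^ r) \<le> exp (- real (Suc n)) * real (Suc n) ^ ((m + 1) * j + (2 * m + 2) * r)"
      using a0[of n] \<rho>1[of n] \<Lambda>1[of n] by simp
  qed
  define t where "t j is x n = a n * \<rho> n ^ j * (trig j (\<rho> n * fst x) * g n is (snd x))" for j "is" and x :: "real \<times> (real^3)" and n
  define W where "W j is x = (\<Sum>n. t j is x n)" for j "is" x
  have st: "summable (t j is x)" if "snd x \<in> open_cube" for j "is" x
  proof (rule summable_comparison_test'[OF summable_mult[OF sum_a[of j "length is"]], of 0 _ "2 * C (length is)"])
    fix n
    have "\<bar>trig j (\<rho> n * fst x) * g n is (snd x)\<bar> \<le> 2 * (C (length is) * \<Lambda> n ^ length is)"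
      unfolding abs_mult using gb[OF that, of n "is"] trig_bound by (intro mult_mono) auto
    then have "a n * \<rho> n ^ j * \<bar>trig j (\<rho> n * fst x) * g n is (snd x)\<bar> \<le> a n * \<rho> n ^ j * (2 * (C (length is) * \<Lambda> n ^ length is))"
      using a0[of n] \<rho>1[of n] by (intro mult_left_mono) auto
    then show "norm (t j is x n) \<le> 2 * C (length is) * (a n * \<rho> n ^ j * \<Lambda> n ^ length is)"
      unfolding t_def using a0[of n] \<rho>1[of n] by (simp add: abs_mult mult_ac)
  qed
  have der: "(W j is has_derivative (\<lambda>v. fst v * W (Suc j) is x + (\<Sum>i\<in>UNIV. snd v $ i * W j (i # is) x))) (at x)"
    if x: "snd x \<in> open_cube" for j "is" x
  proof -
    define l where "l = length is"
    \<comment> \<open>The bounds for a jet entry, for its gradient and for its Taylor remainder; the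
      4 is the product of the two factors 2 in \<open>jet_taylor\<close>.\<close>
    define B where "B = C l + C (l + 1) + 4 * (C (l + 2) + C (l + 3))"
    have B: "B \<ge> 0" unfolding B_def using C0 by (intro add_nonneg_nonneg mult_nonneg_nonneg) auto
    \<comment> \<open>64 = 4 * 4^2: the square comes from bounding the sum of the four coordinate
      increments by 4 times the norm.\<close>
    define M where "M = 64 * (B * (\<Sum>n. a n * \<rho> n ^ (j + 2) * \<Lambda> n ^ (l + 3)))"
    obtain \<delta> where \<delta>: "\<delta> > 0" "ball (snd x) \<delta> \<subseteq> open_cube" using open_open_cube x open_contains_ball by blast
    show ?thesis
    proof (rule has_derivative_quadratic[where \<delta> = "min 1 \<delta>" and M = M])
      show "bounded_linear (\<lambda>v. fst v * W (Suc j) is x + (\<Sum>i\<in>UNIV. snd v $ i * W j (i # is) x))"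
        by (intro bounded_linear_add bounded_linear_sum bounded_linear_mult_const bounded_linear_fst
            bounded_linear_compose[OF bounded_linear_vec_nth bounded_linear_snd])
      show "0 < min 1 \<delta>" using \<delta> by simp
      fix v :: "real \<times> (real^3)" assume v: "norm v < min 1 \<delta>"
      have nf: "\<bar>fst v\<bar> \<le> norm v" and ns: "norm (snd v) \<le> norm v"
        using norm_fst_le[of "fst v" "snd v"] norm_snd_le[of "snd v" "fst v"] by simp_all
      have xv: "snd x + snd v \<in> open_cube"
        using \<delta>(2) ns v by (auto simp: subset_iff dist_norm)
      then have xv': "snd (x + v) \<in> open_cube" by simp
      define s where "s = (\<Sum>i\<in>UNIV. \<bar>snd v $ i\<bar>)"
      have s0: "s \<ge> 0" unfolding s_def by (intro sum_nonneg) auto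
      have "\<bar>snd v $ i\<bar> \<le> norm v" for i by (rule order_trans[OF component_le_norm_cart ns])
      from this[of 1] this[of 2] this[of 3] have "s \<le> 3 * norm v" unfolding s_def sum_3 by linarith
      then have fs: "\<bar>fst v\<bar> + s \<le> 4 * norm v" using nf by simp
      define R where "R n = t j is (x + v) n - t j is x n - (fst v * t (Suc j) is x n + (\<Sum>i\<in>UNIV. snd v $ i * t j (i # is) x n))" for n
      have est: "\<bar>R n\<bar>
        \<le> 4 * B * (\<bar>fst v\<bar> + s)\<^sup>2 * (a n * \<rho> n ^ (j + 2) * \<Lambda> n ^ (l + 3))" for n
      proof -
        define K where "K = B * \<Lambda> n ^ (l + 3)"
        have KI: "c' * \<Lambda> n ^ r \<le> K" if "0 \<le> c'" "c' \<le> B" "r \<le> l + 3" for c' r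
          unfolding K_def using that \<Lambda>1[of n] B by (intro mult_mono power_increasing) auto
        let ?qd = "\<Sum>i\<in>UNIV. snd v $ i * g n (i # is) (snd x)"
        have "\<bar>trig j (\<rho> n * fst x + \<rho> n * fst v) * g n is (snd x + snd v) - trig j (\<rho> n * fst x) * g n is (snd x)
          - (fst v * (\<rho> n * trig (Suc j) (\<rho> n * fst x)) * g n is (snd x) + trig j (\<rho> n * fst x) * ?qd)\<bar>
          \<le> 4 * K * (\<rho> n)\<^sup>2 * (\<bar>fst v\<bar> + s)\<^sup>2"
        proof (rule product_taylor)
          show "\<bar>trig j (\<rho> n * fst x + \<rho> n * fst v) - trig j (\<rho> n * fst x) - fst v * (\<rho> n * trig (Suc j) (\<rho> n * fst x))\<bar>
              \<le> 2 * (\<rho> n)\<^sup>2 * (fst v)\<^sup>2"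
            using trig_taylor[of j "\<rho> n * fst x" "\<rho> n * fst v"] by (simp add: power_mult_distrib mult_ac)
          show "\<bar>\<rho> n * trig (Suc j) (\<rho> n * fst x)\<bar> \<le> 2 * \<rho> n"
            using trig_bound[of "Suc j" "\<rho> n * fst x"] \<rho>1[of n] by (simp add: abs_mult mult.commute mult_right_mono)
          show "\<bar>g n is (snd x + snd v)\<bar> \<le> K"
          proof -
            have "\<bar>g n is (snd x + snd v)\<bar> \<le> C l * \<Lambda> n ^ l" unfolding l_def by (rule gb[OF xv])
            also have "\<dots> \<le> K" using C0 by (intro KI) (auto simp: B_def add_nonneg_nonneg)
            finally show ?thesis .
          qed
          show "\<bar>g n is (snd x + snd v) - g n is (snd x) - ?qd\<bar> \<le> K * s\<^sup>2"
          proof -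
            have "\<bar>g n is (snd x + snd v) - g n is (snd x) - ?qd\<bar> \<le>
              2 * (2 * (C (length is + 2) + C (length is + 3)) * \<Lambda> n ^ (length is + 3)) * s\<^sup>2"
              unfolding s_def by (rule jet_taylor[OF C \<Lambda>1 g x xv])
            also have "\<dots> \<le> K * s\<^sup>2"
            proof (rule mult_right_mono)
              have "(4 * (C (l + 2) + C (l + 3))) * \<Lambda> n ^ (l + 3) \<le> K"
                using C0 by (intro KI) (auto simp: B_def add_nonneg_nonneg)
              then show "2 * (2 * (C (length is + 2) + C (length is + 3)) * \<Lambda> n ^ (length is + 3)) \<le> K"
                by (simp add: l_def mult.assoc[symmetric])
            qed simp
            finally show ?thesis .
          qed
          show "\<bar>?qd\<bar> \<le> K * s"
          proof -
            have "\<bar>g n (i # is) (snd x)\<bar> \<le> K" for i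
            proof -
              have "\<bar>g n (i # is) (snd x)\<bar> \<le> C (l + 1) * \<Lambda> n ^ (l + 1)"
                using gb[OF x, of n "i # is"] by (simp add: l_def)
              also have "\<dots> \<le> K" using C0 by (intro KI) (auto simp: B_def add_nonneg_nonneg)
              finally show ?thesis .
            qed
            then have "\<bar>?qd\<bar> \<le> (\<Sum>i\<in>UNIV. \<bar>snd v $ i\<bar> * K)"
              by (intro order_trans[OF sum_abs] sum_mono) (simp add: abs_mult mult_left_mono)
            then show ?thesis by (simp add: s_def sum_distrib_left mult.commute)
          qed
          show "\<bar>fst v\<bar> \<le> 1" using nf v by simp
        qed (use trig_bound \<rho>1 s0 in auto)
        then have "\<bar>a n * \<rho> n ^ j * (trig j (\<rho> n * fst x + \<rho> n * fst v) * g n is (snd x + snd v) - trig j (\<rho> n * fst x) * g n is (snd x)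
          - (fst v * (\<rho> n * trig (Suc j) (\<rho> n * fst x)) * g n is (snd x) + trig j (\<rho> n * fst x) * ?qd))\<bar>
          \<le> a n * \<rho> n ^ j * (4 * K * (\<rho> n)\<^sup>2 * (\<bar>fst v\<bar> + s)\<^sup>2)"
          unfolding abs_mult[of "a n * \<rho> n ^ j"] using a0[of n] \<rho>1[of n]
          by (subst abs_of_nonneg) (auto intro!: mult_left_mono)
        moreover have "a n * \<rho> n ^ j * (trig j (\<rho> n * fst x + \<rho> n * fst v) * g n is (snd x + snd v) - trig j (\<rho> n * fst x) * g n is (snd x)
          - (fst v * (\<rho> n * trig (Suc j) (\<rho> n * fst x)) * g n is (snd x) + trig j (\<rho> n * fst x) * ?qd)) =
          R n"
          by (simp add: R_def t_def algebra_simps sum_distrib_left)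
        moreover have "a n * \<rho> n ^ j * (4 * K * (\<rho> n)\<^sup>2 * (\<bar>fst v\<bar> + s)\<^sup>2) =
          4 * B * (\<bar>fst v\<bar> + s)\<^sup>2 * (a n * \<rho> n ^ (j + 2) * \<Lambda> n ^ (l + 3))"
          unfolding K_def power_add[of "\<rho> n" j 2] by (simp only: mult_ac)
        ultimately show ?thesis by simp
      qed
      have sums_d: "(\<lambda>n. R n)
        sums (W j is (x + v) - W j is x - (fst v * W (Suc j) is x + (\<Sum>i\<in>UNIV. snd v $ i * W j (i # is) x)))"
        unfolding W_def R_def
        by (intro sums_diff sums_add sums_mult sums_sum summable_sums st x xv')
      have "norm (\<Sum>n. R n) \<le>
        (\<Sum>n. 4 * B * (\<bar>fst v\<bar> + s)\<^sup>2 * (a n * \<rho> n ^ (j + 2) * \<Lambda> n ^ (l + 3)))"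
      proof (rule norm_suminf_le)
        show "norm (R n)
          \<le> 4 * B * (\<bar>fst v\<bar> + s)\<^sup>2 * (a n * \<rho> n ^ (j + 2) * \<Lambda> n ^ (l + 3))" for n
          unfolding real_norm_def by (rule est)
        show "summable (\<lambda>n. 4 * B * (\<bar>fst v\<bar> + s)\<^sup>2 * (a n * \<rho> n ^ (j + 2) * \<Lambda> n ^ (l + 3)))"
          by (intro summable_mult sum_a)
      qed
      then have "\<bar>W j is (x + v) - W j is x - (fst v * W (Suc j) is x + (\<Sum>i\<in>UNIV. snd v $ i * W j (i # is) x))\<bar> \<le>
        (\<Sum>n. 4 * B * (\<bar>fst v\<bar> + s)\<^sup>2 * (a n * \<rho> n ^ (j + 2) * \<Lambda> n ^ (l + 3)))"
        unfolding sums_unique[OF sums_d] real_norm_def .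
      also have "\<dots> = 4 * B * (\<bar>fst v\<bar> + s)\<^sup>2 * (\<Sum>n. a n * \<rho> n ^ (j + 2) * \<Lambda> n ^ (l + 3))"
        by (rule suminf_mult[OF sum_a])
      also have "\<dots> \<le> 4 * B * (4 * norm v)\<^sup>2 * (\<Sum>n. a n * \<rho> n ^ (j + 2) * \<Lambda> n ^ (l + 3))"
      proof (rule mult_right_mono)
        show "4 * B * (\<bar>fst v\<bar> + s)\<^sup>2 \<le> 4 * B * (4 * norm v)\<^sup>2"
          using fs s0 B by (intro mult_left_mono power_mono) auto
        show "0 \<le> (\<Sum>n. a n * \<rho> n ^ (j + 2) * \<Lambda> n ^ (l + 3))"
        proof (rule suminf_nonneg[OF sum_a])
          show "0 \<le> a n * \<rho> n ^ (j + 2) * \<Lambda> n ^ (l + 3)" for n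
            using a0[of n] \<rho>1[of n] \<Lambda>1[of n] by (intro mult_nonneg_nonneg) auto
        qed
      qed
      also have "\<dots> = M * (norm v)\<^sup>2" by (simp add: M_def power_mult_distrib)
      finally show "\<bar>W j is (x + v) - W j is x - (fst v * W (Suc j) is x + (\<Sum>i\<in>UNIV. snd v $ i * W j (i # is) x))\<bar> \<le> M * (norm v)\<^sup>2" .
    qed
  qed
  have pde: "(\<Sum>i\<in>UNIV. W 0 [i, i] x) + potential I c m (snd x) * W (Suc (Suc 0)) [] x = 0" if x: "snd x \<in> open_cube" for x
  proof -
    have "(\<lambda>n. (\<Sum>i\<in>UNIV. t 0 [i, i] x n) + potential I c m (snd x) * t (Suc (Suc 0)) [] x n) sums
      ((\<Sum>i\<in>UNIV. W 0 [i, i] x) + potential I c m (snd x) * W (Suc (Suc 0)) [] x)"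
      unfolding W_def by (intro sums_add sums_mult sums_sum summable_sums st x)
    moreover have "(\<Sum>i\<in>UNIV. t 0 [i, i] x n) + potential I c m (snd x) * t (Suc (Suc 0)) [] x n = 0" for n
    proof -
      have "(\<Sum>i\<in>UNIV. t 0 [i, i] x n) = a n * trig 0 (\<rho> n * fst x) * (\<Sum>i\<in>UNIV. g n [i, i] (snd x))"
        by (simp add: t_def sum_distrib_left mult_ac)
      also have "\<dots> = a n * trig 0 (\<rho> n * fst x) * (\<Lambda> n * potential I c m (snd x) * g n [] (snd x))"
        by (simp only: geq[OF x])
      \<comment> \<open>Two derivatives in theta produce the factor -\<rho>^2, and \<rho>^2 is
        exactly the \<Lambda> of the equation for \<open>g n\<close>.\<close>
      also have "\<dots> = - (potential I c m (snd x) * t (Suc (Suc 0)) [] x n)"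
        by (simp add: t_def trig_2 \<Lambda>\<rho> power2_eq_square mult_ac)
      finally show ?thesis by simp
    qed
    ultimately show ?thesis using sums_unique2[OF _ sums_zero] by simp
  qed
  \<comment> \<open>The factor \<open>trig \<sigma> 0\<close> is the same for every n, so it leaves
    the sum as a common sign and no cancellation can occur.\<close>
  have W0: "\<bar>W \<sigma> [] 0\<bar> = (\<Sum>n. exp (- ((1 + D) * real (Suc n))) * (real (Suc n) ^ (m + 1)) ^ \<sigma>)"
    if s: "summable (\<lambda>n. exp (- ((1 + D) * real (Suc n))) * (real (Suc n) ^ (m + 1)) ^ \<sigma>)" for \<sigma>
  proof -
    have "t \<sigma> [] 0 n = trig \<sigma> 0 * (exp (- ((1 + D) * real (Suc n))) * (real (Suc n) ^ (m + 1)) ^ \<sigma>)" for n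
      unfolding t_def a_def \<rho>_def using g0'[of n] by simp
    then have tt: "t \<sigma> [] 0 = (\<lambda>n. trig \<sigma> 0 * (exp (- ((1 + D) * real (Suc n))) * (real (Suc n) ^ (m + 1)) ^ \<sigma>))"
      by (intro ext)
    have "W \<sigma> [] 0 = trig \<sigma> 0 * (\<Sum>n. exp (- ((1 + D) * real (Suc n))) * (real (Suc n) ^ (m + 1)) ^ \<sigma>)"
      unfolding W_def tt by (rule suminf_mult[OF s])
    moreover have "(\<Sum>n. exp (- ((1 + D) * real (Suc n))) * (real (Suc n) ^ (m + 1)) ^ \<sigma>) \<ge> 0"
      by (rule suminf_nonneg[OF s]) auto
    ultimately show ?thesis by (simp add: abs_mult trig_at_0)
  qed
  have "0 < 1 + D" using D by simp
  from gevrey_moment_bounds[OF this, of m] obtain c1 C1 where c1: "c1 > 0" "C1 > 0"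
    and mom: "\<forall>\<sigma>. summable (\<lambda>n. exp (- ((1 + D) * real (Suc n))) * (real (Suc n) ^ (m + 1)) ^ \<sigma>) \<and>
    c1 ^ (\<sigma> + 1) * fact \<sigma> ^ (m + 1) \<le> (\<Sum>n. exp (- ((1 + D) * real (Suc n))) * (real (Suc n) ^ (m + 1)) ^ \<sigma>) \<and>
    (\<Sum>n. exp (- ((1 + D) * real (Suc n))) * (real (Suc n) ^ (m + 1)) ^ \<sigma>) \<le> C1 ^ (\<sigma> + 1) * fact \<sigma> ^ (m + 1)"
    by blast
  have "c1 ^ (\<sigma> + 1) * fact \<sigma> ^ (m + 1) \<le> \<bar>W \<sigma> [] 0\<bar> \<and> \<bar>W \<sigma> [] 0\<bar> \<le> C1 ^ (\<sigma> + 1) * fact \<sigma> ^ (m + 1)" for \<sigma>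
    unfolding W0[OF conjunct1[OF mom[rule_format]]] using mom by blast
  then show ?thesis using der pde c1 by blast
qed

subsection \<open>Groups in exponential coordinates\<close>

text \<open>The double difference over a square of side h is written by the mean value theorem in
  both orders. Both mixed derivatives are then taken at points within reach of the continuity
  assumptions.\<close>

lemma mixed_partials_eq:
  fixes f f1 f2 f12 f21 :: "real \<Rightarrow> real \<Rightarrow> real"
  assumes f1: "\<And>x y. ((\<lambda>x. f x y) has_real_derivative f1 x y) (at x)"
    and f2: "\<And>x y. ((\<lambda>y. f x y) has_real_derivative f2 x y) (at y)"
    and f12: "\<And>x y. ((\<lambda>y. f1 x y) has_real_derivative f12 x y) (at y)"
    and f21: "\<And>x y. ((\<lambda>x. f2 x y) has_real_derivative f21 x y) (at x)"
    and c12: "continuous (at (0, 0)) (\<lambda>z. f12 (fst z) (snd z))"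
    and c21: "continuous (at (0, 0)) (\<lambda>z. f21 (fst z) (snd z))"
  shows "f12 0 0 = f21 0 0"
proof (rule ccontr)
  assume ne: "f12 0 0 \<noteq> f21 0 0"
  define e where "e = \<bar>f12 0 0 - f21 0 0\<bar> / 2"
  have e: "e > 0" using ne by (simp add: e_def)
  obtain d1 where d1: "d1 > 0" "\<And>z. dist z (0, 0) < d1 \<Longrightarrow> \<bar>f12 (fst z) (snd z) - f12 0 0\<bar> < e"
    using c12 e unfolding continuous_at_eps_delta by (force simp: dist_real_def)
  obtain d2 where d2: "d2 > 0" "\<And>z. dist z (0, 0) < d2 \<Longrightarrow> \<bar>f21 (fst z) (snd z) - f21 0 0\<bar> < e"
    using c21 e unfolding continuous_at_eps_delta by (force simp: dist_real_def)
  define h where "h = min d1 d2 / 2"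
  have h: "h > 0" using d1 d2 by (simp add: h_def)
  have near: "dist (a, b) (0, 0) < min d1 d2" if "0 < a" "a < h" "0 < b" "b < h" for a b :: real
  proof -
    have "dist (a, b) (0, 0) \<le> \<bar>a\<bar> + \<bar>b\<bar>"
      by (simp add: dist_Pair_Pair sqrt_sum_squares_le_sum_abs)
    then show ?thesis using that by (simp add: h_def)
  qed
  have "\<exists>a. 0 < a \<and> a < h \<and> (f h h - f h 0) - (f 0 h - f 0 0) = (h - 0) * (f1 a h - f1 a 0)"
    by (rule MVT2[OF h]) (auto intro!: derivative_eq_intros f1)
  then obtain a where a: "0 < a" "a < h" "(f h h - f h 0) - (f 0 h - f 0 0) = h * (f1 a h - f1 a 0)" by auto
  have "\<exists>b. 0 < b \<and> b < h \<and> f1 a h - f1 a 0 = (h - 0) * f12 a b"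
    by (rule MVT2[OF h]) (rule f12)
  then obtain b where b: "0 < b" "b < h" "f1 a h - f1 a 0 = h * f12 a b" by auto
  have "\<exists>b. 0 < b \<and> b < h \<and> (f h h - f 0 h) - (f h 0 - f 0 0) = (h - 0) * (f2 h b - f2 0 b)"
    by (rule MVT2[OF h]) (auto intro!: derivative_eq_intros f2)
  then obtain b' where b': "0 < b'" "b' < h" "(f h h - f 0 h) - (f h 0 - f 0 0) = h * (f2 h b' - f2 0 b')" by auto
  have "\<exists>a. 0 < a \<and> a < h \<and> f2 h b' - f2 0 b' = (h - 0) * f21 a b'"
    by (rule MVT2[OF h]) (rule f21)
  then obtain a' where a': "0 < a'" "a' < h" "f2 h b' - f2 0 b' = h * f21 a' b'" by auto
  have "h * (f1 a h - f1 a 0) = h * (f2 h b' - f2 0 b')" using a(3) b'(3) by linarith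
  then have "h * (h * f12 a b) = h * (h * f21 a' b')" unfolding b(3) a'(3) .
  then have "f12 a b = f21 a' b'" using h by simp
  moreover have "\<bar>f12 a b - f12 0 0\<bar> < e" using d1(2)[of "(a, b)"] near[OF a(1,2) b(1,2)] by simp
  moreover have "\<bar>f21 a' b' - f21 0 0\<bar> < e" using d2(2)[of "(a', b')"] near[OF a'(1,2) b'(1,2)] by simp
  moreover have "2 * e = \<bar>f12 0 0 - f21 0 0\<bar>" by (simp add: e_def)
  ultimately show False by linarith
qed

text \<open>The two second derivatives enter as derivatives along curves, the form in which
  left-invariant fields supply them.\<close>

lemma smooth_mixed_partials:
  fixes f :: "real \<times> real \<Rightarrow> 'v::euclidean_space"
  assumes sm: "smooth_map_on UNIV f"
    and P: "((\<lambda>y. frechet_derivative f (at (0, y)) (1, 0)) has_vector_derivative P) (at 0)"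
    and Q: "((\<lambda>x. frechet_derivative f (at (x, 0)) (0, 1)) has_vector_derivative Q) (at 0)"
  shows "P = Q"
proof (rule euclidean_eqI)
  fix b :: 'v assume b: "b \<in> Basis"
  define A where "A z = frechet_derivative f (at z) (1, 0)" for z
  define B where "B z = frechet_derivative f (at z) (0, 1)" for z
  have sA: "smooth_map_on UNIV A" and sB: "smooth_map_on UNIV B"
    unfolding A_def B_def by (intro smooth_map_on_frechet sm)+
  have par: "((\<lambda>x. g (x, y) \<bullet> b) has_real_derivative frechet_derivative g (at (x, y)) (1, 0) \<bullet> b) (at x)"
    "((\<lambda>y. g (x, y) \<bullet> b) has_real_derivative frechet_derivative g (at (x, y)) (0, 1) \<bullet> b) (at y)"
    if "smooth_map_on UNIV g" for g :: "real \<times> real \<Rightarrow> 'v" and x y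
  proof -
    note D = smooth_map_on_has_derivative[OF that, of "(x, y)"]
    have lin: "linear (frechet_derivative g (at (x, y)))" using D has_derivative_linear by blast
    have "((\<lambda>x. g (x, y)) has_derivative (\<lambda>h. frechet_derivative g (at (x, y)) (h, 0))) (at x)"
      by (rule has_derivative_compose[of "\<lambda>x. (x, y)" "\<lambda>h. (h, 0)" x UNIV g, OF _ D])
         (auto intro!: derivative_eq_intros)
    then have "((\<lambda>x. g (x, y) \<bullet> b) has_derivative (\<lambda>h. frechet_derivative g (at (x, y)) (h, 0) \<bullet> b)) (at x)"
      by (rule has_derivative_inner_left)
    moreover have "(\<lambda>h. frechet_derivative g (at (x, y)) (h, 0) \<bullet> b) = (*) (frechet_derivative g (at (x, y)) (1, 0) \<bullet> b)"
    proof
      fix h :: real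
      have "frechet_derivative g (at (x, y)) (h, 0) = h *\<^sub>R frechet_derivative g (at (x, y)) (1, 0)"
        using linear_cmul[OF lin, of h "(1, 0)"] by simp
      then show "frechet_derivative g (at (x, y)) (h, 0) \<bullet> b = frechet_derivative g (at (x, y)) (1, 0) \<bullet> b * h"
        by (simp only: inner_scaleR_left mult.commute)
    qed
    ultimately show "((\<lambda>x. g (x, y) \<bullet> b) has_real_derivative frechet_derivative g (at (x, y)) (1, 0) \<bullet> b) (at x)"
      unfolding has_field_derivative_def by (simp only:)
    have "((\<lambda>y. g (x, y)) has_derivative (\<lambda>h. frechet_derivative g (at (x, y)) (0, h))) (at y)"
      by (rule has_derivative_compose[of "\<lambda>y. (x, y)" "\<lambda>h. (0, h)" y UNIV g, OF _ D])
         (auto intro!: derivative_eq_intros)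
    then have "((\<lambda>y. g (x, y) \<bullet> b) has_derivative (\<lambda>h. frechet_derivative g (at (x, y)) (0, h) \<bullet> b)) (at y)"
      by (rule has_derivative_inner_left)
    moreover have "(\<lambda>h. frechet_derivative g (at (x, y)) (0, h) \<bullet> b) = (*) (frechet_derivative g (at (x, y)) (0, 1) \<bullet> b)"
    proof
      fix h :: real
      have "frechet_derivative g (at (x, y)) (0, h) = h *\<^sub>R frechet_derivative g (at (x, y)) (0, 1)"
        using linear_cmul[OF lin, of h "(0, 1)"] by simp
      then show "frechet_derivative g (at (x, y)) (0, h) \<bullet> b = frechet_derivative g (at (x, y)) (0, 1) \<bullet> b * h"
        by (simp only: inner_scaleR_left mult.commute)
    qed
    ultimately show "((\<lambda>y. g (x, y) \<bullet> b) has_real_derivative frechet_derivative g (at (x, y)) (0, 1) \<bullet> b) (at y)"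
      unfolding has_field_derivative_def by (simp only:)
  qed
  have cont: "continuous (at z) (\<lambda>z. frechet_derivative g (at (fst z, snd z)) v \<bullet> b)"
    if "smooth_map_on UNIV g" for g :: "real \<times> real \<Rightarrow> 'v" and v z
  proof -
    have "isCont (\<lambda>z. frechet_derivative g (at z) v) z"
      using smooth_map_on_continuous[OF smooth_map_on_frechet[OF that, of v]]
      by (simp only: continuous_on_eq_continuous_at[OF open_UNIV] UNIV_I ball_simps)
    then show ?thesis by (simp add: continuous_intros)
  qed
  have "frechet_derivative A (at (0, 0)) (0, 1) \<bullet> b = frechet_derivative B (at (0, 0)) (1, 0) \<bullet> b"
  proof (rule mixed_partials_eq[where f = "\<lambda>x y. f (x, y) \<bullet> b" and ?f1.0 = "\<lambda>x y. A (x, y) \<bullet> b"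
        and ?f2.0 = "\<lambda>x y. B (x, y) \<bullet> b" and ?f12.0 = "\<lambda>x y. frechet_derivative A (at (x, y)) (0, 1) \<bullet> b"
        and ?f21.0 = "\<lambda>x y. frechet_derivative B (at (x, y)) (1, 0) \<bullet> b"])
    fix x y
    show "((\<lambda>x. f (x, y) \<bullet> b) has_real_derivative A (x, y) \<bullet> b) (at x)"
      unfolding A_def by (rule par(1)[OF sm])
    show "((\<lambda>y. f (x, y) \<bullet> b) has_real_derivative B (x, y) \<bullet> b) (at y)"
      unfolding B_def by (rule par(2)[OF sm])
  qed (rule par(2)[OF sA] par(1)[OF sB] cont[OF sA] cont[OF sB])+
  moreover have "P \<bullet> b = frechet_derivative A (at (0, 0)) (0, 1) \<bullet> b"
  proof -
    have "((\<lambda>y. A (0, y) \<bullet> b) has_real_derivative P \<bullet> b) (at 0)"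
      using has_derivative_inner_left[OF P[unfolded has_vector_derivative_def], of b]
      unfolding has_field_derivative_def A_def by (simp add: mult_commute_abs)
    from DERIV_unique[OF this par(2)[OF sA, of 0 0]] show ?thesis .
  qed
  moreover have "Q \<bullet> b = frechet_derivative B (at (0, 0)) (1, 0) \<bullet> b"
  proof -
    have "((\<lambda>x. B (x, 0) \<bullet> b) has_real_derivative Q \<bullet> b) (at 0)"
      using has_derivative_inner_left[OF Q[unfolded has_vector_derivative_def], of b]
      unfolding has_field_derivative_def B_def by (simp add: mult_commute_abs)
    from DERIV_unique[OF this par(1)[OF sB, of 0 0]] show ?thesis .
  qed
  ultimately show "P \<bullet> b = Q \<bullet> b" by simp
qed

text \<open>The component of \<open>d\<close> orthogonal to \<open>h\<close> pairs to zero with the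
  whole curve, hence with its derivative.\<close>

lemma subspace_vector_derivative:
  fixes h :: "'v::euclidean_space set"
  assumes h: "subspace h" and c: "\<And>t. c t \<in> h" and d: "(c has_vector_derivative d) (at 0)"
  shows "d \<in> h"
proof -
  obtain y z where yz: "y \<in> span h" "\<And>w. w \<in> span h \<Longrightarrow> orthogonal z w" "d = y + z"
    using orthogonal_subspace_decomp_exists[of h d] by metis
  have sp: "span h = h" using h by (simp add: span_eq_iff)
  have "((\<lambda>t. c t \<bullet> z) has_derivative (\<lambda>s. (s *\<^sub>R d) \<bullet> z)) (at 0)"
    using d by (intro has_derivative_inner_left) (simp add: has_vector_derivative_def)
  moreover have "c t \<bullet> z = 0" for t
    using yz(2)[of "c t"] c[of t] sp by (simp add: orthogonal_def inner_commute)
  ultimately have "((\<lambda>t::real. 0::real) has_derivative (\<lambda>s. (s *\<^sub>R d) \<bullet> z)) (at 0)" by simp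
  then have "(\<lambda>s::real. (s *\<^sub>R d) \<bullet> z) = (\<lambda>s. 0)" using has_derivative_unique has_derivative_const by blast
  from fun_cong[OF this, of 1] have "d \<bullet> z = 0" by simp
  moreover have "y \<bullet> z = 0" using yz(1,2) by (simp add: orthogonal_def inner_commute)
  ultimately have "z \<bullet> z = 0" using yz(3) by (simp add: inner_add_left)
  then show ?thesis using yz sp by simp
qed

section \<open>Left translation, one-parameter subgroups and conjugation\<close>

locale exp_group =
  fixes mul br :: "'v::euclidean_space \<Rightarrow> 'v \<Rightarrow> 'v"
  assumes grp: "exp_coord_group mul br"
begin

lemma assoc: "mul (mul x y) z = mul x (mul y z)"
  and mul_0 [simp]: "mul 0 x = x" "mul x 0 = x" "mul x (- x) = 0" "mul (- x) x = 0"
  and ray: "mul (s *\<^sub>R v) (t *\<^sub>R v) = (s + t) *\<^sub>R v"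
  using grp unfolding exp_coord_group_def by blast+

lemma cancel [simp]: "mul (- x) (mul x y) = y" "mul x (mul (- x) y) = y"
  by (simp_all add: assoc[symmetric])

lemma minus_mul: "- mul x y = mul (- y) (- x)"
proof -
  have "mul (mul x y) (mul (- y) (- x)) = 0" by (simp add: assoc)
  then have "mul (- mul x y) (mul (mul x y) (mul (- y) (- x))) = - mul x y" by simp
  then show ?thesis by simp
qed

lemma smooth_mul_pair: "smooth_map_on UNIV (\<lambda>z. mul (fst z) (snd z))"
  using grp unfolding exp_coord_group_def smooth_map_on_def by blast

lemma smooth_mul:
  assumes "smooth_map_on UNIV f" "smooth_map_on UNIV g"
  shows "smooth_map_on UNIV (\<lambda>x. mul (f x) (g x))"
  using smooth_map_on_compose[OF smooth_mul_pair smooth_map_on_Pair[OF assms]] by simp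

definition Dmul :: "'v \<Rightarrow> 'v \<Rightarrow> 'v \<times> 'v \<Rightarrow> 'v" where
  "Dmul x y = frechet_derivative (\<lambda>z. mul (fst z) (snd z)) (at (x, y))"

lemma Dmul_linear: "linear (Dmul x y)"
  unfolding Dmul_def using smooth_map_on_has_derivative[OF smooth_mul_pair] has_derivative_linear by blast

lemma has_derivative_mul:
  assumes "(f has_derivative f') (at x)" "(g has_derivative g') (at x)"
  shows "((\<lambda>x. mul (f x) (g x)) has_derivative (\<lambda>h. Dmul (f x) (g x) (f' h, g' h))) (at x)"
  using has_derivative_compose[OF has_derivative_Pair[OF assms] smooth_map_on_has_derivative[OF smooth_mul_pair]]
  by (simp add: Dmul_def)

lemma has_vector_derivative_mul:
  assumes "(f has_vector_derivative f') (at x)" "(g has_vector_derivative g') (at x)"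
  shows "((\<lambda>x. mul (f x) (g x)) has_vector_derivative Dmul (f x) (g x) (f', g')) (at x)"
proof -
  have "Dmul (f x) (g x) (h *\<^sub>R f', h *\<^sub>R g') = h *\<^sub>R Dmul (f x) (g x) (f', g')" for h
    using linear_cmul[OF Dmul_linear, of "f x" "g x" h "(f', g')"] by simp
  then show ?thesis
    using has_derivative_mul[OF assms[unfolded has_vector_derivative_def]]
    by (simp add: has_vector_derivative_def)
qed

lemma vector_derivative_unique: "(f has_vector_derivative a) (at x) \<Longrightarrow> (f has_vector_derivative b) (at x) \<Longrightarrow> a = b"
  by (rule vector_derivative_unique_at)

lemma ray_derivative: "((\<lambda>t. t *\<^sub>R v) has_vector_derivative v) (at t)" for v :: 'v
  by (auto intro!: derivative_eq_intros)

lemma Dmul_0_left: "Dmul 0 y (0, w) = w"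
proof -
  have "((\<lambda>x. x) has_derivative (\<lambda>h. Dmul 0 y (0, h))) (at y)"
    using has_derivative_mul[OF has_derivative_const[of 0] has_derivative_ident[of "at y"]] by simp
  from fun_cong[OF has_derivative_unique[OF this has_derivative_ident], of w] show ?thesis by simp
qed

lemma Dmul_0_right: "Dmul x 0 (v, 0) = v"
proof -
  have "((\<lambda>x. x) has_derivative (\<lambda>h. Dmul x 0 (h, 0))) (at x)"
    using has_derivative_mul[OF has_derivative_ident[of "at x"] has_derivative_const[of 0]] by simp
  from fun_cong[OF has_derivative_unique[OF this has_derivative_ident], of v] show ?thesis by simp
qed

lemma Dmul_00: "Dmul 0 0 (v, w) = v + w"
  using linear_add[OF Dmul_linear, of 0 0 "(v, 0)" "(0, w)"] by (simp add: Dmul_0_left Dmul_0_right)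

definition left_inv :: "'v \<Rightarrow> 'v \<Rightarrow> 'v" where "left_inv x v = Dmul x 0 (0, v)"

lemma left_inv_derivative: "((\<lambda>t. mul x (t *\<^sub>R v)) has_vector_derivative left_inv x v) (at 0)"
  using has_vector_derivative_mul[OF has_vector_derivative_const[of x] ray_derivative[of v 0]]
  by (simp add: left_inv_def)

lemma left_inv_derivative_at: "((\<lambda>t. mul x (t *\<^sub>R v)) has_vector_derivative left_inv (mul x (t *\<^sub>R v)) v) (at t)"
proof -
  have "((\<lambda>s. mul (mul x (t *\<^sub>R v)) (s *\<^sub>R v)) has_vector_derivative left_inv (mul x (t *\<^sub>R v)) v) (at (t - t))"
    using left_inv_derivative by simp
  then have "((\<lambda>s. mul (mul x (t *\<^sub>R v)) ((s - t) *\<^sub>R v)) has_vector_derivative 1 *\<^sub>R left_inv (mul x (t *\<^sub>R v)) v) (at t)"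
    by (intro vector_diff_chain_at[of "\<lambda>s. s - t" 1 t "\<lambda>s. mul (mul x (t *\<^sub>R v)) (s *\<^sub>R v)", unfolded o_def])
       (auto intro!: derivative_eq_intros)
  then show ?thesis by (simp add: assoc ray)
qed

lemma smooth_left_inv: "smooth_map_on UNIV (\<lambda>x. left_inv x v)"
proof -
  have "smooth_map_on UNIV (\<lambda>x::'v. (x, 0::'v))" by (intro smooth_map_on_linear) (auto intro!: linearI)
  from smooth_map_on_compose[OF smooth_map_on_frechet[OF smooth_mul_pair, of "(0, v)"] this]
  show ?thesis by (simp add: left_inv_def Dmul_def)
qed

lemma lvf_eq:
  assumes "(u has_derivative u') (at x)"
  shows "lvf mul v u x = u' (left_inv x v)"
proof -
  have "((\<lambda>t. mul x (t *\<^sub>R v)) has_derivative (\<lambda>h. h *\<^sub>R left_inv x v)) (at 0)"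
    using left_inv_derivative[of x v] by (simp add: has_vector_derivative_def)
  from has_derivative_compose[OF this, of u u'] assms
  have "((\<lambda>t. u (mul x (t *\<^sub>R v))) has_derivative (\<lambda>h. u' (h *\<^sub>R left_inv x v))) (at 0)" by simp
  moreover have "u' (h *\<^sub>R left_inv x v) = u' (left_inv x v) * h" for h
    using linear_cmul[OF has_derivative_linear[OF assms]] by simp
  ultimately have "((\<lambda>t. u (mul x (t *\<^sub>R v))) has_real_derivative u' (left_inv x v)) (at 0)"
    by (simp add: has_field_derivative_def)
  then show ?thesis unfolding lvf_def by (rule DERIV_imp_deriv)
qed

definition Ad :: "'v \<Rightarrow> 'v \<Rightarrow> 'v" where "Ad g w = Dmul g (- g) (left_inv g w, 0)"

lemma conj_has_derivative: "((\<lambda>y. mul (mul g y) (- g)) has_derivative Ad g) (at 0)"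
proof -
  have "((\<lambda>y. mul g y) has_derivative left_inv g) (at 0)"
    using has_derivative_mul[of "\<lambda>_. g" "\<lambda>_. 0" 0 "\<lambda>x. x" "\<lambda>x. x"] by (simp add: left_inv_def[abs_def])
  from has_derivative_mul[OF this has_derivative_const[of "- g"]]
  show ?thesis by (simp add: Ad_def[abs_def])
qed

lemma Ad_linear: "linear (Ad g)"
  using conj_has_derivative has_derivative_linear by blast

lemma conj_curve_derivative:
  assumes "(c has_vector_derivative d) (at 0)" "c 0 = 0"
  shows "((\<lambda>t. mul (mul g (c t)) (- g)) has_vector_derivative Ad g d) (at 0)"
proof -
  have "((\<lambda>t. mul (mul g (c t)) (- g)) has_derivative (\<lambda>h. Ad g (h *\<^sub>R d))) (at 0)"
    using has_derivative_compose[OF assms(1)[unfolded has_vector_derivative_def], of "\<lambda>y. mul (mul g y) (- g)" "Ad g"]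
      conj_has_derivative assms(2) by simp
  then show ?thesis by (simp add: has_vector_derivative_def linear_cmul[OF Ad_linear])
qed

text \<open>The curve \<gamma>(t) exp(-tw) is constant: its value at t + h is \<gamma>(t) times
  \<gamma>(h) exp(-hw) times exp(-tw), and the middle factor has derivative w - w = 0 at h =
  0.\<close>

lemma one_parameter_unique:
  assumes hom: "\<And>s t. \<gamma> (s + t) = mul (\<gamma> s) (\<gamma> t)" and d: "(\<gamma> has_vector_derivative w) (at 0)"
  shows "\<gamma> t = t *\<^sub>R w"
proof -
  define \<beta> where "\<beta> t = mul (\<gamma> t) (- (t *\<^sub>R w))" for t
  have \<gamma>0: "\<gamma> 0 = 0"
  proof -
    have "mul (- \<gamma> 0) (\<gamma> (0 + 0)) = \<gamma> 0" unfolding hom by simp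
    then show ?thesis by simp
  qed
  have "(\<beta> has_vector_derivative 0) (at t)" for t
  proof -
    have m: "((\<lambda>h. - (h *\<^sub>R w)) has_vector_derivative - w) (at 0)"
      by (auto intro!: derivative_eq_intros)
    have "((\<lambda>h. mul (\<gamma> h) (- (h *\<^sub>R w))) has_vector_derivative 0) (at 0)"
      using has_vector_derivative_mul[OF d m] \<gamma>0 by (simp add: Dmul_00)
    from has_vector_derivative_mul[OF has_vector_derivative_const[of "\<gamma> t"] has_vector_derivative_mul[OF this has_vector_derivative_const[of "- (t *\<^sub>R w)"]]]
    have "((\<lambda>h. mul (\<gamma> t) (mul (mul (\<gamma> h) (- (h *\<^sub>R w))) (- (t *\<^sub>R w)))) has_vector_derivative 0) (at (t - t))"
      using linear_0[OF Dmul_linear] by (simp add: zero_prod_def[symmetric])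
    then have "((\<lambda>s. mul (\<gamma> t) (mul (mul (\<gamma> (s - t)) (- ((s - t) *\<^sub>R w))) (- (t *\<^sub>R w)))) has_vector_derivative 1 *\<^sub>R 0) (at t)"
      by (intro vector_diff_chain_at[of "\<lambda>s. s - t" 1 t "\<lambda>h. mul (\<gamma> t) (mul (mul (\<gamma> h) (- (h *\<^sub>R w))) (- (t *\<^sub>R w)))", unfolded o_def])
         (auto intro!: derivative_eq_intros)
    moreover have "mul (\<gamma> t) (mul (mul (\<gamma> (s - t)) (- ((s - t) *\<^sub>R w))) (- (t *\<^sub>R w))) = \<beta> s" for s
    proof -
      have "mul (- ((s - t) *\<^sub>R w)) (- (t *\<^sub>R w)) = - (s *\<^sub>R w)"
        using ray[of "- (s - t)" w "- t"] by (simp add: algebra_simps)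
      moreover have "mul (\<gamma> t) (\<gamma> (s - t)) = \<gamma> s" using hom[of t "s - t"] by simp
      ultimately show ?thesis by (simp add: \<beta>_def assoc[symmetric]) (simp add: assoc)
    qed
    ultimately show ?thesis by simp
  qed
  then obtain k where k: "\<And>t. \<beta> t = k" using has_vector_derivative_zero_constant[of UNIV \<beta>] by auto
  have "\<beta> 0 = 0" by (simp add: \<beta>_def \<gamma>0)
  then have "\<beta> t = 0" using k[of t] k[of 0] by simp
  then have "mul (mul (\<gamma> t) (- (t *\<^sub>R w))) (t *\<^sub>R w) = t *\<^sub>R w" by (simp add: \<beta>_def)
  then show ?thesis by (simp add: assoc)
qed

text \<open>A conjugated one-parameter subgroup is again one, hence a straight line. As exp is the
  identity in these coordinates, conjugation itself is the linear map \<open>Ad g\<close>.\<close>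

lemma conj_ray: "mul (mul g (t *\<^sub>R w)) (- g) = t *\<^sub>R Ad g w"
proof (rule one_parameter_unique[where \<gamma> = "\<lambda>t. mul (mul g (t *\<^sub>R w)) (- g)"])
  fix s t
  show "mul (mul g ((s + t) *\<^sub>R w)) (- g) = mul (mul (mul g (s *\<^sub>R w)) (- g)) (mul (mul g (t *\<^sub>R w)) (- g))"
    by (simp add: assoc ray[symmetric])
next
  show "((\<lambda>t. mul (mul g (t *\<^sub>R w)) (- g)) has_vector_derivative Ad g w) (at 0)"
    by (rule conj_curve_derivative[OF ray_derivative]) simp
qed

lemma conj_eq_Ad: "mul (mul g w) (- g) = Ad g w"
  using conj_ray[of g 1 w] by simp

lemma mul_ray_right: "mul g (t *\<^sub>R w) = mul (t *\<^sub>R Ad g w) g"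
proof -
  have "mul (mul (mul g (t *\<^sub>R w)) (- g)) g = mul g (t *\<^sub>R w)" by (simp add: assoc)
  then show ?thesis by (simp add: conj_ray)
qed

lemma Ad_mul: "Ad (mul g h) w = Ad g (Ad h w)"
  by (simp add: conj_eq_Ad[symmetric] assoc minus_mul)

lemma Ad_0 [simp]: "Ad 0 w = w"
  using conj_eq_Ad[of 0 w] by simp

end

lemma smooth_map_on_curve:
  assumes "smooth_map_on UNIV f" "(c has_vector_derivative c') (at t)"
  shows "((\<lambda>t. f (c t)) has_vector_derivative frechet_derivative f (at (c t)) c') (at t)"
proof -
  have "((\<lambda>t. f (c t)) has_derivative (\<lambda>h. frechet_derivative f (at (c t)) (h *\<^sub>R c'))) (at t)"
    using has_derivative_compose[OF assms(2)[unfolded has_vector_derivative_def] smooth_map_on_has_derivative[OF assms(1)]] .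
  then show ?thesis
    by (simp add: has_vector_derivative_def linear_cmul[OF has_derivative_linear[OF smooth_map_on_has_derivative[OF assms(1)]]])
qed

lemma smooth_map_on_isCont: "smooth_map_on UNIV f \<Longrightarrow> isCont f x"
  using has_derivative_continuous[OF smooth_map_on_has_derivative] .

lemma constant_of_zero_derivative:
  fixes f :: "real \<Rightarrow> 'v::real_normed_vector"
  assumes "\<And>t. (f has_vector_derivative 0) (at t)"
  shows "f s = f 0"
  using has_vector_derivative_zero_constant[of UNIV f] assms by (metis UNIV_I convex_UNIV)

section \<open>The bracket as the derivative of conjugation\<close>

context exp_group begin

lemma left_inv_0 [simp]: "left_inv 0 v = v"
  by (simp add: left_inv_def Dmul_00)

text \<open>The commutator axiom of the group is tested at 0 on the linear coordinate functions,
  whose derivatives along left-invariant fields are the components of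
  \<open>left_inv\<close>.\<close>

lemma bracket_eq:
  assumes P: "((\<lambda>a. left_inv (a *\<^sub>R v) w) has_vector_derivative P) (at 0)"
    and Q: "((\<lambda>a. left_inv (a *\<^sub>R w) v) has_vector_derivative Q) (at 0)"
  shows "br v w = P - Q"
proof (rule euclidean_eqI)
  fix b :: 'v assume "b \<in> Basis"
  define u where "u x = x \<bullet> b" for x :: 'v
  have ul: "linear u" unfolding u_def[abs_def] by (rule bounded_linear.linear[OF bounded_linear_inner_left])
  have lu: "lvf mul y u x = left_inv x y \<bullet> b" for x y
    using lvf_eq[OF linear_imp_has_derivative[OF ul]] by (simp add: u_def)
  have llu: "lvf mul y (lvf mul z u) 0 = R \<bullet> b" if "((\<lambda>a. left_inv (a *\<^sub>R y) z) has_vector_derivative R) (at 0)" for y z R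
  proof -
    have "((\<lambda>a. left_inv (a *\<^sub>R y) z \<bullet> b) has_derivative (\<lambda>h. (h *\<^sub>R R) \<bullet> b)) (at 0)"
      using that by (intro has_derivative_inner_left) (simp add: has_vector_derivative_def)
    then have "((\<lambda>a. left_inv (a *\<^sub>R y) z \<bullet> b) has_real_derivative R \<bullet> b) (at 0)"
      by (simp add: has_field_derivative_def mult_commute_abs)
    then show ?thesis unfolding lvf_def[of mul y] lu by (simp add: DERIV_imp_deriv)
  qed
  have "lvf mul v (lvf mul w u) 0 - lvf mul w (lvf mul v u) 0 = lvf mul (br v w) u 0"
    using grp smooth_on_linear[OF ul] unfolding exp_coord_group_def by blast
  then show "br v w \<bullet> b = (P - Q) \<bullet> b"
    unfolding llu[OF P] llu[OF Q] lu by (simp add: inner_diff_left)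
qed

lemma left_inv_ray_derivative:
  "((\<lambda>a. left_inv (a *\<^sub>R v) w) has_vector_derivative frechet_derivative (\<lambda>x. left_inv x w) (at 0) v) (at 0)"
  using smooth_map_on_curve[OF smooth_left_inv ray_derivative[of v 0]] by simp

lemma bracket_antisym: "br v w = - br w v"
  using bracket_eq[OF left_inv_ray_derivative left_inv_ray_derivative, of v w]
    bracket_eq[OF left_inv_ray_derivative left_inv_ray_derivative, of w v] by simp

text \<open>Differentiating \<open>exp (sv) exp (\<tau>w) exp (-sv)\<close> first in \<open>\<tau>\<close> and then in \<open>s\<close>; by symmetry of
  mixed partial derivatives the two contributions are the two terms of the commutator of
  left-invariant vector fields.\<close>
lemma Ad_derivative_0: "((\<lambda>s. Ad (s *\<^sub>R v) w) has_vector_derivative br v w) (at 0)"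
proof -
  define r where "r z = mul (mul (fst z *\<^sub>R v) (fst (snd z) *\<^sub>R w)) (snd (snd z) *\<^sub>R v)" for z :: "real \<times> real \<times> real"
  define f where "f z = mul (fst z *\<^sub>R w) (snd z *\<^sub>R v)" for z :: "real \<times> real"
  have sr: "smooth_map_on UNIV r" unfolding r_def
    by (intro smooth_mul smooth_map_on_linear) (auto intro!: linearI simp: algebra_simps)
  have sf: "smooth_map_on UNIV f" unfolding f_def
    by (intro smooth_mul smooth_map_on_linear) (auto intro!: linearI simp: algebra_simps)
  define A where "A z = frechet_derivative r (at (fst z, 0, snd z)) (0, 1, 0)" for z :: "real \<times> real"
  have sA: "smooth_map_on UNIV A"
  proof -
    have "smooth_map_on UNIV (\<lambda>z::real \<times> real. (fst z, 0::real, snd z))"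
      by (intro smooth_map_on_linear) (auto intro!: linearI)
    from smooth_map_on_compose[OF smooth_map_on_frechet[OF sr, of "(0, 1, 0)"] this]
    show ?thesis by (simp add: A_def[abs_def])
  qed
  have A: "((\<lambda>t. r (a, t, c)) has_vector_derivative A (a, c)) (at 0)" for a c
    using smooth_map_on_curve[OF sr, of "\<lambda>t. (a, t, c)" "(0, 1, 0)" 0]
    by (simp add: A_def has_vector_derivative_Pair)
  have A1: "A (a, 0) = left_inv (a *\<^sub>R v) w" for a
    using A[of a 0] left_inv_derivative[of "a *\<^sub>R v" w] by (intro vector_derivative_unique[of _ _ 0]) (auto simp: r_def)
  have A2: "A (s, - s) = Ad (s *\<^sub>R v) w" for s
  proof (rule vector_derivative_unique[OF A])
    show "((\<lambda>t. r (s, t, - s)) has_vector_derivative Ad (s *\<^sub>R v) w) (at 0)"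
      using conj_curve_derivative[OF ray_derivative[of w 0], of "s *\<^sub>R v"] by (simp add: r_def)
  qed
  have A3: "A (0, c) = frechet_derivative f (at (0, c)) (1, 0)" for c
  proof (rule vector_derivative_unique[OF A])
    have "((\<lambda>t. f (t, c)) has_vector_derivative frechet_derivative f (at (0, c)) (1, 0)) (at 0)"
      using smooth_map_on_curve[OF sf, of "\<lambda>t. (t, c)" "(1, 0)" 0] by (simp add: has_vector_derivative_Pair)
    then show "((\<lambda>t. r (0, t, c)) has_vector_derivative frechet_derivative f (at (0, c)) (1, 0)) (at 0)"
      by (simp add: r_def f_def)
  qed
  have f2: "frechet_derivative f (at (t, 0)) (0, 1) = left_inv (t *\<^sub>R w) v" for t
  proof (rule vector_derivative_unique[OF _ left_inv_derivative])
    have "((\<lambda>c. f (t, c)) has_vector_derivative frechet_derivative f (at (t, 0)) (0, 1)) (at 0)"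
      using smooth_map_on_curve[OF sf, of "\<lambda>c. (t, c)" "(0, 1)" 0] by (simp add: has_vector_derivative_Pair)
    then show "((\<lambda>c. mul (t *\<^sub>R w) (c *\<^sub>R v)) has_vector_derivative frechet_derivative f (at (t, 0)) (0, 1)) (at 0)"
      by (simp add: f_def)
  qed
  define D where "D = frechet_derivative A (at (0, 0))"
  have Dlin: "linear D" unfolding D_def using smooth_map_on_has_derivative[OF sA] has_derivative_linear by blast
  have D: "((\<lambda>t. A (c t)) has_vector_derivative D c') (at 0)" if "(c has_vector_derivative c') (at 0)" "c 0 = (0, 0)" for c c'
    using smooth_map_on_curve[OF sA that(1)] that(2) by (simp add: D_def)
  have P: "((\<lambda>a. left_inv (a *\<^sub>R v) w) has_vector_derivative D (1, 0)) (at 0)"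
    using D[of "\<lambda>t. (t, 0)" "(1, 0)"] by (simp add: A1 has_vector_derivative_Pair)
  have "((\<lambda>c. frechet_derivative f (at (0, c)) (1, 0)) has_vector_derivative D (0, 1)) (at 0)"
    using D[of "\<lambda>t. (0, t)" "(0, 1)"] by (simp add: A3[symmetric] has_vector_derivative_Pair)
  moreover have "((\<lambda>t. frechet_derivative f (at (t, 0)) (0, 1)) has_vector_derivative
      frechet_derivative (\<lambda>x. left_inv x v) (at 0) w) (at 0)"
    unfolding f2 by (rule left_inv_ray_derivative)
  ultimately have "D (0, 1) = frechet_derivative (\<lambda>x. left_inv x v) (at 0) w"
    by (rule smooth_mixed_partials[OF sf])
  then have "br v w = D (1, 0) - D (0, 1)" using bracket_eq[OF P left_inv_ray_derivative] by simp
  also have "\<dots> = D (1, - 1)" using linear_diff[OF Dlin, of "(1, 0)" "(0, 1)"] by simp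
  finally have eq: "br v w = D (1, - 1)" .
  have "((\<lambda>s. A (s, - s)) has_vector_derivative D (1, - 1)) (at 0)"
    by (rule D) (auto intro!: has_vector_derivative_Pair derivative_eq_intros)
  then show ?thesis by (simp add: A2 eq)
qed

lemma Ad_ray_add: "Ad ((s + t) *\<^sub>R v) w = Ad (s *\<^sub>R v) (Ad (t *\<^sub>R v) w)"
  by (simp add: ray[symmetric] Ad_mul)

text \<open>The increment of s may be split off on either side of the one-parameter group. The first
  form feeds the exponential series; the second keeps the bracket outermost, where a functional
  vanishing on brackets can see it.\<close>

lemma Ad_derivative: "((\<lambda>s. Ad (s *\<^sub>R v) w) has_vector_derivative Ad (s *\<^sub>R v) (br v w)) (at s)"
  and Ad_derivative': "((\<lambda>s. Ad (s *\<^sub>R v) w) has_vector_derivative br v (Ad (s *\<^sub>R v) w)) (at s)"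
proof -
  have shift: "((\<lambda>t. g (t - s)) has_vector_derivative d) (at s)" if "(g has_vector_derivative d) (at 0)" for g :: "real \<Rightarrow> 'v" and d
  proof -
    have "((\<lambda>t. t - s) has_vector_derivative 1) (at s)" by (auto intro!: derivative_eq_intros)
    from vector_diff_chain_at[OF this, of g d] that show ?thesis by (simp add: o_def)
  qed
  have "((\<lambda>t. Ad (s *\<^sub>R v) (Ad ((t - s) *\<^sub>R v) w)) has_vector_derivative Ad (s *\<^sub>R v) (br v w)) (at s)"
    by (rule bounded_linear.has_vector_derivative[OF linear_conv_bounded_linear[THEN iffD1, OF Ad_linear] shift[OF Ad_derivative_0]])
  then show "((\<lambda>s. Ad (s *\<^sub>R v) w) has_vector_derivative Ad (s *\<^sub>R v) (br v w)) (at s)"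
    by (simp add: Ad_ray_add[symmetric])
  have "((\<lambda>t. Ad ((t - s) *\<^sub>R v) (Ad (s *\<^sub>R v) w)) has_vector_derivative br v (Ad (s *\<^sub>R v) w)) (at s)"
    by (rule shift[OF Ad_derivative_0])
  then show "((\<lambda>s. Ad (s *\<^sub>R v) w) has_vector_derivative br v (Ad (s *\<^sub>R v) w)) (at s)"
    by (simp add: Ad_ray_add[symmetric])
qed

lemma bracket_linear: "linear (br v)"
proof (rule linearI)
  fix x y :: 'v and c :: real
  have "((\<lambda>s. Ad (s *\<^sub>R v) x + Ad (s *\<^sub>R v) y) has_vector_derivative br v x + br v y) (at 0)"
    by (intro has_vector_derivative_add Ad_derivative_0)
  then have "((\<lambda>s. Ad (s *\<^sub>R v) (x + y)) has_vector_derivative br v x + br v y) (at 0)"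
    by (simp add: linear_add[OF Ad_linear])
  then show "br v (x + y) = br v x + br v y" using vector_derivative_unique[OF Ad_derivative_0] by blast
  have "((\<lambda>s. c *\<^sub>R Ad (s *\<^sub>R v) x) has_vector_derivative c *\<^sub>R br v x) (at 0)"
    by (rule bounded_linear.has_vector_derivative[OF bounded_linear_scaleR_right Ad_derivative_0])
  then have "((\<lambda>s. Ad (s *\<^sub>R v) (c *\<^sub>R x)) has_vector_derivative c *\<^sub>R br v x) (at 0)"
    by (simp add: linear_cmul[OF Ad_linear])
  then show "br v (c *\<^sub>R x) = c *\<^sub>R br v x" using vector_derivative_unique[OF Ad_derivative_0] by blast
qed

lemma bracket_linear_left: "linear (\<lambda>v. br v w)"
  using linear_compose_neg[OF bracket_linear[of w]] by (simp add: bracket_antisym[of _ w])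

lemma Ad_of_commuting:
  assumes "br v w = 0" shows "Ad (s *\<^sub>R v) w = w"
proof -
  have "((\<lambda>s. Ad (s *\<^sub>R v) w) has_vector_derivative 0) (at s)" for s
    using Ad_derivative[of v w s] assms by (simp add: linear_0[OF Ad_linear])
  from constant_of_zero_derivative[OF this, of s] show ?thesis by simp
qed

text \<open>The finite series of exp (s ad v). The induction is on the order of nilpotency: the
  derivative in s is \<open>Ad\<close> applied to \<open>br v w\<close>, which dies one step
  earlier.\<close>

lemma Ad_nilpotent:
  "((br v) ^^ n) w = 0 \<Longrightarrow> Ad (s *\<^sub>R v) w = (\<Sum>k<n. (s ^ k / fact k) *\<^sub>R ((br v) ^^ k) w)"
proof (induction n arbitrary: w s)
  case 0
  then show ?case by (simp add: linear_0[OF Ad_linear])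
next
  case (Suc n)
  have "((br v) ^^ n) (br v w) = 0" using Suc.prems by (simp add: funpow_swap1)
  note IH = Suc.IH[OF this]
  define f where "f s = Ad (s *\<^sub>R v) w - (w + (\<Sum>k<n. (s ^ Suc k / fact (Suc k)) *\<^sub>R ((br v) ^^ k) (br v w)))" for s
  have "(f has_vector_derivative 0) (at s)" for s
  proof -
    have d: "((\<lambda>s. (s ^ Suc k / fact (Suc k)) *\<^sub>R y) has_vector_derivative (s ^ k / fact k) *\<^sub>R y) (at s)" for k and y :: 'v
    proof -
      have "((\<lambda>s::real. s ^ Suc k / fact (Suc k)) has_real_derivative s ^ k / fact k) (at s)"
      proof -
        have "((\<lambda>s::real. s ^ Suc k / fact (Suc k)) has_real_derivative (real (Suc k) * s ^ (Suc k - Suc 0)) / fact (Suc k)) (at s)"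
          by (rule DERIV_cdivide[OF DERIV_pow])
        moreover have "(real (Suc k) * s ^ (Suc k - Suc 0)) / fact (Suc k) = s ^ k / fact k"
          unfolding fact_Suc using mult_divide_mult_cancel_left[of "real (Suc k)" "s ^ k" "fact k"] by (simp del: of_nat_Suc)
        ultimately show ?thesis by (simp only:)
      qed
      from has_vector_derivative_scaleR[OF this has_vector_derivative_const[of y]] show ?thesis by simp
    qed
    have "(f has_vector_derivative Ad (s *\<^sub>R v) (br v w) - (0 + (\<Sum>k<n. (s ^ k / fact k) *\<^sub>R ((br v) ^^ k) (br v w)))) (at s)"
      unfolding f_def
      by (intro has_vector_derivative_diff has_vector_derivative_add has_vector_derivative_const
          has_vector_derivative_sum d Ad_derivative)
    then show ?thesis by (simp add: IH)
  qed
  from constant_of_zero_derivative[OF this, of s] have "f s = 0" by (simp add: f_def)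
  then have "Ad (s *\<^sub>R v) w = w + (\<Sum>k<n. (s ^ Suc k / fact (Suc k)) *\<^sub>R ((br v) ^^ k) (br v w))"
    by (simp add: f_def del: fact_Suc power_Suc)
  also have "\<dots> = (\<Sum>k<Suc n. (s ^ k / fact k) *\<^sub>R ((br v) ^^ k) w)"
    unfolding sum.lessThan_Suc_shift by (simp add: funpow_swap1 del: fact_Suc power_Suc)
  finally show ?case .
qed

text \<open>Closure under \<open>mul\<close> keeps the conjugates inside \<open>h\<close>. Hence the
  derivative of \<open>l\<close> along them is \<open>l\<close> of a bracket within
  \<open>h\<close>, which is zero.\<close>

lemma Ad_invariant:
  assumes h: "subspace h" and closed: "\<And>a b. a \<in> h \<Longrightarrow> b \<in> h \<Longrightarrow> mul a b \<in> h"
    and l: "linear l" and l0: "\<And>a b. a \<in> h \<Longrightarrow> b \<in> h \<Longrightarrow> l (br a b) = (0::real)"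
    and x: "x \<in> h" and w: "w \<in> h"
  shows "Ad x w \<in> h" "l (Ad x w) = l w"
proof -
  have Ad_h: "Ad y w \<in> h" if "y \<in> h" for y
    unfolding conj_eq_Ad[symmetric] using closed[OF closed[OF that w] subspace_neg[OF h that]] .
  then show "Ad x w \<in> h" using x .
  have "((\<lambda>s. l (Ad (s *\<^sub>R x) w)) has_vector_derivative 0) (at s)" for s
    using bounded_linear.has_vector_derivative[OF linear_conv_bounded_linear[THEN iffD1, OF l] Ad_derivative'[of x w s]]
      l0[OF x Ad_h[OF subspace_scale[OF h x, of s]]] by simp
  from constant_of_zero_derivative[OF this, of 1] show "l (Ad x w) = l w" by simp
qed

text \<open>The derivative \<open>D s\<close> of \<open>exp (-sx) exp (s (x + \<epsilon>w))\<close> at \<open>\<epsilon> = 0\<close> satisfies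
  \<open>D (s + r) = Ad (exp (-rx)) (D s) + D r\<close>, so a functional that is invariant under Ad is additive
  along \<open>D\<close>. This replaces the Baker-Campbell-Hausdorff formula.\<close>
lemma additive_on_subgroup:
  assumes h: "subspace h" and closed: "\<And>a b. a \<in> h \<Longrightarrow> b \<in> h \<Longrightarrow> mul a b \<in> h"
    and l: "linear l" and l0: "\<And>a b. a \<in> h \<Longrightarrow> b \<in> h \<Longrightarrow> l (br a b) = (0::real)"
    and a: "a \<in> h" and b: "b \<in> h"
  shows "l (mul a b) = l a + l b"
proof -
  have bl: "bounded_linear l" using l by (simp add: linear_conv_bounded_linear)
  have dexp: "l (Dmul (- x) x (0, w)) = l w" if x: "x \<in> h" and w: "w \<in> h" for x w
  proof -
    define c where "c s e = mul (- (s *\<^sub>R x)) (s *\<^sub>R (x + e *\<^sub>R w))" for s e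
    define D where "D s = Dmul (- (s *\<^sub>R x)) (s *\<^sub>R x) (0, s *\<^sub>R w)" for s
    have cD: "(c s has_vector_derivative D s) (at 0)" for s
    proof -
      have "((\<lambda>e. s *\<^sub>R (x + e *\<^sub>R w)) has_vector_derivative s *\<^sub>R w) (at 0)"
        by (auto intro!: derivative_eq_intros)
      from has_vector_derivative_mul[OF has_vector_derivative_const[of "- (s *\<^sub>R x)"] this]
      show ?thesis by (simp add: c_def[abs_def] D_def)
    qed
    have c0: "c s 0 = 0" for s by (simp add: c_def)
    have ch: "c s e \<in> h" for s e
      unfolding c_def by (intro closed subspace_neg[OF h] subspace_scale[OF h] subspace_add[OF h] x w)
    have Dh: "D s \<in> h" for s by (rule subspace_vector_derivative[OF h ch cD])
    have rec: "D (s + r) = Ad (- (r *\<^sub>R x)) (D s) + D r" for s r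
    proof (rule vector_derivative_unique[OF cD])
      have "c (s + r) e = mul (mul (mul (- (r *\<^sub>R x)) (c s e)) (- (- (r *\<^sub>R x)))) (c r e)" for e
      proof -
        have 1: "mul (- (r *\<^sub>R x)) (- (s *\<^sub>R x)) = - ((s + r) *\<^sub>R x)"
          using ray[of "- r" x "- s"] by (simp add: algebra_simps)
        have 2: "mul (s *\<^sub>R (x + e *\<^sub>R w)) (r *\<^sub>R (x + e *\<^sub>R w)) = (s + r) *\<^sub>R (x + e *\<^sub>R w)" by (rule ray)
        show ?thesis unfolding c_def 1[symmetric] 2[symmetric] by (simp add: assoc)
      qed
      then have "c (s + r) = (\<lambda>e. mul (mul (mul (- (r *\<^sub>R x)) (c s e)) (- (- (r *\<^sub>R x)))) (c r e))" by (rule ext)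
      moreover have "((\<lambda>e. mul (mul (mul g (c s e)) (- g)) (c r e)) has_vector_derivative Ad g (D s) + D r) (at 0)" for g
        using has_vector_derivative_mul[OF conj_curve_derivative[OF cD c0] cD] by (simp add: c0 Dmul_00)
      ultimately show "(c (s + r) has_vector_derivative Ad (- (r *\<^sub>R x)) (D s) + D r) (at 0)" by (simp only:)
    qed
    have add: "l (D (s + r)) = l (D s) + l (D r)" for s r
      unfolding rec linear_add[OF l]
      using Ad_invariant(2)[OF h closed l l0 subspace_neg[OF h subspace_scale[OF h x]] Dh] by simp
    have D0: "l (D 0) = 0" using add[of 0 0] by simp
    have mult: "l (D (real n * s)) = real n * l (D s)" for n s
      by (induction n) (simp_all add: D0 add distrib_right)
    \<comment> \<open>Additivity at s = 1 / (n + 1): the factor s in \<open>D s\<close> cancels n +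
      1. As n grows the base points tend to the origin, where \<open>Dmul\<close> is
      addition.\<close>
    have eq: "l (D 1) = l (Dmul (- (s *\<^sub>R x)) (s *\<^sub>R x) (0, w))" if "s = 1 / real (Suc n)" for s n
    proof -
      have "l (D 1) = real (Suc n) * l (D s)" using mult[of "Suc n" s] that by simp
      also have "D s = s *\<^sub>R Dmul (- (s *\<^sub>R x)) (s *\<^sub>R x) (0, w)"
        using linear_cmul[OF Dmul_linear, of "- (s *\<^sub>R x)" "s *\<^sub>R x" s "(0, w)"] by (simp add: D_def)
      finally show ?thesis using that by (simp add: linear_cmul[OF l])
    qed
    have "smooth_map_on UNIV (\<lambda>z. frechet_derivative (\<lambda>z. mul (fst z) (snd z)) (at z) (0, w))"
      by (rule smooth_map_on_frechet[OF smooth_mul_pair])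
    then have "isCont (\<lambda>z. frechet_derivative (\<lambda>z. mul (fst z) (snd z)) (at z) (0, w)) (0, 0)"
      by (rule smooth_map_on_isCont)
    moreover have "(\<lambda>n. (- ((1 / real (Suc n)) *\<^sub>R x), (1 / real (Suc n)) *\<^sub>R x)) \<longlonglongrightarrow> (- (0 *\<^sub>R x), 0 *\<^sub>R x)"
      by (intro tendsto_Pair tendsto_minus tendsto_scaleR tendsto_const LIMSEQ_Suc lim_1_over_n)
    ultimately have "(\<lambda>n. frechet_derivative (\<lambda>z. mul (fst z) (snd z))
        (at (- ((1 / real (Suc n)) *\<^sub>R x), (1 / real (Suc n)) *\<^sub>R x)) (0, w)) \<longlonglongrightarrow>
        frechet_derivative (\<lambda>z. mul (fst z) (snd z)) (at (0, 0)) (0, w)"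
      by (intro isCont_tendsto_compose[where g = "\<lambda>z. frechet_derivative (\<lambda>z. mul (fst z) (snd z)) (at z) (0, w)"]) auto
    then have "(\<lambda>n. l (Dmul (- ((1 / real (Suc n)) *\<^sub>R x)) ((1 / real (Suc n)) *\<^sub>R x) (0, w))) \<longlonglongrightarrow> l (Dmul 0 0 (0, w))"
      unfolding Dmul_def by (rule bounded_linear.tendsto[OF bl])
    then have "(\<lambda>n::nat. l (D 1)) \<longlonglongrightarrow> l w" unfolding eq[OF refl, symmetric] by (simp add: Dmul_00)
    then have "l (D 1) = l w" by (simp add: LIMSEQ_const_iff)
    then show ?thesis by (simp add: D_def)
  qed
  \<comment> \<open>Translation back by \<open>- x\<close> undoes \<open>left_inv x\<close>, so
    \<open>dexp\<close> applied to \<open>left_inv x w\<close> shows that \<open>l\<close> is the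
    same left-invariant form along all of \<open>h\<close>.\<close>
  have left: "l (left_inv x w) = l w" if x: "x \<in> h" and w: "w \<in> h" for x w
  proof -
    have "left_inv x w \<in> h"
      by (rule subspace_vector_derivative[OF h _ left_inv_derivative]) (intro closed x subspace_scale[OF h w])
    then have "l (Dmul (- x) x (0, left_inv x w)) = l (left_inv x w)" by (rule dexp[OF x])
    moreover have "Dmul (- x) x (0, left_inv x w) = w"
    proof (rule vector_derivative_unique)
      show "((\<lambda>t. mul (- x) (mul x (t *\<^sub>R w))) has_vector_derivative Dmul (- x) x (0, left_inv x w)) (at 0)"
        using has_vector_derivative_mul[OF has_vector_derivative_const[of "- x"] left_inv_derivative[of x w]] by simp
      show "((\<lambda>t. mul (- x) (mul x (t *\<^sub>R w))) has_vector_derivative w) (at 0)"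
        using ray_derivative[of w 0] by simp
    qed
    ultimately show ?thesis by simp
  qed
  have "((\<lambda>t. l (mul a (t *\<^sub>R b)) - t * l b) has_vector_derivative 0) (at t)" for t
  proof -
    have "((\<lambda>t. l (mul a (t *\<^sub>R b))) has_vector_derivative l (left_inv (mul a (t *\<^sub>R b)) b)) (at t)"
      by (rule bounded_linear.has_vector_derivative[OF bl left_inv_derivative_at])
    moreover have "l (left_inv (mul a (t *\<^sub>R b)) b) = l b"
      by (intro left closed a b subspace_scale[OF h])
    moreover have "((\<lambda>t. t * l b) has_vector_derivative l b) (at t)" by (auto intro!: derivative_eq_intros)
    ultimately show ?thesis using has_vector_derivative_diff by fastforce
  qed
  from constant_of_zero_derivative[OF this, of 1] show ?thesis by simp
qed

end

subsection \<open>Stratified groups\<close>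

text \<open>A pair is deleted only when one of its elements is output, and every pair left at the
  end contributes an element: the output is a vertex cover.\<close>

lemma greedy_hits: "greedy B P S \<Longrightarrow> e \<in> P \<Longrightarrow> e \<inter> S \<noteq> {}"
  by (induction rule: greedy.induct) blast+

text \<open>A chosen element has positive degree, so an index that lies in no pair, like that of a
  central element, is never output.\<close>

lemma greedy_subset: "greedy B P S \<Longrightarrow> S \<subseteq> \<Union>P"
proof (induction rule: greedy.induct)
  case (step i B P S)
  have "{e \<in> P. i \<in> e} \<noteq> {}" using step(2) unfolding pdeg_def by (metis card.empty not_numeral_le_zero)
  then show ?case using step by blast
qed blast

section \<open>Strata, coordinate functionals and degree counting\<close>

locale stratified_group = exp_group mul br
  for mul br :: "'v::euclidean_space \<Rightarrow> 'v \<Rightarrow> 'v" +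
  fixes m p :: nat and V :: "nat \<Rightarrow> 'v set" and X :: "nat \<Rightarrow> 'v"
  assumes strat: "stratified br m V"
    and X_inj: "inj_on X {1..p}" and X_indep: "independent (X ` {1..p})" and X_span: "span (X ` {1..p}) = V 1"
begin

lemma V_subspace: "j \<in> {1..m+1} \<Longrightarrow> subspace (V j)"
  and V_decomp: "\<exists>!vs. (\<forall>j\<in>{1..m+1}. vs j \<in> V j) \<and> (\<forall>j. j \<notin> {1..m+1} \<longrightarrow> vs j = 0) \<and> x = (\<Sum>j=1..m+1. vs j)"
  and V_bracket: "i \<in> {1..m+1} \<Longrightarrow> j \<in> {1..m+1} \<Longrightarrow> i + j \<le> m + 1 \<Longrightarrow> y \<in> V i \<Longrightarrow> z \<in> V j \<Longrightarrow> br y z \<in> V (i + j)"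
  and V_bracket_0: "i \<in> {1..m+1} \<Longrightarrow> j \<in> {1..m+1} \<Longrightarrow> i + j > m + 1 \<Longrightarrow> y \<in> V i \<Longrightarrow> z \<in> V j \<Longrightarrow> br y z = 0"
  using strat unfolding stratified_def by (blast, blast, blast, blast)

text \<open>All brackets lie here, so every linear form that vanishes on this space is additive on
  the whole group.\<close>

definition V_ge2 :: "'v set" where
  "V_ge2 = {\<Sum>j=2..m+1. vs j | vs. \<forall>j\<in>{2..m+1}. vs j \<in> V j}"

lemma V_ge2_subspace: "subspace V_ge2"
  unfolding subspace_def
proof (intro conjI ballI allI)
  show "0 \<in> V_ge2" unfolding V_ge2_def
    by (intro CollectI exI[of _ "\<lambda>_. 0"]) (auto intro: subspace_0[OF V_subspace])
next
  fix x y assume "x \<in> V_ge2" "y \<in> V_ge2"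
  then obtain a b where "\<forall>j\<in>{2..m+1}. a j \<in> V j" "\<forall>j\<in>{2..m+1}. b j \<in> V j" "x = (\<Sum>j=2..m+1. a j)" "y = (\<Sum>j=2..m+1. b j)"
    unfolding V_ge2_def by blast
  then show "x + y \<in> V_ge2" unfolding V_ge2_def
    by (intro CollectI exI[of _ "\<lambda>j. a j + b j"]) (auto simp: sum.distrib intro: subspace_add[OF V_subspace])
next
  fix c x assume "x \<in> V_ge2"
  then obtain a where "\<forall>j\<in>{2..m+1}. a j \<in> V j" "x = (\<Sum>j=2..m+1. a j)"
    unfolding V_ge2_def by blast
  then show "c *\<^sub>R x \<in> V_ge2" unfolding V_ge2_def
    by (intro CollectI exI[of _ "\<lambda>j. c *\<^sub>R a j"]) (auto simp: scaleR_sum_right simp del: sum.cl_ivl_Suc intro: subspace_scale[OF V_subspace])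
qed

lemma V_in_V_ge2:
  assumes "j \<in> {2..m+1}" "x \<in> V j" shows "x \<in> V_ge2"
proof -
  have "(\<Sum>i=2..m+1. if i = j then x else 0) = x" using assms(1) by simp
  moreover have "(if i = j then x else 0) \<in> V i" if "i \<in> {2..m+1}" for i
    using assms that by (auto intro: subspace_0[OF V_subspace])
  ultimately show ?thesis unfolding V_ge2_def
    by (intro CollectI exI[of _ "\<lambda>i. if i = j then x else 0"] conjI ballI) (simp_all only:)
qed

lemma split_V1:
  obtains a b where "a \<in> V 1" "b \<in> V_ge2" "x = a + b"
proof -
  obtain vs where vs: "\<forall>j\<in>{1..m+1}. vs j \<in> V j" "x = (\<Sum>j=1..m+1. vs j)" using V_decomp[of x] by blast
  have "(\<Sum>j=1..m+1. vs j) = vs 1 + (\<Sum>j=2..m+1. vs j)"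
    by (subst sum.atLeast_Suc_atMost) (auto simp: numeral_2_eq_2)
  moreover have "(\<Sum>j=2..m+1. vs j) \<in> V_ge2" unfolding V_ge2_def using vs(1) by auto
  moreover have "vs 1 \<in> V 1" using vs(1) by auto
  ultimately show thesis using that vs(2) by metis
qed

lemma V1_Int_V_ge2:
  assumes "x \<in> V 1" "x \<in> V_ge2" shows "x = 0"
proof -
  obtain b where b: "\<forall>j\<in>{2..m+1}. b j \<in> V j" "x = (\<Sum>j=2..m+1. b j)" using assms(2) unfolding V_ge2_def by blast
  define v1 where "v1 j = (if j = 1 then x else 0)" for j :: nat
  define v2 where "v2 j = (if j \<in> {2..m+1} then b j else 0)" for j
  have "(\<forall>j\<in>{1..m+1}. v1 j \<in> V j) \<and> (\<forall>j. j \<notin> {1..m+1} \<longrightarrow> v1 j = 0) \<and> x = (\<Sum>j=1..m+1. v1 j)"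
    unfolding v1_def using assms(1) by (auto intro: subspace_0[OF V_subspace])
  moreover have "(\<forall>j\<in>{1..m+1}. v2 j \<in> V j) \<and> (\<forall>j. j \<notin> {1..m+1} \<longrightarrow> v2 j = 0) \<and> x = (\<Sum>j=1..m+1. v2 j)"
  proof (intro conjI ballI allI impI)
    show "v2 j \<in> V j" if "j \<in> {1..m+1}" for j using b(1) that by (auto simp: v2_def intro: subspace_0[OF V_subspace])
    show "v2 j = 0" if "j \<notin> {1..m+1}" for j using that by (auto simp: v2_def)
    have "(\<Sum>j=1..m+1. v2 j) = v2 1 + (\<Sum>j=2..m+1. v2 j)"
      by (subst sum.atLeast_Suc_atMost) (auto simp: numeral_2_eq_2)
    also have "\<dots> = (\<Sum>j=2..m+1. b j)" by (simp add: v2_def)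
    finally show "x = (\<Sum>j=1..m+1. v2 j)" using b(2) by simp
  qed
  ultimately have "v1 = v2" using V_decomp[of x] by blast
  from fun_cong[OF this, of 1] show ?thesis by (simp add: v1_def v2_def)
qed

lemma bracket_in_V_ge2: "br x y \<in> V_ge2"
proof -
  obtain a where a: "\<forall>j\<in>{1..m+1}. a j \<in> V j" "x = (\<Sum>j=1..m+1. a j)" using V_decomp[of x] by blast
  obtain b where b: "\<forall>j\<in>{1..m+1}. b j \<in> V j" "y = (\<Sum>j=1..m+1. b j)" using V_decomp[of y] by blast
  have E: "br x y = (\<Sum>i=1..m+1. \<Sum>j=1..m+1. br (a i) (b j))"
    unfolding a(2) b(2) linear_sum[OF bracket_linear] linear_sum[OF bracket_linear_left] by (rule sum.swap)
  have "br (a i) (b j) \<in> V_ge2" if "i \<in> {1..m+1}" "j \<in> {1..m+1}" for i j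
  proof (cases "i + j \<le> m + 1")
    case True
    then show ?thesis using that a b by (intro V_in_V_ge2[of "i + j"] V_bracket) auto
  next
    case False
    then show ?thesis using that a b V_bracket_0[of i j] by (simp add: subspace_0[OF V_ge2_subspace])
  qed
  then show ?thesis unfolding E by (intro subspace_sum[OF V_ge2_subspace])
qed

lemma bracket_V_ge2_V_ge2:
  assumes l: "linear l" and l_brk: "\<forall>k\<in>{2..m+1}. \<forall>j\<in>{2..m+1}. \<forall>x\<in>V k. \<forall>y\<in>V j. l (br x y) = (0::real)"
    and x: "x \<in> V_ge2" and y: "y \<in> V_ge2"
  shows "l (br x y) = 0"
proof -
  obtain a where a: "\<forall>j\<in>{2..m+1}. a j \<in> V j" "x = (\<Sum>j=2..m+1. a j)" using x unfolding V_ge2_def by blast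
  obtain b where b: "\<forall>j\<in>{2..m+1}. b j \<in> V j" "y = (\<Sum>j=2..m+1. b j)" using y unfolding V_ge2_def by blast
  have "l (br x y) = (\<Sum>j=2..m+1. \<Sum>i=2..m+1. l (br (a i) (b j)))"
    unfolding a(2) b(2) linear_sum[OF bracket_linear] linear_sum[OF bracket_linear_left] linear_sum[OF l] ..
  also have "\<dots> = 0" using a(1) b(1) l_brk by (intro sum.neutral ballI) blast
  finally show ?thesis .
qed

lemma V1_combination:
  assumes "x \<in> V 1" obtains c where "x = (\<Sum>i=1..p. c i *\<^sub>R X i)"
proof -
  have "x \<in> range (\<lambda>u. \<Sum>v\<in>X ` {1..p}. u v *\<^sub>R v)" using assms X_span span_finite[of "X ` {1..p}"] by auto
  then obtain u where "x = (\<Sum>v\<in>X ` {1..p}. u v *\<^sub>R v)" by blast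
  then have "x = (\<Sum>i=1..p. u (X i) *\<^sub>R X i)" by (simp only: sum.reindex[OF X_inj] o_def)
  then show thesis by (rule that)
qed

lemma X_in_V1: "i \<in> {1..p} \<Longrightarrow> X i \<in> V 1"
  unfolding X_span[symmetric] by (intro span_base) auto

text \<open>The functional is the inner product with the component of \<open>X j\<close> orthogonal
  to the other basis vectors and to \<open>V_ge2\<close>, suitably normalised. That component is
  nonzero by independence and because \<open>V 1\<close> meets \<open>V_ge2\<close> in 0
  only.\<close>

lemma dual_coordinate:
  assumes j: "j \<in> {1..p}"
  obtains \<xi> where "linear \<xi>" "\<And>i. i \<in> {1..p} \<Longrightarrow> \<xi> (X i) = (if i = j then 1 else (0::real))" "\<And>y. y \<in> V_ge2 \<Longrightarrow> \<xi> y = 0"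
proof -
  let ?A = "X ` ({1..p} - {j})"
  let ?W = "?A \<union> V_ge2"
  have notin: "X j \<notin> span ?W"
  proof
    assume "X j \<in> span ?W"
    then obtain a b where ab: "a \<in> span ?A" "b \<in> V_ge2" "X j = a + b"
      unfolding span_Un using V_ge2_subspace by (auto simp: span_eq_iff[THEN iffD2])
    have "span ?A \<subseteq> V 1" unfolding X_span[symmetric] by (intro span_mono) auto
    then have "a \<in> V 1" using ab(1) by blast
    then have "X j - a \<in> V 1" using X_in_V1[OF j] V_subspace[of 1] by (auto intro: subspace_diff)
    then have "b \<in> V 1" using ab(3) by simp
    then have "b = 0" using ab(2) V1_Int_V_ge2 by blast
    then have "X j = a" using ab(3) by simp
    then have "X j \<in> span ?A" using ab(1) by simp
    moreover have "?A = X ` {1..p} - {X j}"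
      using inj_on_image_set_diff[OF X_inj, of "{1..p}" "{j}"] j by simp
    ultimately have "\<exists>a\<in>X ` {1..p}. a \<in> span (X ` {1..p} - {a})"
      using j by (intro bexI[of _ "X j"]) (simp_all only: imageI)
    then show False using X_indep unfolding dependent_def by blast
  qed
  obtain y z where yz: "y \<in> span ?W" "\<And>w. w \<in> span ?W \<Longrightarrow> orthogonal z w" "X j = y + z"
    using orthogonal_subspace_decomp_exists[of ?W "X j"] by metis
  have z0: "z \<noteq> 0" using notin yz by auto
  have yz0: "y \<bullet> z = 0" using yz(1,2) by (simp add: orthogonal_def inner_commute)
  define \<xi> where "\<xi> x = (x \<bullet> z) / (z \<bullet> z)" for x
  show thesis
  proof (rule that[of \<xi>])
    show "linear \<xi>" unfolding \<xi>_def by (intro linearI) (auto simp: inner_add_left add_divide_distrib)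
    have W0: "\<xi> w = 0" if "w \<in> ?W" for w
      using yz(2)[OF span_base[OF that]] by (simp add: \<xi>_def orthogonal_def inner_commute)
    show "\<xi> (X i) = (if i = j then 1 else 0)" if "i \<in> {1..p}" for i
    proof (cases "i = j")
      case True
      then show ?thesis using z0 yz0 yz(3) by (simp add: \<xi>_def inner_add_left)
    next
      case False
      then show ?thesis using W0[of "X i"] that by auto
    qed
    show "\<xi> y = 0" if "y \<in> V_ge2" for y using W0 that by auto
  qed
qed

lemma ad_power_V:
  assumes x: "x \<in> V 1" and y: "y \<in> V j" and j: "j \<in> {1..m+1}"
  shows "j + k \<le> m + 1 \<Longrightarrow> (br x ^^ k) y \<in> V (j + k)" "j + k > m + 1 \<Longrightarrow> (br x ^^ k) y = 0"
proof (induction k)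
  case 0
  {
    case 1 then show ?case using y by simp
  next
    case 2 then show ?case using j by simp
  }
next
  case (Suc k)
  {
    case 1
    then have "(br x ^^ k) y \<in> V (j + k)" using Suc(1) by simp
    then show ?case using V_bracket[of 1 "j + k"] x j 1 by simp
  next
    case 2
    show ?case
    proof (cases "j + k \<le> m + 1")
      case True
      then have "(br x ^^ k) y \<in> V (j + k)" using Suc(1) by simp
      then show ?thesis using V_bracket_0[of 1 "j + k"] x j 2 True by simp
    next
      case False
      then show ?thesis using Suc(2) by (simp add: linear_0[OF bracket_linear])
    qed
  }
qed

text \<open>Only the component of degree \<open>m + 1\<close> is seen by \<open>l\<close>, which forces homogeneity of degree \<open>m\<close>.\<close>
lemma Ad_polynomial:
  assumes l: "linear l" and l_low: "\<forall>i\<in>{1..m}. \<forall>x\<in>V i. l x = (0::real)"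
    and x: "x \<in> V 1" and y: "y \<in> V 1" and w: "w \<in> V 1"
  shows "l (Ad (s *\<^sub>R x) (Ad (t *\<^sub>R y) w)) =
    hom_poly (\<lambda>a. l ((br x ^^ a) ((br y ^^ (m - a)) w)) / (fact a * fact (m - a))) m s t"
proof -
  let ?B = "\<lambda>a k. (br x ^^ a) ((br y ^^ k) w)"
  \<comment> \<open>The bracket has degree 1 + a + k: below m + 1 the form \<open>l\<close> vanishes
    on it, above m + 1 it is zero itself.\<close>
  have B: "l (?B a k) = 0" if "a + k \<noteq> m" for a k
  proof (cases "1 + k \<le> m + 1")
    case True
    then have k: "(br y ^^ k) w \<in> V (1 + k)" using ad_power_V(1)[OF y w, of k] by simp
    show ?thesis
    proof (cases "1 + k + a \<le> m + 1")
      case True2: True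
      then have "?B a k \<in> V (1 + k + a)" using ad_power_V(1)[OF x k, of a] by simp
      then show ?thesis using l_low True2 that by auto
    next
      case False
      then show ?thesis using ad_power_V(2)[OF x k, of a] True by (simp add: linear_0[OF l])
    qed
  next
    case False
    then have "(br y ^^ k) w = 0" using ad_power_V(2)[OF y w, of k] by simp
    moreover have "(br x ^^ a) 0 = 0" by (induction a) (simp_all add: linear_0[OF bracket_linear])
    ultimately show ?thesis by (simp add: linear_0[OF l])
  qed
  have nil_y: "(br y ^^ (m + 1)) w = 0" using ad_power_V(2)[OF y w, of "m + 1"] by simp
  have nil_x: "?B (m + 1) k = 0" for k
  proof (cases "1 + k \<le> m + 1")
    case True
    then have "(br y ^^ k) w \<in> V (1 + k)" using ad_power_V(1)[OF y w, of k] by simp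
    then show ?thesis using ad_power_V(2)[OF x, of _ "1 + k" "m + 1"] True by simp
  next
    case False
    then have "(br y ^^ k) w = 0" using ad_power_V(2)[OF y w, of k] by simp
    moreover have "(br x ^^ a) 0 = 0" for a by (induction a) (simp_all add: linear_0[OF bracket_linear])
    ultimately show ?thesis by (simp add: linear_0[OF bracket_linear])
  qed
  have "l (Ad (s *\<^sub>R x) (Ad (t *\<^sub>R y) w)) =
      (\<Sum>k<m+1. (t ^ k / fact k) * (\<Sum>a<m+1. (s ^ a / fact a) * l (?B a k)))"
    unfolding Ad_nilpotent[OF nil_y] linear_sum[OF Ad_linear] linear_cmul[OF Ad_linear] linear_sum[OF l] linear_cmul[OF l]
    by (subst Ad_nilpotent[OF nil_x]) (simp only: linear_sum[OF l] linear_cmul[OF l] real_scaleR_def)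
  also have "\<dots> = (\<Sum>k\<le>m. \<Sum>a\<le>m. (t ^ k / fact k) * ((s ^ a / fact a) * l (?B a k)))"
    by (simp add: sum_distrib_left lessThan_Suc_atMost)
  also have "\<dots> = (\<Sum>a\<le>m. \<Sum>k\<le>m. (t ^ k / fact k) * ((s ^ a / fact a) * l (?B a k)))" by (rule sum.swap)
  also have "\<dots> = (\<Sum>a\<le>m. l (?B a (m - a)) / (fact a * fact (m - a)) * (s ^ a * t ^ (m - a)))"
  proof (rule sum.cong[OF refl])
    fix a assume a: "a \<in> {..m}"
    have "(\<Sum>k\<le>m. (t ^ k / fact k) * ((s ^ a / fact a) * l (?B a k))) =
      (\<Sum>k\<in>{m - a}. (t ^ k / fact k) * ((s ^ a / fact a) * l (?B a k)))"
    proof (rule sum.mono_neutral_right)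
      show "\<forall>k\<in>{..m} - {m - a}. (t ^ k / fact k) * ((s ^ a / fact a) * l (?B a k)) = 0"
      proof
        fix k assume "k \<in> {..m} - {m - a}"
        then have "l (?B a k) = 0" using a by (intro B) auto
        then show "(t ^ k / fact k) * ((s ^ a / fact a) * l (?B a k)) = 0" by simp
      qed
    qed auto
    then show "(\<Sum>k\<le>m. (t ^ k / fact k) * ((s ^ a / fact a) * l (?B a k))) =
      l (?B a (m - a)) / (fact a * fact (m - a)) * (s ^ a * t ^ (m - a))" by (simp add: mult_ac)
  qed
  finally show ?thesis unfolding hom_poly_def .
qed

end

lemma Ck_on_subset: "Ck_on n V f \<Longrightarrow> U \<subseteq> V \<Longrightarrow> Ck_on n U f"
  by (induction n arbitrary: f) (auto intro: differentiable_on_subset)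

subsection \<open>The Gevrey solution\<close>

text \<open>The flow of \<open>v\<close> is mapped to a straight line whose velocity
  \<open>(P x, e)\<close> is constant along that flow. Hence the second derivative is a pure
  second-order expression in the jet, without first-order terms.\<close>

lemma second_derivative_along:
  fixes W :: "nat \<Rightarrow> 3 list \<Rightarrow> real \<times> (real^3) \<Rightarrow> real" and \<Phi> :: "'v::euclidean_space \<Rightarrow> real \<times> (real^3)"
  assumes der: "\<And>j is x. snd x \<in> open_cube \<Longrightarrow> (W j is has_derivative
       (\<lambda>v. fst v * W (Suc j) is x + (\<Sum>i\<in>UNIV. snd v $ i * W j (i # is) x))) (at x)"
    and tr: "\<And>y t. \<Phi> (mul y (t *\<^sub>R v)) = \<Phi> y + t *\<^sub>R (P y, e)"
    and P: "\<And>t. P (mul x (t *\<^sub>R v)) = P x"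
    and mul_0: "mul x 0 = x"
    and x: "snd (\<Phi> x) \<in> open_cube"
  shows "lvf mul v (lvf mul v (\<lambda>x. W 0 [] (\<Phi> x))) x =
    P x * (P x * W (Suc (Suc 0)) [] (\<Phi> x) + (\<Sum>k\<in>UNIV. e $ k * W (Suc 0) [k] (\<Phi> x))) +
    (\<Sum>k\<in>UNIV. e $ k * (P x * W (Suc 0) [k] (\<Phi> x) + (\<Sum>l\<in>UNIV. e $ l * W 0 [l, k] (\<Phi> x))))"
proof -
  have D: "((\<lambda>t. W j is (\<Phi> (mul y (t *\<^sub>R v)))) has_real_derivative
      (P y * W (Suc j) is (\<Phi> y) + (\<Sum>k\<in>UNIV. e $ k * W j (k # is) (\<Phi> y)))) (at 0)"
    if y: "snd (\<Phi> y) \<in> open_cube" for j "is" y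
  proof -
    let ?L = "\<lambda>v. fst v * W (Suc j) is (\<Phi> y) + (\<Sum>i\<in>UNIV. snd v $ i * W j (i # is) (\<Phi> y))"
    have "((\<lambda>t. \<Phi> y + t *\<^sub>R (P y, e)) has_derivative (\<lambda>h. h *\<^sub>R (P y, e))) (at 0)"
      by (auto intro!: derivative_eq_intros)
    moreover have "(W j is has_derivative ?L) (at (\<Phi> y + 0 *\<^sub>R (P y, e)))"
      unfolding scaleR_zero_left add_0_right by (rule der[OF y])
    ultimately have "((\<lambda>t. W j is (\<Phi> y + t *\<^sub>R (P y, e))) has_derivative (\<lambda>h. ?L (h *\<^sub>R (P y, e)))) (at 0)"
      by (rule has_derivative_compose)
    moreover have "?L (h *\<^sub>R (P y, e)) = (P y * W (Suc j) is (\<Phi> y) + (\<Sum>k\<in>UNIV. e $ k * W j (k # is) (\<Phi> y))) * h" for h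
      by (simp add: algebra_simps sum_distrib_left)
    ultimately have "((\<lambda>t. W j is (\<Phi> y + t *\<^sub>R (P y, e))) has_real_derivative
      (P y * W (Suc j) is (\<Phi> y) + (\<Sum>k\<in>UNIV. e $ k * W j (k # is) (\<Phi> y)))) (at 0)"
      unfolding has_field_derivative_def by (simp only:)
    then show ?thesis by (simp only: tr)
  qed
  have L1: "lvf mul v (\<lambda>x. W 0 [] (\<Phi> x)) y = P y * W (Suc 0) [] (\<Phi> y) + (\<Sum>k\<in>UNIV. e $ k * W 0 [k] (\<Phi> y))"
    if "snd (\<Phi> y) \<in> open_cube" for y
    unfolding lvf_def by (rule DERIV_imp_deriv[OF D[OF that]])
  have ev: "eventually (\<lambda>t. lvf mul v (\<lambda>x. W 0 [] (\<Phi> x)) (mul x (t *\<^sub>R v)) =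
      P x * W (Suc 0) [] (\<Phi> (mul x (t *\<^sub>R v))) + (\<Sum>k\<in>UNIV. e $ k * W 0 [k] (\<Phi> (mul x (t *\<^sub>R v))))) (nhds 0)"
  proof -
    have "open ((\<lambda>t. snd (\<Phi> x) + t *\<^sub>R e) -` open_cube)"
      by (intro open_vimage open_open_cube continuous_intros)
    from eventually_nhds_in_open[OF this, of 0] x
    have "eventually (\<lambda>t. snd (\<Phi> x) + t *\<^sub>R e \<in> open_cube) (nhds 0)" by simp
    then show ?thesis
    proof eventually_elim
      case (elim t)
      then have "snd (\<Phi> (mul x (t *\<^sub>R v))) \<in> open_cube" by (simp add: tr)
      from L1[OF this] show ?case by (simp only: P)
    qed
  qed
  have "((\<lambda>t. P x * W (Suc 0) [] (\<Phi> (mul x (t *\<^sub>R v))) + (\<Sum>k\<in>UNIV. e $ k * W 0 [k] (\<Phi> (mul x (t *\<^sub>R v)))))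
    has_real_derivative
    P x * (P x * W (Suc (Suc 0)) [] (\<Phi> x) + (\<Sum>k\<in>UNIV. e $ k * W (Suc 0) [k] (\<Phi> x))) +
    (\<Sum>k\<in>UNIV. e $ k * (P x * W (Suc 0) [k] (\<Phi> x) + (\<Sum>l\<in>UNIV. e $ l * W 0 [l, k] (\<Phi> x))))) (at 0)"
    by (intro DERIV_add DERIV_cmult DERIV_sum D[OF x])
  then have "((\<lambda>t. lvf mul v (\<lambda>x. W 0 [] (\<Phi> x)) (mul x (t *\<^sub>R v))) has_real_derivative
    P x * (P x * W (Suc (Suc 0)) [] (\<Phi> x) + (\<Sum>k\<in>UNIV. e $ k * W (Suc 0) [k] (\<Phi> x))) +
    (\<Sum>k\<in>UNIV. e $ k * (P x * W (Suc 0) [k] (\<Phi> x) + (\<Sum>l\<in>UNIV. e $ l * W 0 [l, k] (\<Phi> x))))) (at 0)"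
    using DERIV_cong_ev[OF refl ev refl] by blast
  then show ?thesis unfolding lvf_def[of mul v "lvf mul v _"] by (rule DERIV_imp_deriv)
qed

text \<open>Every derivative of a jet entry is a combination of jet entries with constant
  coefficients, so induction over all entries at once closes.\<close>

lemma jet_smooth_on:
  fixes W :: "nat \<Rightarrow> 3 list \<Rightarrow> real \<times> (real^3) \<Rightarrow> real"
  assumes der: "\<And>j is x. snd x \<in> open_cube \<Longrightarrow> (W j is has_derivative
       (\<lambda>v. fst v * W (Suc j) is x + (\<Sum>i\<in>UNIV. snd v $ i * W j (i # is) x))) (at x)"
  shows "smooth_on (UNIV \<times> open_cube) (W j is)"
proof -
  have o: "open (UNIV \<times> open_cube :: (real \<times> (real^3)) set)" by (intro open_Times open_UNIV open_open_cube)
  have "Ck_on n (UNIV \<times> open_cube) (W j is)" for n j "is"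
  proof (induction n arbitrary: j "is")
    case (Suc n)
    show ?case
    proof (rule Ck_on_SucI[OF o der])
      fix b :: "real \<times> (real^3)"
      show "Ck_on n (UNIV \<times> open_cube) (\<lambda>x. fst b * W (Suc j) is x + (\<Sum>i\<in>UNIV. snd b $ i * W j (i # is) x))"
        by (intro Ck_on_add Ck_on_sum Ck_on_mult Ck_on_const Suc.IH o finite)
    qed auto
  qed simp
  then show ?thesis by (simp add: smooth_on_iff_Ck_on)
qed

theorem theorem3p11:
  fixes mul br :: "'v::euclidean_space \<Rightarrow> 'v \<Rightarrow> 'v"
    and m p q \<beta> :: nat and V :: "nat \<Rightarrow> 'v set"
    and X Z :: "nat \<Rightarrow> 'v" and l2 :: "'v \<Rightarrow> real" and S :: "nat set"
  assumes grp: "exp_coord_group mul br"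
    and m: "m \<ge> 1"
    and strat: "stratified br m V"
    and Xbasis: "inj_on X {1..p}" "independent (X ` {1..p})" "span (X ` {1..p}) = V 1"
    and Zbasis: "inj_on Z {1..q}" "independent (Z ` {1..q})" "span (Z ` {1..q}) = V (m + 1)"
    and beta: "\<beta> \<in> {1..q}"
    and l2_lin: "linear l2"
    and l2_low: "\<forall>i\<in>{1..m}. \<forall>x\<in>V i. l2 x = 0"
    and l2_top: "\<forall>j\<in>{1..q}. l2 (Z j) = (if j = \<beta> then 1 else 0)"
    and l2_brk: "\<forall>k\<in>{2..m+1}. \<forall>j\<in>{2..m+1}. \<forall>x\<in>V k. \<forall>y\<in>V j. l2 (br x y) = 0"
    and S: "S_set br l2 m X p S"
    and center: "\<forall>Y. br (X p) Y = 0"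
    and cardS: "card S = 2"
    and commS: "\<forall>i\<in>S. \<forall>j\<in>S. br (X i) (X j) = 0"
  shows "\<exists>u U. open U \<and> 0 \<in> U \<and> smooth_on U u \<and> (\<forall>x\<in>U. subLap mul X p u x = 0) \<and>
           (\<exists>c C. c > 0 \<and> C > 0 \<and> (\<forall>\<sigma>.
              c ^ (\<sigma> + 1) * fact \<sigma> ^ (m + 1) \<le> \<bar>(deriv ^^ \<sigma>) (\<lambda>a. u (a *\<^sub>R Z \<beta>)) 0\<bar> \<and>
              \<bar>(deriv ^^ \<sigma>) (\<lambda>a. u (a *\<^sub>R Z \<beta>)) 0\<bar> \<le> C ^ (\<sigma> + 1) * fact \<sigma> ^ (m + 1)))"
proof -
  interpret stratified_group mul br m p V X
    using grp strat Xbasis by unfold_locales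
  obtain i1 i2 where i12: "S = {i1, i2}" "i1 \<noteq> i2" using cardS unfolding card_2_iff by blast
  have l2_0: "l2 0 = 0" by (rule linear_0[OF l2_lin])
  have center': "br Y (X p) = 0" for Y using center bracket_antisym[of Y "X p"] by simp
  let ?P0 = "{{k, j} | k j. k \<in> {1..p} \<and> j \<in> {1..p} \<and> l2 (br (X k) (X j)) \<noteq> 0}"
  \<comment> \<open>A central element has zero bracket with everything, so neither form of the
    definition of S can select it; this makes y a coordinate different from s and t.\<close>
  have S_sub: "S \<subseteq> {1..p}" and p_notin: "p \<notin> S"
  proof -
    have "i \<in> {1..p} \<and> i \<noteq> p" if i: "i \<in> S" for i
    proof (cases "m \<ge> 2")
      case True
      then show ?thesis using S i center l2_0 by (auto simp: S_set_def)
    next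
      case False
      then have "greedy {1..p} ?P0 S" using S by (simp add: S_set_def)
      then obtain k j where kj: "i \<in> {k, j}" "k \<in> {1..p}" "j \<in> {1..p}" "l2 (br (X k) (X j)) \<noteq> 0"
        using greedy_subset i by blast
      then have "k \<noteq> p" "j \<noteq> p" using center center' l2_0 by auto
      then show ?thesis using kj by auto
    qed
    then show "S \<subseteq> {1..p}" "p \<notin> S" by auto
  qed
  have i1p: "i1 \<in> {1..p}" "i1 \<noteq> p" and i2p: "i2 \<in> {1..p}" "i2 \<noteq> p" using S_sub p_notin i12 by auto
  have pp: "p \<in> {1..p}" using i1p by auto
  obtain \<xi>1 :: "'v \<Rightarrow> real" where \<xi>1: "linear \<xi>1" "\<And>i. i \<in> {1..p} \<Longrightarrow> \<xi>1 (X i) = (if i = i1 then 1 else 0)" "\<And>y. y \<in> V_ge2 \<Longrightarrow> \<xi>1 y = 0"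
    by (rule dual_coordinate[OF i1p(1)], rule that)
  obtain \<xi>2 :: "'v \<Rightarrow> real" where \<xi>2: "linear \<xi>2" "\<And>i. i \<in> {1..p} \<Longrightarrow> \<xi>2 (X i) = (if i = i2 then 1 else 0)" "\<And>y. y \<in> V_ge2 \<Longrightarrow> \<xi>2 y = 0"
    by (rule dual_coordinate[OF i2p(1)], rule that)
  obtain \<eta> :: "'v \<Rightarrow> real" where \<eta>: "linear \<eta>" "\<And>i. i \<in> {1..p} \<Longrightarrow> \<eta> (X i) = (if i = p then 1 else 0)" "\<And>y. y \<in> V_ge2 \<Longrightarrow> \<eta> y = 0"
    by (rule dual_coordinate[OF pp], rule that)
  \<comment> \<open>Here the subgroup is the whole group: the form kills all brackets, so it is a
    character and is invariant under \<open>Ad\<close>.\<close>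
  have hom: "\<xi> (mul a b) = \<xi> a + \<xi> b" and hom_Ad: "\<xi> (Ad a b) = \<xi> b"
    if "linear \<xi>" "\<And>y. y \<in> V_ge2 \<Longrightarrow> \<xi> y = (0::real)" for \<xi> :: "'v \<Rightarrow> real" and a b
    using additive_on_subgroup[of UNIV \<xi> a b] Ad_invariant(2)[of UNIV \<xi> a b] that bracket_in_V_ge2 by auto
  note hom1 = hom[OF \<xi>1(1,3)] and hom2 = hom[OF \<xi>2(1,3)] and hom\<eta> = hom[OF \<eta>(1,3)]
  define h where "h = {x. \<xi>1 x = 0 \<and> \<xi>2 x = 0}"
  have h: "subspace h" unfolding h_def
    by (auto simp: subspace_def linear_0[OF \<xi>1(1)] linear_0[OF \<xi>2(1)] linear_add[OF \<xi>1(1)] linear_add[OF \<xi>2(1)]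
        linear_cmul[OF \<xi>1(1)] linear_cmul[OF \<xi>2(1)])
  have h_mul: "a \<in> h \<Longrightarrow> b \<in> h \<Longrightarrow> mul a b \<in> h" for a b unfolding h_def by (simp add: hom1 hom2)
  have h_split: "\<exists>c y. a = (\<Sum>i\<in>{1..p} - S. c i *\<^sub>R X i) + y \<and> y \<in> V_ge2" if a: "a \<in> h" for a
  proof -
    obtain a1 y where y: "a1 \<in> V 1" "y \<in> V_ge2" "a = a1 + y" using split_V1 by blast
    obtain c where c: "a1 = (\<Sum>i=1..p. c i *\<^sub>R X i)" using V1_combination[OF y(1)] by blast
    have coef: "\<xi> a = c j" if "linear \<xi>" "\<And>i. i \<in> {1..p} \<Longrightarrow> \<xi> (X i) = (if i = j then 1 else 0)"
      "\<And>y. y \<in> V_ge2 \<Longrightarrow> \<xi> y = (0::real)" "j \<in> {1..p}" for \<xi> :: "'v \<Rightarrow> real" and j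
    proof -
      have "\<xi> a = (\<Sum>i=1..p. c i * \<xi> (X i))"
        unfolding y(3) c using that(1) that(3)[OF y(2)] by (simp add: linear_add linear_sum linear_cmul)
      also have "\<dots> = (\<Sum>i=1..p. if i = j then c i else 0)"
        using that(2) by (intro sum.cong) auto
      finally show ?thesis using that(4) by simp
    qed
    have "c i1 = 0" "c i2 = 0"
      using coef[OF \<xi>1 i1p(1)] coef[OF \<xi>2 i2p(1)] a unfolding h_def by auto
    then have "a1 = (\<Sum>i\<in>{1..p} - S. c i *\<^sub>R X i)"
      unfolding c using i12 by (intro sum.mono_neutral_right) auto
    then show ?thesis using y by blast
  qed
  \<comment> \<open>The defining property of S enters here. For m \<ge> 2 it is immediate. For m = 1
    two indices outside S cannot form a pair, because S is a vertex cover, and brackets with the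
    second stratum vanish by degree.\<close>
  have X_h: "l2 (br (X i) b) = 0" if i: "i \<in> {1..p} - S" and b: "b \<in> h" for i b
  proof (cases "m \<ge> 2")
    case True
    then show ?thesis using S i by (auto simp: S_set_def)
  next
    case False
    then have m1: "m = 1" using m by simp
    have gr: "greedy {1..p} ?P0 S" using S False by (simp add: S_set_def)
    obtain c y where cy: "b = (\<Sum>j\<in>{1..p} - S. c j *\<^sub>R X j) + y" "y \<in> V_ge2" using h_split[OF b] by blast
    have "l2 (br (X i) (X j)) = 0" if j: "j \<in> {1..p} - S" for j
    proof (rule ccontr)
      assume "l2 (br (X i) (X j)) \<noteq> 0"
      then have "{i, j} \<in> ?P0" using i j by blast
      from greedy_hits[OF gr this] show False using i j by auto
    qed
    moreover have "br (X i) y = 0"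
    proof -
      have "y \<in> V 2" using cy(2) m1 unfolding V_ge2_def by (auto simp: numeral_2_eq_2)
      then show ?thesis using V_bracket_0[of 1 2 "X i" y] X_in_V1[of i] i m1 by auto
    qed
    ultimately show ?thesis
      unfolding cy(1) linear_add[OF bracket_linear] linear_sum[OF bracket_linear] linear_cmul[OF bracket_linear]
        linear_add[OF l2_lin] linear_sum[OF l2_lin] linear_cmul[OF l2_lin] by (simp add: l2_0)
  qed
  have V_ge2_h: "y \<in> h" if "y \<in> V_ge2" for y using that \<xi>1(3) \<xi>2(3) by (simp add: h_def)
  \<comment> \<open>Together with the assumption on brackets of strata of degree at least 2, this
    makes \<open>l2\<close> a character of the subgroup \<open>h\<close>.\<close>
  have br_h: "l2 (br a b) = 0" if a: "a \<in> h" and b: "b \<in> h" for a b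
  proof -
    obtain c y where cy: "a = (\<Sum>j\<in>{1..p} - S. c j *\<^sub>R X j) + y" "y \<in> V_ge2" using h_split[OF a] by blast
    obtain d z where dz: "b = (\<Sum>j\<in>{1..p} - S. d j *\<^sub>R X j) + z" "z \<in> V_ge2" using h_split[OF b] by blast
    have 1: "l2 (br (\<Sum>j\<in>{1..p} - S. c j *\<^sub>R X j) w) = 0" if "w \<in> h" for w c
      unfolding linear_sum[OF bracket_linear_left] linear_cmul[OF bracket_linear_left]
        linear_sum[OF l2_lin] linear_cmul[OF l2_lin] using X_h that by (intro sum.neutral) auto
    have "l2 (br y b) = 0"
    proof -
      have "l2 (br y (\<Sum>j\<in>{1..p} - S. d j *\<^sub>R X j)) = - l2 (br (\<Sum>j\<in>{1..p} - S. d j *\<^sub>R X j) y)"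
        using bracket_antisym[of y] by (simp add: linear_neg[OF l2_lin])
      moreover have "l2 (br y z) = 0" by (rule bracket_V_ge2_V_ge2[OF l2_lin l2_brk cy(2) dz(2)])
      ultimately show ?thesis unfolding dz(1) linear_add[OF bracket_linear] linear_add[OF l2_lin]
        using 1[OF V_ge2_h[OF cy(2)]] by simp
    qed
    moreover have "l2 (br (\<Sum>j\<in>{1..p} - S. c j *\<^sub>R X j) b) = 0" by (rule 1[OF b])
    ultimately show ?thesis unfolding cy(1) linear_add[OF bracket_linear_left] linear_add[OF l2_lin] by simp
  qed
  have l2_mul: "l2 (mul a b) = l2 a + l2 b" if "a \<in> h" "b \<in> h" for a b
    by (rule additive_on_subgroup[OF h h_mul l2_lin br_h that])
  \<comment> \<open>Solves x = H x * exp(\<xi>1 x X i1) * exp(\<xi>2 x X i2), a factorisation with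
    the subgroup part on the left.\<close>
  define H where "H x = mul (mul x (- (\<xi>2 x *\<^sub>R X i2))) (- (\<xi>1 x *\<^sub>R X i1))" for x
  define \<theta> where "\<theta> x = l2 (H x)" for x
  have H_h: "H x \<in> h" for x
    unfolding h_def H_def using i1p i2p i12(2)
    by (simp add: hom1 hom2 linear_neg[OF \<xi>1(1)] linear_neg[OF \<xi>2(1)] linear_cmul[OF \<xi>1(1)] linear_cmul[OF \<xi>2(1)] \<xi>1(2) \<xi>2(2))
  define c where "c i a = l2 ((br (X i1) ^^ a) ((br (X i2) ^^ (m - a)) (X i))) / (fact a * fact (m - a))" for i a
  have poly: "l2 (Ad (s *\<^sub>R X i1) (Ad (t *\<^sub>R X i2) (X i))) = hom_poly (c i) m s t" if "i \<in> {1..p}" for i s t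
    using Ad_polynomial[OF l2_lin l2_low X_in_V1[OF i1p(1)] X_in_V1[OF i2p(1)] X_in_V1[OF that]] by (simp add: c_def[abs_def])
  \<comment> \<open>The central direction is fixed by every \<open>Ad\<close> and lies in the first
    stratum, where \<open>l2\<close> vanishes: it moves y without moving theta.\<close>
  have poly_p: "hom_poly (c p) m s t = 0" for s t
  proof -
    have "Ad (s *\<^sub>R X i1) (Ad (t *\<^sub>R X i2) (X p)) = X p" by (simp add: Ad_of_commuting center')
    moreover have "l2 (X p) = 0" using l2_low[rule_format, of 1 "X p"] X_in_V1[OF pp] m by simp
    ultimately show ?thesis using poly[OF pp, of s t] by simp
  qed
  have comm: "br (X i2) (X i1) = 0" using commS i12 by blast
  \<comment> \<open>Translation by \<open>X i1\<close> has to pass the factor in direction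
    \<open>X i2\<close> before it is absorbed; this is where commutation of the two elements of S is
    used.\<close>
  have tr1: "\<theta> (mul x (t *\<^sub>R X i1)) = \<theta> x" for x t
  proof -
    have "mul (- (\<xi>2 x *\<^sub>R X i2)) (t *\<^sub>R X i1) = mul (t *\<^sub>R X i1) (- (\<xi>2 x *\<^sub>R X i2))"
      using mul_ray_right[of "(- \<xi>2 x) *\<^sub>R X i2" t "X i1"] Ad_of_commuting[OF comm, of "- \<xi>2 x"] by simp
    then have "mul (t *\<^sub>R X i1) (mul (- (\<xi>2 x *\<^sub>R X i2)) (- ((\<xi>1 x + t) *\<^sub>R X i1))) =
        mul (- (\<xi>2 x *\<^sub>R X i2)) (mul (t *\<^sub>R X i1) (- ((\<xi>1 x + t) *\<^sub>R X i1)))" by (simp only: assoc[symmetric])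
    moreover have "mul (t *\<^sub>R X i1) (- ((\<xi>1 x + t) *\<^sub>R X i1)) = - (\<xi>1 x *\<^sub>R X i1)"
      unfolding scaleR_minus_left[symmetric] ray by simp
    moreover have "\<xi>1 (mul x (t *\<^sub>R X i1)) = \<xi>1 x + t" "\<xi>2 (mul x (t *\<^sub>R X i1)) = \<xi>2 x"
      using i1p i12(2) by (simp_all add: hom1 hom2 linear_cmul[OF \<xi>1(1)] linear_cmul[OF \<xi>2(1)] \<xi>1(2) \<xi>2(2))
    ultimately show ?thesis unfolding \<theta>_def H_def by (simp add: assoc)
  qed
  have tr2: "\<theta> (mul x (t *\<^sub>R X i2)) = \<theta> x" for x t
  proof -
    have "mul (t *\<^sub>R X i2) (- ((\<xi>2 x + t) *\<^sub>R X i2)) = - (\<xi>2 x *\<^sub>R X i2)"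
      unfolding scaleR_minus_left[symmetric] ray by simp
    then have "mul (mul (mul x (t *\<^sub>R X i2)) (- ((\<xi>2 x + t) *\<^sub>R X i2))) w = mul (mul x (- (\<xi>2 x *\<^sub>R X i2))) w" for w
      by (simp add: assoc)
    moreover have "\<xi>2 (mul x (t *\<^sub>R X i2)) = \<xi>2 x + t" "\<xi>1 (mul x (t *\<^sub>R X i2)) = \<xi>1 x"
      using i2p i12(2) by (simp_all add: hom1 hom2 linear_cmul[OF \<xi>1(1)] linear_cmul[OF \<xi>2(1)] \<xi>1(2) \<xi>2(2))
    ultimately show ?thesis unfolding \<theta>_def H_def by (simp only:)
  qed
  have tr3: "\<theta> (mul x (t *\<^sub>R X i)) = \<theta> x + t * hom_poly (c i) m (\<xi>1 x) (\<xi>2 x)" if i: "i \<in> {1..p} - S" for x t i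
  proof -
    have "i \<noteq> i1" "i \<noteq> i2" "i \<in> {1..p}" using i i12 by auto
    then have inv: "\<xi>1 (mul x (t *\<^sub>R X i)) = \<xi>1 x" "\<xi>2 (mul x (t *\<^sub>R X i)) = \<xi>2 x" and z: "\<xi>1 (X i) = 0" "\<xi>2 (X i) = 0"
      by (simp_all add: hom1 hom2 linear_cmul[OF \<xi>1(1)] linear_cmul[OF \<xi>2(1)] \<xi>1(2) \<xi>2(2))
    \<comment> \<open>Translating by \<open>X i\<close> multiplies \<open>H x\<close> on the right
      by the conjugate of exp(t X i) under \<open>E\<close>. The increment of theta is thus t times
      \<open>l2\<close> of \<open>Ad E (X i)\<close>, the polynomial in (s, t).\<close>
    define E where "E = mul (\<xi>1 x *\<^sub>R X i1) (\<xi>2 x *\<^sub>R X i2)"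
    have HE: "H y = mul y (- E)" if "\<xi>1 y = \<xi>1 x" "\<xi>2 y = \<xi>2 x" for y
      unfolding H_def E_def minus_mul that by (simp add: assoc)
    have "H (mul x (t *\<^sub>R X i)) = mul (mul x (t *\<^sub>R X i)) (- E)" by (rule HE[OF inv])
    also have "\<dots> = mul (mul x (- E)) (mul (mul E (t *\<^sub>R X i)) (- E))" by (simp add: assoc)
    also have "\<dots> = mul (H x) (t *\<^sub>R Ad E (X i))" by (simp only: conj_ray HE[OF refl refl])
    finally have eq: "H (mul x (t *\<^sub>R X i)) = mul (H x) (t *\<^sub>R Ad E (X i))" .
    have "t *\<^sub>R Ad E (X i) \<in> h"
      unfolding h_def by (simp add: linear_cmul[OF \<xi>1(1)] linear_cmul[OF \<xi>2(1)] hom_Ad[OF \<xi>1(1,3)] hom_Ad[OF \<xi>2(1,3)] z)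
    then have "\<theta> (mul x (t *\<^sub>R X i)) = \<theta> x + t * l2 (Ad E (X i))"
      unfolding \<theta>_def eq by (simp add: l2_mul[OF H_h] linear_cmul[OF l2_lin])
    then show ?thesis using poly[OF \<open>i \<in> {1..p}\<close>] by (simp add: E_def Ad_mul)
  qed
  define e where "e i = (if i = i1 then axis 1 1 else if i = i2 then axis 2 1 else if i = p then axis 3 1 else (0::real^3))" for i
  define z :: "'v \<Rightarrow> real^3" where "z x = (\<chi> k. if k = 1 then \<xi>1 x else if k = 2 then \<xi>2 x else \<eta> x)" for x
  define P where "P i x = (if i \<in> S then 0 else hom_poly (c i) m (\<xi>1 x) (\<xi>2 x))" for i x
  define \<Phi> where "\<Phi> x = (\<theta> x, z x)" for x
  have z_tr: "z (mul x (t *\<^sub>R X i)) = z x + t *\<^sub>R e i" if "i \<in> {1..p}" for x t i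
    using that i1p i2p i12(2) unfolding z_def e_def vec_eq_iff forall_3
    by (auto simp: hom1 hom2 hom\<eta> linear_cmul[OF \<xi>1(1)] linear_cmul[OF \<xi>2(1)] linear_cmul[OF \<eta>(1)] \<xi>1(2) \<xi>2(2) \<eta>(2) axis_def)
  have \<Phi>_tr: "\<Phi> (mul x (t *\<^sub>R X i)) = \<Phi> x + t *\<^sub>R (P i x, e i)" if "i \<in> {1..p}" for x t i
  proof -
    have "\<theta> (mul x (t *\<^sub>R X i)) = \<theta> x + t * P i x"
      using tr1 tr2 tr3[of i x t] that i12 by (auto simp: P_def)
    then show ?thesis by (simp add: \<Phi>_def z_tr[OF that])
  qed
  have P_tr: "P i (mul x (t *\<^sub>R X i)) = P i x" if "i \<in> {1..p}" for i x t
    using that i12 by (auto simp: P_def hom1 hom2 linear_cmul[OF \<xi>1(1)] linear_cmul[OF \<xi>2(1)] \<xi>1(2) \<xi>2(2))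
  have \<Phi>_smooth: "smooth_map_on UNIV \<Phi>"
  proof -
    have "smooth_map_on UNIV H"
      unfolding H_def
      by (intro smooth_mul smooth_map_on_linear linearI)
         (simp_all add: linear_add[OF \<xi>1(1)] linear_add[OF \<xi>2(1)] linear_cmul[OF \<xi>1(1)] linear_cmul[OF \<xi>2(1)] scaleR_left_distrib)
    then have "smooth_map_on UNIV \<theta>"
      unfolding \<theta>_def[abs_def] by (rule smooth_map_on_compose[OF smooth_map_on_linear[OF l2_lin]])
    moreover have "smooth_map_on UNIV z"
      by (intro smooth_map_on_linear linearI)
         (simp_all add: z_def vec_eq_iff linear_add[OF \<xi>1(1)] linear_add[OF \<xi>2(1)] linear_add[OF \<eta>(1)]
           linear_cmul[OF \<xi>1(1)] linear_cmul[OF \<xi>2(1)] linear_cmul[OF \<eta>(1)])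
    ultimately show ?thesis unfolding \<Phi>_def[abs_def] by (rule smooth_map_on_Pair)
  qed
  have "finite ({1..p} - S)" by simp
  from grushin_solution[OF this, where m = m and c = c] obtain W :: "nat \<Rightarrow> 3 list \<Rightarrow> real \<times> (real^3) \<Rightarrow> real" where
    W: "\<forall>j is x. snd x \<in> open_cube \<longrightarrow> (W j is has_derivative
       (\<lambda>v. fst v * W (Suc j) is x + (\<Sum>i\<in>UNIV. snd v $ i * W j (i # is) x))) (at x)"
    and pde: "\<forall>x. snd x \<in> open_cube \<longrightarrow> (\<Sum>i\<in>UNIV. W 0 [i, i] x) + potential ({1..p} - S) c m (snd x) * W (Suc (Suc 0)) [] x = 0"
    and gev: "\<exists>c C. c > 0 \<and> C > 0 \<and> (\<forall>\<sigma>. c ^ (\<sigma> + 1) * fact \<sigma> ^ (m + 1) \<le> \<bar>W \<sigma> [] 0\<bar> \<and>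
       \<bar>W \<sigma> [] 0\<bar> \<le> C ^ (\<sigma> + 1) * fact \<sigma> ^ (m + 1))"
    by (rule exE) (elim conjE, rule that)
  have der: "(W j is has_derivative
       (\<lambda>v. fst v * W (Suc j) is x + (\<Sum>i\<in>UNIV. snd v $ i * W j (i # is) x))) (at x)"
    if "snd x \<in> open_cube" for j "is" x using W that by blast
  define u where "u x = W 0 [] (\<Phi> x)" for x
  define U where "U = \<Phi> -` (UNIV \<times> open_cube)"
  have cube: "open (UNIV \<times> open_cube :: (real \<times> (real^3)) set)" by (intro open_Times open_UNIV open_open_cube)
  have U_open: "open U" unfolding U_def by (rule open_vimage[OF cube smooth_map_on_continuous[OF \<Phi>_smooth]])
  have U_iff: "x \<in> U \<longleftrightarrow> snd (\<Phi> x) \<in> open_cube" for x by (simp add: U_def mem_Times_iff)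
  \<comment> \<open>\<open>Z \<beta>\<close> lies in the top stratum, where the three coordinate
    functionals vanish and \<open>l2\<close> counts its multiple: the curve is the theta-axis, and
    derivatives along it are the entries \<open>W \<sigma> []\<close>.\<close>
  have \<Phi>_ray: "\<Phi> (a *\<^sub>R Z \<beta>) = (a, 0)" for a
  proof -
    have "Z \<beta> \<in> V (m + 1)" unfolding Zbasis(3)[symmetric] using beta by (intro span_base) auto
    then have "Z \<beta> \<in> V_ge2" using m by (intro V_in_V_ge2[of "m + 1"]) auto
    then have "\<xi>1 (a *\<^sub>R Z \<beta>) = 0" "\<xi>2 (a *\<^sub>R Z \<beta>) = 0" "\<eta> (a *\<^sub>R Z \<beta>) = 0"
      using \<xi>1 \<xi>2 \<eta> by (simp_all add: linear_cmul)
    moreover have "l2 (a *\<^sub>R Z \<beta>) = a" using l2_top beta by (simp add: linear_cmul[OF l2_lin])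
    ultimately show ?thesis by (simp add: \<Phi>_def \<theta>_def H_def z_def vec_eq_iff)
  qed
  have zero_cube: "(0 :: real^3) \<in> open_cube" by (simp add: open_cube_def)
  have "0 \<in> U" using \<Phi>_ray[of 0] zero_cube by (simp add: U_iff)
  moreover have "smooth_on U u"
    unfolding u_def
  proof (rule smooth_on_compose[OF U_open cube _ jet_smooth_on[of W, OF der]])
    show "\<Phi> ` U \<subseteq> UNIV \<times> open_cube" unfolding U_def by auto
    show "smooth_map_on U \<Phi>" using \<Phi>_smooth unfolding smooth_map_on_def smooth_on_iff_Ck_on
      by (blast intro: Ck_on_subset)
  qed
  moreover have "subLap mul X p u x = 0" if x: "x \<in> U" for x
  proof -
    define T where "T i = (if i = i1 then W 0 [1, 1] (\<Phi> x) else if i = i2 then W 0 [2, 2] (\<Phi> x) else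
      if i = p then W 0 [3, 3] (\<Phi> x) else 0)" for i
    have "lvf mul (X i) (lvf mul (X i) u) x = (P i x)\<^sup>2 * W (Suc (Suc 0)) [] (\<Phi> x) + T i" if i: "i \<in> {1..p}" for i
    proof -
      have "lvf mul (X i) (lvf mul (X i) u) x =
        P i x * (P i x * W (Suc (Suc 0)) [] (\<Phi> x) + (\<Sum>k\<in>UNIV. e i $ k * W (Suc 0) [k] (\<Phi> x))) +
        (\<Sum>k\<in>UNIV. e i $ k * (P i x * W (Suc 0) [k] (\<Phi> x) + (\<Sum>l\<in>UNIV. e i $ l * W 0 [l, k] (\<Phi> x))))"
        unfolding u_def[abs_def] using x U_iff
        by (intro second_derivative_along[where \<Phi> = \<Phi> and W = W and e = "e i" and P = "P i", OF der \<Phi>_tr[OF i] P_tr[OF i]]) auto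
      also have "\<dots> = (P i x)\<^sup>2 * W (Suc (Suc 0)) [] (\<Phi> x) + T i"
      \<comment> \<open>The three distinguished fields move z along an axis and leave theta alone;
        every other field moves theta only. Hence no mixed derivatives survive.\<close>
      proof (cases "i = i1 \<or> i = i2 \<or> i = p")
        case True
        then have "P i x = 0" using i12 poly_p by (auto simp: P_def)
        moreover have "(\<Sum>k\<in>UNIV. e i $ k * (\<Sum>l\<in>UNIV. e i $ l * W 0 [l, k] (\<Phi> x))) = T i"
          using True i1p i2p i12(2) by (auto simp: e_def T_def sum_3 axis_def)
        ultimately show ?thesis by simp
      next
        case False
        then show ?thesis by (simp add: e_def T_def power2_eq_square)
      qed
      finally show ?thesis .
    qed
    then have "subLap mul X p u x = (\<Sum>i=1..p. (P i x)\<^sup>2) * W (Suc (Suc 0)) [] (\<Phi> x) + (\<Sum>i=1..p. T i)"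
      unfolding subLap_def by (simp add: sum.distrib sum_distrib_right)
    moreover have "(\<Sum>i=1..p. (P i x)\<^sup>2) = potential ({1..p} - S) c m (snd (\<Phi> x))"
    proof -
      have "(\<Sum>i=1..p. (P i x)\<^sup>2) = (\<Sum>i\<in>{1..p} - S. (P i x)\<^sup>2)"
        by (intro sum.mono_neutral_right) (auto simp: P_def)
      also have "\<dots> = potential ({1..p} - S) c m (snd (\<Phi> x))"
        unfolding potential_def by (intro sum.cong) (auto simp: P_def \<Phi>_def z_def)
      finally show ?thesis .
    qed
    moreover have "(\<Sum>i=1..p. T i) = (\<Sum>i\<in>UNIV. W 0 [i, i] (\<Phi> x))"
    proof -
      have "(\<Sum>i=1..p. T i) = (\<Sum>i\<in>{i1, i2, p}. T i)"
        using i1p i2p pp by (intro sum.mono_neutral_right) (auto simp: T_def)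
      also have "\<dots> = (\<Sum>i\<in>UNIV. W 0 [i, i] (\<Phi> x))"
        using i1p i2p i12(2) by (simp add: T_def sum_3)
      finally show ?thesis .
    qed
    moreover have "(\<Sum>i\<in>UNIV. W 0 [i, i] (\<Phi> x)) + potential ({1..p} - S) c m (snd (\<Phi> x)) * W (Suc (Suc 0)) [] (\<Phi> x) = 0"
      using pde[rule_format, of "\<Phi> x"] x U_iff by blast
    ultimately show ?thesis by (simp only: add.commute)
  qed
  moreover have "(deriv ^^ \<sigma>) (\<lambda>a. u (a *\<^sub>R Z \<beta>)) = (\<lambda>a. W \<sigma> [] (a, 0))" for \<sigma>
  proof (induction \<sigma>)
    case 0
    then show ?case by (simp add: u_def \<Phi>_ray)
  next
    case (Suc \<sigma>)
    have "((\<lambda>a. W \<sigma> [] (a, 0)) has_real_derivative W (Suc \<sigma>) [] (a, 0)) (at a)" for a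
    proof -
      have "((\<lambda>a. (a, 0 :: real^3)) has_derivative (\<lambda>h. (h, 0))) (at a)" by (auto intro!: derivative_eq_intros)
      from has_derivative_compose[OF this der[of "(a, 0)"]] zero_cube
      have "((\<lambda>a. W \<sigma> [] (a, 0)) has_derivative (\<lambda>h. h * W (Suc \<sigma>) [] (a, 0))) (at a)" by simp
      then show ?thesis by (simp add: has_field_derivative_def mult_commute_abs)
    qed
    then have "deriv (\<lambda>a. W \<sigma> [] (a, 0)) = (\<lambda>a. W (Suc \<sigma>) [] (a, 0))" by (intro ext DERIV_imp_deriv)
    then show ?case by (simp add: Suc)
  qed
  then have "(deriv ^^ \<sigma>) (\<lambda>a. u (a *\<^sub>R Z \<beta>)) 0 = W \<sigma> [] 0" for \<sigma> by (simp add: zero_prod_def)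
  ultimately show ?thesis using U_open gev by (intro exI[of _ u] exI[of _ U]) auto
qed

end
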